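(* Let $\rho>1$ and let $F$ be a $\mathbb{C}^N$-valued function that is analytic in $E$ and meromorphic in $E_\rho=\mathrm{int}\,\Gamma_\rho$, with exactly $\mu$ poles $z_1,\dots,z_\mu$ in $E_\rho$, all simple, so that $F(z)=\sum_{s=1}^\mu\frac{v_s}{z-z_s}+\Theta(z)$ with $v_s\in\mathbb{C}^N$ nonzero and $\Theta$ analytic in $E_\rho$. Order the poles so that $\Phi(z_1)\le\Phi(z_2)\le\cdots\le\Phi(z_\mu)\le\rho$. Let $k\ge1$ be fixed and assume $\prod_{i=1}^k(q,v_i)\ne0$. When $k<\mu$, assume in addition that $$\Phi(z_k)<\Phi(z_{k+1})=\cdots=\Phi(z_{k+r})<\begin{cases}\Phi(z_{k+r+1})&\text{if }k+r<\mu,\\ \rho&\text{if }k+r=\mu.\end{cases}$$ Let $z_m^{(p)}$, $m=1,\dots,k$, be the zeros of $V_{p,k}(z)$, labelled so that $\lim_{p\to\infty}z_m^{(p)}=z_m$. (i) When $k<\mu$, for $m=1,\dots,k$, $$z_m^{(p)}-z_m=O\Big(\frac{\Psi_p(z_m)}{\widetilde\Psi_{p,k}}\Big)\quad\text{as }p\to\infty,\qquad |\widetilde\Psi_{p,k}|=\min_{1\le j\le r}|\Psi_p(z_{k+j})|,$$ and consequently $$\limsup_{p\to\infty}|z_m^{(p)}-z_m|^{1/p}\le\frac{\Phi(z_m)}{\Phi(z_{k+1})},\quad m=1,\dots,k.$$ In case $r=1$, and assuming that $T_{1,\dots,m-1,m+1,\dots,k+1}\ne0$, one has the more refined result $$z_m^{(p)}-z_m\sim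 C_m\frac{\Psi_p(z_m)}{\Psi_p(z_{k+1})}\quad\text{as }p\to\infty,$$ $$C_m=(-1)^{k-m}\,\frac{T_{1,\dots,m-1,m+1,\dots,k+1}}{T_{1,\dots,k}}\,(z_{k+1}-z_m)\prod_{\substack{i=1\\ i\ne m}}^k\frac{z_{k+1}-z_i}{z_m-z_i}.$$ (ii) When $k=\mu$, $$\limsup_{p\to\infty}|z_m^{(p)}-z_m|^{1/p}\le\frac{\Phi(z_m)}{\rho},\quad m=1,\dots,k.$$
   Context: Sets and interpolation points. $E$ is a closed and bounded set in the complex plane whose complement $K$ (which includes the point at infinity) has a classical Green's function $g(z)$ with pole at infinity, continuous on $\partial E$ and zero on $\partial E$. Put $\Phi(z)=\exp[g(z)]$ and $\kappa=\mathrm{cap}(E)$, the logarithmic capacity of $E$. For $\sigma>1$, $\Gamma_\sigma$ is the locus $\Phi(z)=\sigma$ and $E_\sigma=\mathrm{int}\,\Gamma_\sigma$ is its interior (so $E\subset E_\sigma$). For each $p\in\{1,2,\dots\}$ there is given a set of interpolation points $\xi^{(p)}_1,\dots,\xi^{(p)}_{p+k}$, not necessarily distinct (equal points being listed consecutively), such that the $\xi_i^{(p)}$ have no limit points in $K$ and $$\lim_{p\to\infty}\Big|\prod_{i=1}^{p+k}(z-\xi_i^{(p)})\Big|^{1/p}=\kappa\,\Phi(z)$$ uniformly in $z$ on every compact subset of $K$. For fixed $p$ write $\xi_i=\xi_i^{(p)}$. The ITEA construction. $(\cdot,\cdot)$ is an inner product on $\mathbb{C}^N$ (linear in its second argument)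 and $q\in\mathbb{C}^N$ is a fixed nonzero vector. Put $\psi_{m,n}(z)=\prod_{r=m}^n(z-\xi_r)$ for $n\ge m\ge1$, $\psi_{m,m-1}(z)=1$, and $\Psi_p(z)=\psi_{1,p+k}(z)$. Let $D_{m,n}=F[\xi_m,\dots,\xi_n]$ be the divided difference of $F$ over $\{\xi_m,\dots,\xi_n\}$ (in the generalized Hermite sense if points coincide), and put $u_{i,j}=(q,D_{j+1,p+i})$. The denominator polynomial is $V_{p,k}(z)=\sum_{j=0}^kc_j\psi_{1,j}(z)$, where $c_k=1$ and $c_0,\dots,c_{k-1}$ solve $\sum_{j=0}^{k-1}u_{i,j}c_j=-u_{i,k}$, $i=1,\dots,k$ (uniquely solvable when $\det(u_{i,j})_{1\le i\le k,\,0\le j\le k-1}\ne0$). Under the hypotheses of the claim, $V_{p,k}$ converges to $\prod_{i=1}^k(z-z_i)$ as $p\to\infty$, so its $k$ zeros can be labelled as in the claim for all large $p$. Determinants. $T_{s_1,\dots,s_k}=\det(\alpha_{i,s_j})_{1\le i,j\le k}$, where $\alpha_{i,s}=(q,v_s)\,\psi_{p+i+1,p+k}(z_s)$; this determinant does not depend on $p$, and $T_{1,\dots,k}\ne0$ under the hypotheses of the claim. *)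

theory Defs
  imports "HOL-Complex_Analysis.Complex_Analysis" "HOL-Library.Landau_Symbols"
    "Jordan_Normal_Form.Determinant"
begin

subsection \<open>Potential theory\<close>

(* gx, gy and gxx, gxy, gyx, gyy are the first and second partial derivatives in x = Re z, y = Im z *)
definition harmonic_on :: "(complex \<Rightarrow> real) \<Rightarrow> complex set \<Rightarrow> bool" where
  "harmonic_on g S \<longleftrightarrow>
     (\<exists>gx gy gxx gxy gyx gyy :: complex \<Rightarrow> real.
        continuous_on S gxx \<and> continuous_on S gxy \<and> continuous_on S gyx \<and> continuous_on S gyy \<and>
        (\<forall>z\<in>S. (g has_derivative (\<lambda>h. gx z * Re h + gy z * Im h)) (at z) \<and>
               (gx has_derivative (\<lambda>h. gxx z * Re h + gxy z * Im h)) (at z) \<and>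
               (gy has_derivative (\<lambda>h. gyx z * Re h + gyy z * Im h)) (at z) \<and>
               gxx z + gyy z = 0))"

(* Only the values of g on the closure of the complement of E matter. For a bounded set E,
   positivity of g forces the complement of E to be connected (maximum principle). *)
definition green_function_at_infinity :: "complex set \<Rightarrow> (complex \<Rightarrow> real) \<Rightarrow> bool" where
  "green_function_at_infinity E g \<longleftrightarrow>
     harmonic_on g (- E) \<and>
     (\<forall>z\<in>- E. 0 < g z) \<and>
     (\<exists>\<gamma>. ((\<lambda>z. g z - ln (cmod z)) \<longlongrightarrow> \<gamma>) at_infinity) \<and>
     continuous_on (closure (- E)) g \<and>
     (\<forall>z\<in>frontier E. g z = 0)"

definition Phi :: "(complex \<Rightarrow> real) \<Rightarrow> complex \<Rightarrow> real" where
  "Phi g z = exp (g z)"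

definition level_locus :: "complex set \<Rightarrow> (complex \<Rightarrow> real) \<Rightarrow> real \<Rightarrow> complex set" where
  "level_locus E g \<sigma> = {z \<in> - E. Phi g z = \<sigma>}"

(* inside collects the points lying in bounded components of the complement of the locus *)
definition level_interior :: "complex set \<Rightarrow> (complex \<Rightarrow> real) \<Rightarrow> real \<Rightarrow> complex set" where
  "level_interior E g \<sigma> = inside (level_locus E g \<sigma>)"

(* lim (min max |r|)^(1/n), the minimum being over monic polynomials r of degree n and the
   maximum over E: the Chebyshev-constant definition of the logarithmic capacity *)
definition log_capacity :: "complex set \<Rightarrow> real" where
  "log_capacity E =
     lim (\<lambda>n. root n (INF r \<in> {r :: complex poly. degree r = n \<and> lead_coeff r = 1}.
                        SUP z\<in>E. cmod (poly r z)))"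

subsection \<open>Vectors in complex N-space\<close>

definition is_inner_product :: "(complex^'n \<Rightarrow> complex^'n \<Rightarrow> complex) \<Rightarrow> bool" where
  "is_inner_product ip \<longleftrightarrow>
     (\<forall>x y w. ip x (y + w) = ip x y + ip x w) \<and>
     (\<forall>x y a. ip x (a *s y) = a * ip x y) \<and>
     (\<forall>x y. ip y x = cnj (ip x y)) \<and>
     (\<forall>x. x \<noteq> 0 \<longrightarrow> 0 < Re (ip x x))"

definition vec_analytic_on :: "(complex \<Rightarrow> complex^'n) \<Rightarrow> complex set \<Rightarrow> bool" where
  "vec_analytic_on f S \<longleftrightarrow> (\<forall>c. (\<lambda>z. vec_nth (f z) c) analytic_on S)"

definition vec_meromorphic_on :: "(complex \<Rightarrow> complex^'n) \<Rightarrow> complex set \<Rightarrow> bool" where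
  "vec_meromorphic_on f S \<longleftrightarrow> (\<forall>c. (\<lambda>z. vec_nth (f z) c) meromorphic_on S)"

subsection \<open>Interpolation points\<close>

(* A configuration is xi p i with p \<ge> 1 and 1 \<le> i \<le> p + k. A limit point is approached by points
   of the p-th sets for infinitely many p; the point at infinity is treated separately. *)
definition limit_point_of_sets :: "nat \<Rightarrow> (nat \<Rightarrow> nat \<Rightarrow> complex) \<Rightarrow> complex \<Rightarrow> bool" where
  "limit_point_of_sets k xi z \<longleftrightarrow>
     (\<forall>e>0. \<exists>\<^sub>F p in sequentially. \<exists>i\<in>{1..p+k}. dist (xi p i) z < e)"

definition infinity_limit_point_of_sets :: "nat \<Rightarrow> (nat \<Rightarrow> nat \<Rightarrow> complex) \<Rightarrow> bool" where
  "infinity_limit_point_of_sets k xi \<longleftrightarrow>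
     (\<forall>R. \<exists>\<^sub>F p in sequentially. \<exists>i\<in>{1..p+k}. cmod (xi p i) > R)"

definition equal_points_consecutive :: "nat \<Rightarrow> (nat \<Rightarrow> complex) \<Rightarrow> bool" where
  "equal_points_consecutive n x \<longleftrightarrow>
     (\<forall>i j l. 1 \<le> i \<and> i \<le> j \<and> j \<le> l \<and> l \<le> n \<and> x i = x l \<longrightarrow> x j = x i)"

definition psi :: "(nat \<Rightarrow> complex) \<Rightarrow> nat \<Rightarrow> nat \<Rightarrow> complex \<Rightarrow> complex" where
  "psi x m n z = (\<Prod>r=m..n. z - x r)"

definition Psi :: "nat \<Rightarrow> (nat \<Rightarrow> nat \<Rightarrow> complex) \<Rightarrow> nat \<Rightarrow> complex \<Rightarrow> complex" where
  "Psi k xi p z = psi (xi p) 1 (p + k) z"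

subsection \<open>Divided differences\<close>

(* f[x m, ..., x n] for m \<le> n, in the Hermite sense. When equal points are listed consecutively,
   x m = x n means that all the points coincide. *)
function divided_difference ::
    "(complex \<Rightarrow> complex) \<Rightarrow> (nat \<Rightarrow> complex) \<Rightarrow> nat \<Rightarrow> nat \<Rightarrow> complex" where
  "divided_difference f x m n =
     (if n \<le> m \<or> x m = x n then (deriv ^^ (n - m)) f (x m) / fact (n - m)
      else (divided_difference f x (m + 1) n - divided_difference f x m (n - 1)) / (x n - x m))"
  by pat_completeness auto
termination by (relation "Wellfounded.measure (\<lambda>(f, x, m, n). n - m)") auto

declare divided_difference.simps [simp del]

definition vec_divided_difference ::
    "(complex \<Rightarrow> complex^'n) \<Rightarrow> (nat \<Rightarrow> complex) \<Rightarrow> nat \<Rightarrow> nat \<Rightarrow> complex^'n" where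
  "vec_divided_difference F x m n = (\<chi> c. divided_difference (\<lambda>z. vec_nth (F z) c) x m n)"

subsection \<open>The ITEA denominator\<close>

(* In this section x stands for the p-th set of interpolation points. *)

definition itea_u ::
    "(complex^'n \<Rightarrow> complex^'n \<Rightarrow> complex) \<Rightarrow> complex^'n \<Rightarrow> (complex \<Rightarrow> complex^'n) \<Rightarrow>
     (nat \<Rightarrow> complex) \<Rightarrow> nat \<Rightarrow> nat \<Rightarrow> nat \<Rightarrow> complex" where
  "itea_u ip q F x p i j = ip q (vec_divided_difference F x (j + 1) (p + i))"

(* c 0, ..., c k are determined by these conditions exactly when the k \<times> k matrix
   (itea_u ip q F x p i j), 1 \<le> i \<le> k, 0 \<le> j < k, is nonsingular. *)
definition itea_coeffs ::
    "(complex^'n \<Rightarrow> complex^'n \<Rightarrow> complex) \<Rightarrow> complex^'n \<Rightarrow> (complex \<Rightarrow> complex^'n) \<Rightarrow>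
     (nat \<Rightarrow> complex) \<Rightarrow> nat \<Rightarrow> nat \<Rightarrow> nat \<Rightarrow> complex" where
  "itea_coeffs ip q F x p k =
     (SOME c. c k = 1 \<and>
        (\<forall>i\<in>{1..k}. (\<Sum>j<k. itea_u ip q F x p i j * c j) = - itea_u ip q F x p i k))"

definition itea_V ::
    "(complex^'n \<Rightarrow> complex^'n \<Rightarrow> complex) \<Rightarrow> complex^'n \<Rightarrow> (complex \<Rightarrow> complex^'n) \<Rightarrow>
     (nat \<Rightarrow> complex) \<Rightarrow> nat \<Rightarrow> nat \<Rightarrow> complex \<Rightarrow> complex" where
  "itea_V ip q F x p k z = (\<Sum>j\<le>k. itea_coeffs ip q F x p k j * psi x 1 j z)"

subsection \<open>The asymptotic constants\<close>

definition alpha ::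
    "(complex^'n \<Rightarrow> complex^'n \<Rightarrow> complex) \<Rightarrow> complex^'n \<Rightarrow> (nat \<Rightarrow> complex^'n) \<Rightarrow> (nat \<Rightarrow> complex) \<Rightarrow>
     (nat \<Rightarrow> complex) \<Rightarrow> nat \<Rightarrow> nat \<Rightarrow> nat \<Rightarrow> nat \<Rightarrow> complex" where
  "alpha ip q v z x p k i s = ip q (v s) * psi x (p + i + 1) (p + k) (z s)"

(* s 1, ..., s k are the column labels; the shift by Suc is due to matrices being indexed from 0 *)
definition T_det ::
    "(complex^'n \<Rightarrow> complex^'n \<Rightarrow> complex) \<Rightarrow> complex^'n \<Rightarrow> (nat \<Rightarrow> complex^'n) \<Rightarrow> (nat \<Rightarrow> complex) \<Rightarrow>
     (nat \<Rightarrow> complex) \<Rightarrow> nat \<Rightarrow> nat \<Rightarrow> (nat \<Rightarrow> nat) \<Rightarrow> complex" where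
  "T_det ip q v z x p k s =
     Determinant.det (Matrix.mat k k (\<lambda>(i, j). alpha ip q v z x p k (Suc i) (s (Suc j))))"

(* enumerates 1, ..., m - 1, m + 1, m + 2, ... *)
definition omit :: "nat \<Rightarrow> nat \<Rightarrow> nat" where
  "omit m j = (if j < m then j else j + 1)"

definition C_const ::
    "(complex^'n \<Rightarrow> complex^'n \<Rightarrow> complex) \<Rightarrow> complex^'n \<Rightarrow> (nat \<Rightarrow> complex^'n) \<Rightarrow> (nat \<Rightarrow> complex) \<Rightarrow>
     (nat \<Rightarrow> complex) \<Rightarrow> nat \<Rightarrow> nat \<Rightarrow> nat \<Rightarrow> complex" where
  "C_const ip q v z x p k m =
     (-1) ^ (k - m) * (T_det ip q v z x p k (omit m) / T_det ip q v z x p k (\<lambda>j. j)) *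
     (z (k + 1) - z m) * (\<Prod>i\<in>{1..k} - {m}. (z (k + 1) - z i) / (z m - z i))"

end

theory Submission
  imports Defs
begin

text \<open>Write \<open>f = (q, F)\<close>, with residues \<open>a\<^sub>s = (q, v\<^sub>s)\<close> at the poles and analytic part \<open>\<theta>\<close>. The equations
  defining \<open>V = V\<^bsub>p,k\<^esub>\<close> say that the divided difference of \<open>V f \<pi>\<close> over all \<open>p + k\<close> points vanishes for
  every polynomial \<open>\<pi>\<close> of degree less than \<open>k\<close>. Since the divided difference of \<open>1 / (w - z\<^sub>s)\<close> is
  \<open>- 1 / \<Psi>(z\<^sub>s)\<close>, while that of an analytic function is its Cauchy integral against \<open>1 / \<Psi>\<close>, this reads
  \<open>\<Sum>\<^sub>s a\<^sub>s V(z\<^sub>s) \<pi>(z\<^sub>s) / \<Psi>(z\<^sub>s) = (1 / 2\<pi>i) \<integral> \<theta> V \<pi> / \<Psi>\<close> over a cycle close to the level curve of \<open>\<rho>\<close>.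
  Taking for \<open>\<pi>\<close> the Lagrange polynomial of \<open>z\<^sub>m\<close> leaves only \<open>s = m\<close> and \<open>s > k\<close> on the left, and
  \<open>V(z\<^sub>m)\<close> is \<open>z\<^sub>m - z\<^sub>m\<^sup>(\<^sup>p\<^sup>)\<close> times a factor with nonzero limit. The same identity for a polynomial in the
  kernel of the linear system shows that the system is eventually nonsingular.\<close>

subsection \<open>Cauchy's formula for a cycle around a compact set\<close>

text \<open>Three obstacles shape the argument. The level curve of \<rho> may be singular and
  \<Theta> need not extend to it, so for each \<open>\<sigma> < \<rho>\<close> the cycle consists of
  edges of a square grid lying between two sublevel sets of the Green's function; since only
  \<Theta> is integrated, a pole may even lie on it. The denominator is an unknown polynomial, so
  every estimate is proportional to a bound \<open>B\<close> for it on a fixed compact set.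
  Convergent zeros provide such a \<open>B\<close> for V itself, and Lagrange interpolation at the
  first \<open>k\<close> poles provides it for a kernel polynomial, whose degree is below
  \<open>k\<close>. Nonsingularity cannot be skipped: the coefficients are a choice among the
  solutions and satisfy the equations only if a solution exists. Finally, the limit constant comes
  out in terms of residues and Lagrange polynomials; the determinants \<open>T_det\<close> enter
  only when it is identified with \<open>C_const\<close>, through a linear relation between the
  columns labelled \<open>1, ..., k + 1\<close>. Positivity of the capacity is not assumed but read
  off from the growth of the node polynomials.\<close>

lemma sum_diff_shift:
  fixes f :: "'a \<Rightarrow> 'b::ab_group_add"
  assumes "finite S" "inj \<sigma>"
  shows "(\<Sum>q\<in>S. f q - f (\<sigma> q)) = (\<Sum>q\<in>S - \<sigma> ` S. f q) - (\<Sum>q\<in>\<sigma> ` S - S. f q)"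
proof -
  have "(\<Sum>q\<in>S. f (\<sigma> q)) = (\<Sum>q\<in>\<sigma> ` S. f q)"
    using assms by (subst sum.reindex) (auto intro: inj_on_subset)
  moreover have "(\<Sum>q\<in>S. f q) = (\<Sum>q\<in>S \<inter> \<sigma> ` S. f q) + (\<Sum>q\<in>S - \<sigma> ` S. f q)"
    using assms(1) by (rule sum.Int_Diff)
  moreover have "(\<Sum>q\<in>\<sigma> ` S. f q) = (\<Sum>q\<in>\<sigma> ` S \<inter> S. f q) + (\<Sum>q\<in>\<sigma> ` S - S. f q)"
    using assms(1) by (intro sum.Int_Diff) auto
  ultimately show ?thesis
    by (simp add: sum_subtractf Int_commute)
qed

text \<open>The top and left sides are traversed in the direction of increasing coordinates and get
  a minus sign, so that an edge shared by two grid squares yields literally the same integral twice,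
  with opposite signs.\<close>

lemma contour_integral_rectpath:
  assumes "continuous_on (path_image (rectpath p q)) f"
  shows "contour_integral (rectpath p q) f =
    contour_integral (linepath p (Complex (Re q) (Im p))) f +
    contour_integral (linepath (Complex (Re q) (Im p)) q) f -
    contour_integral (linepath (Complex (Re p) (Im q)) q) f -
    contour_integral (linepath p (Complex (Re p) (Im q))) f"
proof -
  define a2 a4 where "a2 = Complex (Re q) (Im p)" and "a4 = Complex (Re p) (Im q)"
  have im: "path_image (rectpath p q) = closed_segment p a2 \<union> closed_segment a2 q \<union>
              closed_segment q a4 \<union> closed_segment a4 p"
    by (simp add: rectpath_def Let_def path_image_join a2_def a4_def Un_assoc)
  have c: "continuous_on (closed_segment p a2) f" "continuous_on (closed_segment a2 q) f"
    "continuous_on (closed_segment q a4) f" "continuous_on (closed_segment a4 p) f"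
    by (rule continuous_on_subset[OF assms], force simp: im)+
  then have c': "continuous_on (closed_segment a4 q) f" "continuous_on (closed_segment p a4) f"
    by (simp_all add: closed_segment_commute)
  note ci = c[THEN contour_integrable_continuous_linepath] c'[THEN contour_integrable_continuous_linepath]
  have r: "contour_integral (linepath q a4) f = - contour_integral (linepath a4 q) f"
    "contour_integral (linepath a4 p) f = - contour_integral (linepath p a4) f"
    using c contour_integral_reverse_linepath by blast+
  show ?thesis
    unfolding rectpath_def Let_def a2_def[symmetric] a4_def[symmetric]
    using ci by (simp add: contour_integrable_join r)
qed

text \<open>A chain is a list of segments \<open>(c, a, b)\<close> with coefficient \<open>c\<close>, start \<open>a\<close> and end \<open>b\<close>; the factor
  \<open>1 / 2\<pi>i\<close> of Cauchy's formula is absorbed into the coefficients.\<close>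

definition chain_integral :: "(complex \<times> complex \<times> complex) list \<Rightarrow> (complex \<Rightarrow> complex) \<Rightarrow> complex" where
  "chain_integral \<Gamma> \<phi> = (\<Sum>(c, a, b)\<leftarrow>\<Gamma>. c * contour_integral (linepath a b) \<phi>)"

definition chain_support :: "(complex \<times> complex \<times> complex) list \<Rightarrow> complex set" where
  "chain_support \<Gamma> = (\<Union>(c, a, b)\<in>set \<Gamma>. closed_segment a b)"

lemma chain_integral_Nil [simp]: "chain_integral [] \<phi> = 0"
  by (simp add: chain_integral_def)

lemma chain_integral_Cons [simp]:
  "chain_integral ((c, a, b) # \<Gamma>) \<phi> = c * contour_integral (linepath a b) \<phi> + chain_integral \<Gamma> \<phi>"
  by (simp add: chain_integral_def)

lemma chain_support_Nil [simp]: "chain_support [] = {}"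
  by (simp add: chain_support_def)

lemma chain_support_Cons [simp]:
  "chain_support ((c, a, b) # \<Gamma>) = closed_segment a b \<union> chain_support \<Gamma>"
  by (simp add: chain_support_def)

lemma compact_chain_support: "compact (chain_support \<Gamma>)"
  by (auto simp: chain_support_def intro!: compact_UN)

lemma chain_integral_cong:
  "(\<And>w. w \<in> chain_support \<Gamma> \<Longrightarrow> \<phi> w = \<eta> w) \<Longrightarrow> chain_integral \<Gamma> \<phi> = chain_integral \<Gamma> \<eta>"
proof (induction \<Gamma>)
  case (Cons e \<Gamma>)
  then show ?case
    by (cases e) (auto intro!: arg_cong2[where f="(+)"] arg_cong2[where f="(*)"] contour_integral_eq)
qed auto

lemma chain_integral_add:
  assumes "continuous_on (chain_support \<Gamma>) \<phi>" "continuous_on (chain_support \<Gamma>) \<eta>"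
  shows "chain_integral \<Gamma> (\<lambda>w. \<phi> w + \<eta> w) = chain_integral \<Gamma> \<phi> + chain_integral \<Gamma> \<eta>"
  using assms
proof (induction \<Gamma>)
  case (Cons e \<Gamma>)
  obtain c a b where e: "e = (c, a, b)" by (cases e)
  have "\<phi> contour_integrable_on linepath a b" "\<eta> contour_integrable_on linepath a b"
    using Cons.prems e
    by (auto intro!: contour_integrable_continuous_linepath intro: continuous_on_subset)
  moreover have "chain_integral \<Gamma> (\<lambda>w. \<phi> w + \<eta> w) = chain_integral \<Gamma> \<phi> + chain_integral \<Gamma> \<eta>"
    using Cons e by (auto intro: continuous_on_subset)
  ultimately show ?case
    by (simp add: e contour_integral_add algebra_simps)
qed auto

lemma chain_integral_cmult:
  assumes "continuous_on (chain_support \<Gamma>) \<phi>"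
  shows "chain_integral \<Gamma> (\<lambda>w. d * \<phi> w) = d * chain_integral \<Gamma> \<phi>"
  using assms
proof (induction \<Gamma>)
  case (Cons e \<Gamma>)
  obtain c a b where e: "e = (c, a, b)" by (cases e)
  have "\<phi> contour_integrable_on linepath a b"
    using Cons.prems e
    by (auto intro!: contour_integrable_continuous_linepath intro: continuous_on_subset)
  moreover have "chain_integral \<Gamma> (\<lambda>w. d * \<phi> w) = d * chain_integral \<Gamma> \<phi>"
    using Cons e by (auto intro: continuous_on_subset)
  ultimately show ?case
    by (simp add: e contour_integral_lmul algebra_simps)
qed auto

text \<open>The constant is the length of the chain weighted by its coefficients. It does not depend
  on the integrand, so it serves all \<open>p\<close> and all coefficient vectors at once.\<close>

lemma chain_integral_bound:
  obtains C where "C \<ge> 0"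
    "\<And>\<phi> B. \<lbrakk>continuous_on (chain_support \<Gamma>) \<phi>; 0 \<le> B; \<And>w. w \<in> chain_support \<Gamma> \<Longrightarrow> cmod (\<phi> w) \<le> B\<rbrakk>
       \<Longrightarrow> cmod (chain_integral \<Gamma> \<phi>) \<le> C * B"
proof -
  have "\<exists>C\<ge>0. \<forall>\<phi> B. continuous_on (chain_support \<Gamma>) \<phi> \<longrightarrow> 0 \<le> B \<longrightarrow>
      (\<forall>w\<in>chain_support \<Gamma>. cmod (\<phi> w) \<le> B) \<longrightarrow> cmod (chain_integral \<Gamma> \<phi>) \<le> C * B"
  proof (induction \<Gamma>)
    case (Cons e \<Gamma>)
    obtain c a b where e: "e = (c, a, b)" by (cases e)
    from Cons obtain C where C: "C \<ge> 0" "\<And>\<phi> B. continuous_on (chain_support \<Gamma>) \<phi> \<Longrightarrow> 0 \<le> B \<Longrightarrow>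
      (\<forall>w\<in>chain_support \<Gamma>. cmod (\<phi> w) \<le> B) \<Longrightarrow> cmod (chain_integral \<Gamma> \<phi>) \<le> C * B"
      by blast
    show ?case
    proof (intro exI[of _ "cmod c * cmod (b - a) + C"] conjI allI impI)
      fix \<phi> B
      assume h: "continuous_on (chain_support (e # \<Gamma>)) \<phi>" "0 \<le> B"
        "\<forall>w\<in>chain_support (e # \<Gamma>). cmod (\<phi> w) \<le> B"
      have ci: "(\<phi> has_contour_integral contour_integral (linepath a b) \<phi>) (linepath a b)"
        using h(1) e
        by (auto intro!: has_contour_integral_integral contour_integrable_continuous_linepath
            intro: continuous_on_subset)
      have "cmod (contour_integral (linepath a b) \<phi>) \<le> B * cmod (b - a)"
        using h(2,3) e by (intro has_contour_integral_bound_linepath[OF ci]) auto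
      then have "cmod (c * contour_integral (linepath a b) \<phi>) \<le> cmod c * (B * cmod (b - a))"
        by (simp add: norm_mult mult_left_mono)
      moreover have "cmod (chain_integral \<Gamma> \<phi>) \<le> C * B"
        using h e by (intro C(2)) (auto intro: continuous_on_subset)
      ultimately show "cmod (chain_integral (e # \<Gamma>) \<phi>) \<le> (cmod c * cmod (b - a) + C) * B"
        by (auto simp: e algebra_simps intro: order.trans[OF norm_triangle_ineq])
    qed (use C in auto)
  qed auto
  then show ?thesis using that by blast
qed

lemma has_field_derivative_chain_integral:
  assumes "continuous_on (chain_support \<Gamma>) h" "z \<notin> chain_support \<Gamma>"
  shows "((\<lambda>z. chain_integral \<Gamma> (\<lambda>w. h w / (w - z) ^ Suc j)) has_field_derivative
     (of_nat (Suc j) * chain_integral \<Gamma> (\<lambda>w. h w / (w - z) ^ Suc (Suc j)))) (at z)"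
  using assms
proof (induction \<Gamma>)
  case (Cons e \<Gamma>)
  obtain c a b where e: "e = (c, a, b)" by (cases e)
  have h: "continuous_on (closed_segment a b) h" "z \<notin> closed_segment a b"
    using Cons.prems e by (auto intro: continuous_on_subset)
  have "((\<lambda>z. contour_integral (linepath a b) (\<lambda>w. h w / (w - z) ^ Suc j)) has_field_derivative
     (of_nat (Suc j) * contour_integral (linepath a b) (\<lambda>w. h w / (w - z) ^ Suc (Suc j)))) (at z)"
  proof (rule Cauchy_next_derivative(2)[where S=UNIV and B="cmod (b - a)"])
    fix w assume "w \<in> UNIV - path_image (linepath a b)"
    then have "(\<lambda>u. h u / (u - w) ^ Suc j) contour_integrable_on linepath a b"
      using h(1) by (intro contour_integrable_continuous_linepath continuous_intros) auto
    then show "((\<lambda>u. h u / (u - w) ^ Suc j) has_contour_integral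
        contour_integral (linepath a b) (\<lambda>w'. h w' / (w' - w) ^ Suc j)) (linepath a b)"
      by (rule has_contour_integral_integral)
  qed (use h in auto)
  moreover have "((\<lambda>z. chain_integral \<Gamma> (\<lambda>w. h w / (w - z) ^ Suc j)) has_field_derivative
     (of_nat (Suc j) * chain_integral \<Gamma> (\<lambda>w. h w / (w - z) ^ Suc (Suc j)))) (at z)"
    using Cons e by (auto intro: continuous_on_subset)
  ultimately show ?case
    unfolding e chain_integral_Cons
    by (auto intro!: derivative_eq_intros simp: algebra_simps)
qed auto

section \<open>The grid chain around a compact set\<close>

definition grid_point :: "real \<Rightarrow> int \<times> int \<Rightarrow> complex" where
  "grid_point \<delta> q = Complex (\<delta> * of_int (fst q)) (\<delta> * of_int (snd q))"

definition grid_square :: "real \<Rightarrow> int \<times> int \<Rightarrow> complex set" where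
  "grid_square \<delta> q = cbox (grid_point \<delta> q) (grid_point \<delta> (fst q + 1, snd q + 1))"

lemma mem_grid_square:
  "w \<in> grid_square \<delta> (a, b) \<longleftrightarrow> \<delta> * of_int a \<le> Re w \<and> Re w \<le> \<delta> * (of_int a + 1) \<and>
     \<delta> * of_int b \<le> Im w \<and> Im w \<le> \<delta> * (of_int b + 1)"
  by (auto simp: grid_square_def grid_point_def in_cbox_complex_iff)

text \<open>An edge lies in both squares adjacent to it. Hence an edge with just one adjacent square
  meeting \<open>K\<close> avoids \<open>K\<close>, because the other square does, and stays in the
  open set, because the first square does.\<close>

lemma grid_edge_subset:
  assumes "\<delta> > 0"
  shows "closed_segment (grid_point \<delta> (a, b)) (grid_point \<delta> (a + 1, b))
           \<subseteq> grid_square \<delta> (a, b) \<inter> grid_square \<delta> (a, b - 1)"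
    and "closed_segment (grid_point \<delta> (a, b)) (grid_point \<delta> (a, b + 1))
           \<subseteq> grid_square \<delta> (a, b) \<inter> grid_square \<delta> (a - 1, b)"
proof -
  have conv: "convex (grid_square \<delta> q)" for q
    by (simp add: grid_square_def convex_box)
  show "closed_segment (grid_point \<delta> (a, b)) (grid_point \<delta> (a + 1, b))
           \<subseteq> grid_square \<delta> (a, b) \<inter> grid_square \<delta> (a, b - 1)"
    using assms
    by (intro Int_greatest closed_segment_subset conv) (auto simp: mem_grid_square grid_point_def field_simps)
  show "closed_segment (grid_point \<delta> (a, b)) (grid_point \<delta> (a, b + 1))
           \<subseteq> grid_square \<delta> (a, b) \<inter> grid_square \<delta> (a - 1, b)"
    using assms
    by (intro Int_greatest closed_segment_subset conv) (auto simp: mem_grid_square grid_point_def field_simps)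
qed

lemma finite_grid_squares_meeting:
  assumes "\<delta> > 0" "bounded K"
  shows "finite {q. grid_square \<delta> q \<inter> K \<noteq> {}}"
proof -
  obtain B where B: "\<And>w. w \<in> K \<Longrightarrow> cmod w \<le> B"
    using assms(2) bounded_iff by metis
  define N where "N = \<lceil>B / \<delta>\<rceil> + 1"
  have aux: "a \<in> {-N..N}" if "\<delta> * of_int a \<le> x" "x \<le> \<delta> * (of_int a + 1)" "\<bar>x\<bar> \<le> B" for a :: int and x
  proof -
    have "of_int a \<le> x / \<delta>" "x / \<delta> \<le> of_int a + 1"
      using that assms(1) by (simp_all add: field_simps)
    moreover have "x / \<delta> \<le> B / \<delta>" "- (B / \<delta>) \<le> x / \<delta>"
      using that(3) assms(1) by (simp_all add: field_simps abs_le_iff)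
    moreover have "B / \<delta> \<le> of_int \<lceil>B / \<delta>\<rceil>" by simp
    ultimately have "of_int a \<le> real_of_int (N - 1)" "- real_of_int (N - 1) \<le> of_int a + 1"
      unfolding N_def of_int_add of_int_diff of_int_1 by linarith+
    then show ?thesis by simp
  qed
  have "{q. grid_square \<delta> q \<inter> K \<noteq> {}} \<subseteq> {-N..N} \<times> {-N..N}"
  proof
    fix q assume "q \<in> {q. grid_square \<delta> q \<inter> K \<noteq> {}}"
    then obtain a b w where q: "q = (a, b)" and w: "w \<in> grid_square \<delta> (a, b)" "w \<in> K"
      by (cases q) auto
    have "\<bar>Re w\<bar> \<le> B" "\<bar>Im w\<bar> \<le> B"
      using B[OF w(2)] abs_Re_le_cmod[of w] abs_Im_le_cmod[of w] by linarith+
    then have "a \<in> {-N..N}" "b \<in> {-N..N}"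
      using w(1) aux unfolding mem_grid_square by blast+
    then show "q \<in> {-N..N} \<times> {-N..N}" by (simp add: q)
  qed
  then show ?thesis by (rule finite_subset) auto
qed

text \<open>Off the grid lines \<open>z\<close> is never on the boundary of a square: it is
  interior, and Cauchy's formula applies, or outside, and Cauchy's theorem does.\<close>

lemma contour_integral_grid_square:
  assumes "\<delta> > 0" "h holomorphic_on grid_square \<delta> (a, b)"
    and "\<And>n. Re z \<noteq> \<delta> * of_int n" "\<And>n. Im z \<noteq> \<delta> * of_int n"
  shows "contour_integral (rectpath (grid_point \<delta> (a, b)) (grid_point \<delta> (a + 1, b + 1))) (\<lambda>w. h w / (w - z)) =
    (if z \<in> grid_square \<delta> (a, b) then 2 * pi * \<i> * h z else 0)"
proof -
  let ?p = "grid_point \<delta> (a, b)" and ?q = "grid_point \<delta> (a + 1, b + 1)"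
  have sq: "grid_square \<delta> (a, b) = cbox ?p ?q"
    by (simp add: grid_square_def)
  have le: "Re ?p \<le> Re ?q" "Im ?p \<le> Im ?q"
    using assms(1) by (auto simp: grid_point_def)
  have im: "path_image (rectpath ?p ?q) \<subseteq> cbox ?p ?q"
    using le by (rule path_image_rectpath_subset_cbox)
  show ?thesis
  proof (cases "z \<in> grid_square \<delta> (a, b)")
    case True
    have neq: "Re z \<noteq> Re ?p" "Re z \<noteq> Re ?q" "Im z \<noteq> Im ?p" "Im z \<noteq> Im ?q"
      using assms(3)[of a] assms(3)[of "a+1"] assms(4)[of b] assms(4)[of "b+1"]
      by (simp_all add: grid_point_def)
    then have zbox: "z \<in> box ?p ?q"
      using True unfolding sq in_box_complex_iff in_cbox_complex_iff by (auto simp: less_le)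
    have "((\<lambda>w. h w / (w - z)) has_contour_integral
        2 * pi * \<i> * winding_number (rectpath ?p ?q) z * h z) (rectpath ?p ?q)"
    proof (rule Cauchy_integral_formula_convex_simple)
      show "path_image (rectpath ?p ?q) \<subseteq> cbox ?p ?q - {z}"
        using im zbox path_image_rectpath_inter_box[OF le] by blast
    qed (use zbox assms(2) in \<open>auto simp: sq convex_box interior_cbox\<close>)
    then show ?thesis
      using True winding_number_rectpath[OF zbox] by (simp add: contour_integral_unique)
  next
    case False
    have "((\<lambda>w. h w / (w - z)) has_contour_integral 0) (rectpath ?p ?q)"
    proof (rule Cauchy_theorem_convex_simple)
      show "(\<lambda>w. h w / (w - z)) holomorphic_on cbox ?p ?q"
        using False assms(2) by (auto simp: sq intro!: holomorphic_intros)
    qed (use im in \<open>auto simp: convex_box\<close>)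
    then show ?thesis
      using False by (simp add: contour_integral_unique)
  qed
qed

lemma chain_integral_append [simp]:
  "chain_integral (\<Gamma> @ \<Delta>) \<phi> = chain_integral \<Gamma> \<phi> + chain_integral \<Delta> \<phi>"
  by (simp add: chain_integral_def)

lemma chain_support_append [simp]:
  "chain_support (\<Gamma> @ \<Delta>) = chain_support \<Gamma> \<union> chain_support \<Delta>"
  by (simp add: chain_support_def)

lemma chain_of_finite_set:
  assumes "finite I"
  obtains \<Gamma> where "chain_support \<Gamma> = (\<Union>q\<in>I. closed_segment (a q) (b q))"
    "\<forall>\<phi>. chain_integral \<Gamma> \<phi> = c * (\<Sum>q\<in>I. contour_integral (linepath (a q) (b q)) \<phi>)"
proof -
  obtain xs where xs: "set xs = I" "distinct xs"
    using finite_distinct_list[OF assms] by blast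
  show ?thesis
  proof (rule that[of "map (\<lambda>q. (c, a q, b q)) xs"])
    show "chain_support (map (\<lambda>q. (c, a q, b q)) xs) = (\<Union>q\<in>I. closed_segment (a q) (b q))"
      using xs(1) by (auto simp: chain_support_def)
    show "\<forall>\<phi>. chain_integral (map (\<lambda>q. (c, a q, b q)) xs) \<phi> =
        c * (\<Sum>q\<in>I. contour_integral (linepath (a q) (b q)) \<phi>)"
      using xs by (simp add: chain_integral_def comp_def sum_list_distinct_conv_sum_set sum_distrib_left)
  qed
qed

text \<open>Grid coordinates are discrete, so a sufficiently small shift to the right avoids them,
  even when \<open>x\<close> is itself one.\<close>

lemma generic_grid_approximation:
  assumes "\<delta> > 0"
  shows "\<forall>\<^sub>F t in at_right 0. \<forall>n. x + t \<noteq> \<delta> * real_of_int n"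
proof -
  define m where "m = \<lfloor>x / \<delta>\<rfloor>"
  have "m \<le> x / \<delta>" "x / \<delta> < m + 1"
    unfolding m_def by linarith+
  then have m: "\<delta> * m \<le> x" "x < \<delta> * (m + 1)"
    using assms by (simp_all add: field_simps)
  have "\<forall>n. x + t \<noteq> \<delta> * real_of_int n" if t: "0 < t" "t < \<delta> * (m + 1) - x" for t
  proof (intro allI notI)
    fix n assume "x + t = \<delta> * real_of_int n"
    then have "\<delta> * m < \<delta> * n" "\<delta> * n < \<delta> * (m + 1)"
      using m t by linarith+
    then have "m < n" "n < m + 1"
      using assms mult_less_cancel_left_pos of_int_less_iff by blast+
    then show False by simp
  qed
  then show ?thesis
    using m(2) unfolding eventually_at_right_field
    by (intro exI[of _ "\<delta> * (m + 1) - x"]) auto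
qed

text \<open>Sum the boundary integrals of all grid squares that meet \<open>K\<close>. An edge that meets \<open>K\<close> bounds two
  such squares and cancels. A point on the grid lies on the boundaries being integrated over, hence
  the restriction, which is later removed by continuity.\<close>

lemma Cauchy_chain_off_grid:
  assumes K: "compact K" and D: "open D" and KD: "K \<subseteq> D"
  obtains \<Gamma> \<delta> where "chain_support \<Gamma> \<subseteq> D - K" "\<delta> > 0"
    "\<forall>h z. h holomorphic_on D \<longrightarrow> z \<in> K \<longrightarrow> (\<forall>n. Re z \<noteq> \<delta> * of_int n \<and> Im z \<noteq> \<delta> * of_int n) \<longrightarrow>
       chain_integral \<Gamma> (\<lambda>w. h w / (w - z)) = h z"
proof -
  obtain e where e: "e > 0" "(\<Union>x\<in>K. ball x e) \<subseteq> D"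
    using compact_subset_open_imp_ball_epsilon_subset[OF K D KD] by blast
  \<comment> \<open>Two points of one square are at distance at most
    \<open>2 * \<delta> < e\<close>, so a square that meets \<open>K\<close> stays inside the
    \<open>e\<close>-neighbourhood of \<open>K\<close>.\<close>
  define \<delta> where "\<delta> = e / 3"
  have \<delta>: "\<delta> > 0" using e(1) by (simp add: \<delta>_def)
  define S where "S = {q. grid_square \<delta> q \<inter> K \<noteq> {}}"
  have finS: "finite S"
    unfolding S_def using \<delta> K by (intro finite_grid_squares_meeting compact_imp_bounded)
  have SD: "grid_square \<delta> q \<subseteq> D" if qS: "q \<in> S" for q
  proof
    obtain a b where ab: "q = (a, b)" by (cases q)
    fix y assume y: "y \<in> grid_square \<delta> q"
    obtain x where x: "x \<in> grid_square \<delta> q" "x \<in> K"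
      using qS by (auto simp: S_def)
    have "\<bar>Re (x - y)\<bar> \<le> \<delta>" "\<bar>Im (x - y)\<bar> \<le> \<delta>"
      using x(1) y unfolding ab mem_grid_square by (auto simp: algebra_simps abs_le_iff)
    then have "dist x y < e"
      using cmod_le[of "x - y"] e(1) unfolding dist_norm \<delta>_def by linarith
    then show "y \<in> D" using e(2) x(2) mem_ball by blast
  qed
  let ?P = "grid_point \<delta>"
  let ?up = "\<lambda>q :: int \<times> int. (fst q, snd q + 1)" and ?rt = "\<lambda>q :: int \<times> int. (fst q + 1, snd q)"
  \<comment> \<open>An edge is named by its left or lower end. \<open>A1\<close> and
    \<open>A2\<close> are the horizontal edges with a square of \<open>S\<close> only above or only
    below, \<open>B1\<close> and \<open>B2\<close> the vertical ones with a square of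
    \<open>S\<close> only to the right or only to the left.\<close>
  define A1 A2 B1 B2 where "A1 = S - ?up ` S" and "A2 = ?up ` S - S"
    and "B1 = S - ?rt ` S" and "B2 = ?rt ` S - S"
  have fin: "finite A1" "finite A2" "finite B1" "finite B2"
    using finS by (auto simp: A1_def A2_def B1_def B2_def)
  have up: "(a, b) \<in> ?up ` S \<longleftrightarrow> (a, b - 1) \<in> S" for a b
    by (force simp: image_iff)
  have rt: "(a, b) \<in> ?rt ` S \<longleftrightarrow> (a - 1, b) \<in> S" for a b
    by (force simp: image_iff)
  have H: "closed_segment (?P q) (?P (?rt q)) \<subseteq> D - K" if q: "q \<in> A1 \<union> A2" for q
  proof -
    obtain a b where ab: "q = (a, b)" by (cases q)
    have "((a, b) \<in> S) \<noteq> ((a, b - 1) \<in> S)"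
      using q up unfolding ab A1_def A2_def by auto
    then show ?thesis
      using grid_edge_subset(1)[OF \<delta>, of a b] SD[of "(a, b)"] SD[of "(a, b - 1)"]
      unfolding ab S_def by auto
  qed
  have V: "closed_segment (?P q) (?P (?up q)) \<subseteq> D - K" if q: "q \<in> B1 \<union> B2" for q
  proof -
    obtain a b where ab: "q = (a, b)" by (cases q)
    have "((a, b) \<in> S) \<noteq> ((a - 1, b) \<in> S)"
      using q rt unfolding ab B1_def B2_def by auto
    then show ?thesis
      using grid_edge_subset(2)[OF \<delta>, of a b] SD[of "(a, b)"] SD[of "(a - 1, b)"]
      unfolding ab S_def by auto
  qed
  define c :: complex where "c = 1 / (2 * pi * \<i>)"
  let ?h = "\<lambda>\<phi> q. contour_integral (linepath (?P q) (?P (?rt q))) \<phi>"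
  let ?v = "\<lambda>\<phi> q. contour_integral (linepath (?P q) (?P (?up q))) \<phi>"
  obtain G1 where G1: "chain_support G1 = (\<Union>q\<in>A1. closed_segment (?P q) (?P (?rt q)))"
    "\<And>\<phi>. chain_integral G1 \<phi> = c * (\<Sum>q\<in>A1. ?h \<phi> q)"
    using chain_of_finite_set[OF fin(1), of ?P "\<lambda>q. ?P (?rt q)" "c"] by auto
  obtain G2 where G2: "chain_support G2 = (\<Union>q\<in>A2. closed_segment (?P q) (?P (?rt q)))"
    "\<And>\<phi>. chain_integral G2 \<phi> = - c * (\<Sum>q\<in>A2. ?h \<phi> q)"
    using chain_of_finite_set[OF fin(2), of ?P "\<lambda>q. ?P (?rt q)" "- c"] by auto
  obtain G3 where G3: "chain_support G3 = (\<Union>q\<in>B1. closed_segment (?P q) (?P (?up q)))"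
    "\<And>\<phi>. chain_integral G3 \<phi> = - c * (\<Sum>q\<in>B1. ?v \<phi> q)"
    using chain_of_finite_set[OF fin(3), of ?P "\<lambda>q. ?P (?up q)" "- c"] by auto
  obtain G4 where G4: "chain_support G4 = (\<Union>q\<in>B2. closed_segment (?P q) (?P (?up q)))"
    "\<And>\<phi>. chain_integral G4 \<phi> = c * (\<Sum>q\<in>B2. ?v \<phi> q)"
    using chain_of_finite_set[OF fin(4), of ?P "\<lambda>q. ?P (?up q)" "c"] by auto
  define \<Gamma> where "\<Gamma> = G1 @ G2 @ G3 @ G4"
  have "chain_support \<Gamma> \<subseteq> D - K"
    using H V unfolding \<Gamma>_def chain_support_append G1(1) G2(1) G3(1) G4(1)
    by (simp add: UN_least)
  moreover have "chain_integral \<Gamma> (\<lambda>w. h w / (w - z)) = h z"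
    if hol: "h holomorphic_on D" and z: "z \<in> K"
      and off: "\<And>n. Re z \<noteq> \<delta> * of_int n" "\<And>n. Im z \<noteq> \<delta> * of_int n" for h z
  proof -
    let ?f = "\<lambda>w. h w / (w - z)"
    have sq: "contour_integral (rectpath (?P q) (?P (fst q + 1, snd q + 1))) ?f =
        (?h ?f q - ?h ?f (?up q)) - (?v ?f q - ?v ?f (?rt q))" if qS: "q \<in> S" for q
    proof -
      obtain a b where ab: "q = (a, b)" by (cases q)
      have "continuous_on (path_image (rectpath (?P q) (?P (fst q + 1, snd q + 1)))) ?f"
      proof -
        have le: "Re (?P q) \<le> Re (?P (fst q + 1, snd q + 1))" "Im (?P q) \<le> Im (?P (fst q + 1, snd q + 1))"
          using \<delta> by (simp_all add: grid_point_def)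
        have "z \<notin> path_image (rectpath (?P q) (?P (fst q + 1, snd q + 1)))"
          unfolding path_image_rectpath[OF le]
          using off(1)[of a] off(1)[of "a+1"] off(2)[of b] off(2)[of "b+1"]
          by (simp add: grid_point_def ab)
        then have "path_image (rectpath (?P q) (?P (fst q + 1, snd q + 1))) \<subseteq> D - {z}"
          using path_image_rectpath_subset_cbox[OF le] SD[OF qS] unfolding grid_square_def by blast
        moreover have "continuous_on (D - {z}) ?f"
          using hol by (intro continuous_intros holomorphic_on_imp_continuous_on) (auto intro: holomorphic_on_subset)
        ultimately show ?thesis by (rule continuous_on_subset[rotated])
      qed
      from contour_integral_rectpath[OF this] show ?thesis
        by (simp add: grid_point_def ab)
    qed
    \<comment> \<open>The only square that contains \<open>z\<close>; all other boundary integrals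
      vanish.\<close>
    define q0 where "q0 = (\<lfloor>Re z / \<delta>\<rfloor>, \<lfloor>Im z / \<delta>\<rfloor>)"
    have zq: "z \<in> grid_square \<delta> (a, b) \<longleftrightarrow> (a, b) = q0" for a b
    proof
      assume "z \<in> grid_square \<delta> (a, b)"
      then have "\<delta> * of_int a < Re z" "Re z < \<delta> * (of_int a + 1)"
        "\<delta> * of_int b < Im z" "Im z < \<delta> * (of_int b + 1)"
        using off(1)[of a] off(1)[of "a+1"] off(2)[of b] off(2)[of "b+1"]
        unfolding mem_grid_square by (auto simp: less_le)
      then show "(a, b) = q0"
        using \<delta> unfolding q0_def by (auto intro!: floor_unique[symmetric] simp: field_simps)
    next
      assume "(a, b) = q0"
      then show "z \<in> grid_square \<delta> (a, b)"
        using floor_divide_lower[OF \<delta>, of "Re z"] floor_divide_upper[OF \<delta>, of "Re z"]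
          floor_divide_lower[OF \<delta>, of "Im z"] floor_divide_upper[OF \<delta>, of "Im z"]
        unfolding mem_grid_square q0_def by (auto simp: mult.commute)
    qed
    have q0S: "q0 \<in> S"
    proof -
      have "z \<in> grid_square \<delta> q0"
        using zq[of "fst q0" "snd q0"] by simp
      then show ?thesis
        using z unfolding S_def by blast
    qed
    have "(\<Sum>q\<in>S. contour_integral (rectpath (?P q) (?P (fst q + 1, snd q + 1))) ?f) =
        (\<Sum>q\<in>S. if q = q0 then 2 * pi * \<i> * h z else 0)"
    proof (rule sum.cong[OF refl])
      fix q assume "q \<in> S"
      then have "h holomorphic_on grid_square \<delta> (fst q, snd q)"
        using SD[of q] hol holomorphic_on_subset by simp
      from contour_integral_grid_square[OF \<delta> this off]
      show "contour_integral (rectpath (?P q) (?P (fst q + 1, snd q + 1))) ?f =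
          (if q = q0 then 2 * pi * \<i> * h z else 0)"
        unfolding zq by simp
    qed
    also have "\<dots> = 2 * pi * \<i> * h z"
      using q0S finS by simp
    finally have "2 * pi * \<i> * h z =
        (\<Sum>q\<in>S. (?h ?f q - ?h ?f (?up q)) - (?v ?f q - ?v ?f (?rt q)))"
      using sq by simp
    also have "\<dots> = (\<Sum>q\<in>S. ?h ?f q - ?h ?f (?up q)) - (\<Sum>q\<in>S. ?v ?f q - ?v ?f (?rt q))"
      by (rule sum_subtractf)
    also have "(\<Sum>q\<in>S. ?h ?f q - ?h ?f (?up q)) = (\<Sum>q\<in>A1. ?h ?f q) - (\<Sum>q\<in>A2. ?h ?f q)"
      unfolding A1_def A2_def by (rule sum_diff_shift[OF finS]) (auto simp: inj_def prod_eq_iff)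
    also have "(\<Sum>q\<in>S. ?v ?f q - ?v ?f (?rt q)) = (\<Sum>q\<in>B1. ?v ?f q) - (\<Sum>q\<in>B2. ?v ?f q)"
      unfolding B1_def B2_def by (rule sum_diff_shift[OF finS]) (auto simp: inj_def prod_eq_iff)
    finally have eq: "2 * pi * \<i> * h z = (\<Sum>q\<in>A1. ?h ?f q) - (\<Sum>q\<in>A2. ?h ?f q) -
        ((\<Sum>q\<in>B1. ?v ?f q) - (\<Sum>q\<in>B2. ?v ?f q))" .
    have "chain_integral \<Gamma> ?f = c * ((\<Sum>q\<in>A1. ?h ?f q) - (\<Sum>q\<in>A2. ?h ?f q) -
        ((\<Sum>q\<in>B1. ?v ?f q) - (\<Sum>q\<in>B2. ?v ?f q)))"
      unfolding \<Gamma>_def chain_integral_append G1(2) G2(2) G3(2) G4(2) by (simp add: algebra_simps)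
    also have "\<dots> = h z"
      unfolding eq[symmetric] c_def by simp
    finally show ?thesis .
  qed
  ultimately show ?thesis
    using \<delta> by (intro that[of \<Gamma> \<delta>]) simp_all
qed

text \<open>The chain is chosen before \<open>h\<close>, \<open>z\<close> and \<open>j\<close>, so
  one chain serves every node and every order of derivative. At interior points both sides of the
  off-grid formula are continuous in \<open>z\<close>, since the chain misses \<open>K\<close>;
  repeated differentiation of the kernel then gives all \<open>j\<close>.\<close>

theorem Cauchy_chain:
  assumes K: "compact K" and D: "open D" and KD: "K \<subseteq> D"
  obtains \<Gamma> where "chain_support \<Gamma> \<subseteq> D - K"
    "\<forall>h z j. h holomorphic_on D \<longrightarrow> z \<in> interior K \<longrightarrow>
       (deriv ^^ j) h z / fact j = chain_integral \<Gamma> (\<lambda>w. h w / (w - z) ^ Suc j)"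
proof -
  obtain \<Gamma> \<delta> where supp: "chain_support \<Gamma> \<subseteq> D - K" and \<delta>: "\<delta> > 0"
    and off: "\<forall>h z. h holomorphic_on D \<longrightarrow> z \<in> K \<longrightarrow> (\<forall>n. Re z \<noteq> \<delta> * of_int n \<and> Im z \<noteq> \<delta> * of_int n) \<longrightarrow>
       chain_integral \<Gamma> (\<lambda>w. h w / (w - z)) = h z"
    using Cauchy_chain_off_grid[OF assms] by blast
  have "(deriv ^^ j) h z / fact j = chain_integral \<Gamma> (\<lambda>w. h w / (w - z) ^ Suc j)"
    if hol: "h holomorphic_on D" and z: "z \<in> interior K" for h z j
  proof -
    have conth: "continuous_on (chain_support \<Gamma>) h"
      using hol supp by (meson Diff_subset continuous_on_subset holomorphic_on_imp_continuous_on)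
    have der: "((\<lambda>z. chain_integral \<Gamma> (\<lambda>w. h w / (w - z) ^ Suc j)) has_field_derivative
        (of_nat (Suc j) * chain_integral \<Gamma> (\<lambda>w. h w / (w - z) ^ Suc (Suc j)))) (at z)"
      if "z \<in> interior K" for z j
      using that supp interior_subset by (intro has_field_derivative_chain_integral conth) blast
    have base: "chain_integral \<Gamma> (\<lambda>w. h w / (w - z)) = h z" if z: "z \<in> interior K" for z
    proof -
      \<comment> \<open>A diagonal approach changes both coordinates, so both leave the grid at
        once.\<close>
      let ?\<gamma> = "\<lambda>t::real. z + of_real t * (1 + \<i>)"
      have lim: "(?\<gamma> \<longlongrightarrow> z) (at_right 0)"
        by (auto intro!: tendsto_eq_intros)
      have "(\<lambda>z. chain_integral \<Gamma> (\<lambda>w. h w / (w - z))) \<midarrow>z\<rightarrow> chain_integral \<Gamma> (\<lambda>w. h w / (w - z))"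
        using DERIV_isCont[OF der[OF z, of 0]] by (simp add: isCont_def)
      moreover have "isCont h z"
        using hol D z KD interior_subset
        by (metis continuous_on_eq_continuous_at holomorphic_on_imp_continuous_on subset_iff)
      ultimately have L: "((\<lambda>t. chain_integral \<Gamma> (\<lambda>w. h w / (w - ?\<gamma> t))) \<longlongrightarrow>
            chain_integral \<Gamma> (\<lambda>w. h w / (w - z))) (at_right 0)"
          "((\<lambda>t. h (?\<gamma> t)) \<longlongrightarrow> h z) (at_right 0)"
        using isCont_tendsto_compose[OF _ lim] unfolding isCont_def by blast+
      have "\<forall>\<^sub>F t in at_right 0. ?\<gamma> t \<in> interior K"
        using lim z by (intro topological_tendstoD) auto
      moreover have "\<forall>\<^sub>F t in at_right 0. \<forall>n. Re z + t \<noteq> \<delta> * real_of_int n"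
        "\<forall>\<^sub>F t in at_right 0. \<forall>n. Im z + t \<noteq> \<delta> * real_of_int n"
        by (rule generic_grid_approximation[OF \<delta>])+
      ultimately have "\<forall>\<^sub>F t in at_right 0. chain_integral \<Gamma> (\<lambda>w. h w / (w - ?\<gamma> t)) = h (?\<gamma> t)"
      proof eventually_elim
        case (elim t)
        then show ?case
          using interior_subset by (intro off[rule_format, OF hol]) auto
      qed
      from tendsto_cong[OF this] L show ?thesis
        using tendsto_unique[OF trivial_limit_at_right_real] by blast
    qed
    show ?thesis using z
    proof (induction j arbitrary: z)
      case 0
      then show ?case using base by simp
    next
      case (Suc j)
      have d: "((\<lambda>z. fact j * chain_integral \<Gamma> (\<lambda>w. h w / (w - z) ^ Suc j)) has_field_derivative
          (fact j * (of_nat (Suc j) * chain_integral \<Gamma> (\<lambda>w. h w / (w - z) ^ Suc (Suc j))))) (at z)"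
        by (intro DERIV_cmult der Suc.prems)
      have eq: "fact j * chain_integral \<Gamma> (\<lambda>w. h w / (w - u) ^ Suc j) = (deriv ^^ j) h u"
        if "u \<in> interior K" for u
        using Suc.IH[OF that] by (simp add: field_simps)
      have "((deriv ^^ j) h has_field_derivative
          (fact j * (of_nat (Suc j) * chain_integral \<Gamma> (\<lambda>w. h w / (w - z) ^ Suc (Suc j))))) (at z)"
        by (rule has_field_derivative_transform_within_open[OF d open_interior Suc.prems eq])
      then have "deriv ((deriv ^^ j) h) z =
          fact (Suc j) * chain_integral \<Gamma> (\<lambda>w. h w / (w - z) ^ Suc (Suc j))"
        using DERIV_imp_deriv by (fastforce simp del: power_Suc)
      then show ?case
        by (simp del: power_Suc fact_Suc)
    qed
  qed
  then show ?thesis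
    by (intro that[OF supp]) simp
qed

subsection \<open>Divided differences\<close>

lemma higher_deriv_sum:
  assumes "finite C" "open X" "\<xi> \<in> X" "\<And>c. c \<in> C \<Longrightarrow> f c holomorphic_on X"
  shows "(deriv ^^ j) (\<lambda>w. \<Sum>c\<in>C. f c w) \<xi> = (\<Sum>c\<in>C. (deriv ^^ j) (f c) \<xi>)"
  using assms(1,4)
proof (induction C rule: finite_induct)
  case empty
  then show ?case by (simp add: higher_deriv_const)
next
  case (insert c C)
  then have "(\<lambda>w. \<Sum>c\<in>C. f c w) holomorphic_on X"
    by (intro holomorphic_intros) auto
  then have "(deriv ^^ j) (\<lambda>w. f c w + (\<Sum>c\<in>C. f c w)) \<xi> =
      (deriv ^^ j) (f c) \<xi> + (deriv ^^ j) (\<lambda>w. \<Sum>c\<in>C. f c w) \<xi>"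
    using insert.prems assms(2,3) by (intro higher_deriv_add) auto
  then show ?case using insert by simp
qed

text \<open>Up to sign this is the value at \<open>w = a\<close> of the kernel
  \<open>1 / (w - \<xi>) ^ Suc j\<close>, the one that also occurs in \<open>Cauchy_chain\<close>.
  This is what lets a pole and the analytic part be handled by one functional.\<close>

lemma higher_deriv_inverse_diff:
  fixes a :: complex
  assumes "\<xi> \<noteq> a"
  shows "(deriv ^^ j) (\<lambda>w. 1 / (w - a)) \<xi> / fact j = - (1 / (a - \<xi>) ^ Suc j)"
  using assms
proof (induction j arbitrary: \<xi>)
  case 0
  then show ?case by (simp add: divide_simps)
next
  case (Suc j)
  have d: "((\<lambda>u. - fact j * inverse (a - u) ^ Suc j) has_field_derivative
      (- fact j * (of_nat (Suc j) * inverse (a - \<xi>) ^ Suc (Suc j)))) (at \<xi>)"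
  proof -
    have "((\<lambda>u. inverse (a - u)) has_field_derivative inverse (a - \<xi>) * inverse (a - \<xi>)) (at \<xi>)"
      using Suc.prems by (auto intro!: derivative_eq_intros)
    from DERIV_cmult[OF DERIV_power[OF this, of "Suc j"], of "- fact j"]
    show ?thesis by (simp add: mult_ac del: of_nat_Suc)
  qed
  have eq: "- fact j * inverse (a - u) ^ Suc j = (deriv ^^ j) (\<lambda>w. 1 / (w - a)) u"
    if "u \<in> - {a}" for u
    using Suc.IH[of u] that by (simp add: field_simps)
  have "((deriv ^^ j) (\<lambda>w. 1 / (w - a)) has_field_derivative
      (- fact j * (of_nat (Suc j) * inverse (a - \<xi>) ^ Suc (Suc j)))) (at \<xi>)"
    using Suc.prems by (intro has_field_derivative_transform_within_open[OF d, of "- {a}"] eq) (simp_all add: open_Compl)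
  then have "deriv ((deriv ^^ j) (\<lambda>w. 1 / (w - a))) \<xi> =
      - fact (Suc j) * inverse (a - \<xi>) ^ Suc (Suc j)"
    using DERIV_imp_deriv by (fastforce simp del: power_Suc)
  then show ?case
    by (simp del: power_Suc fact_Suc add: divide_inverse power_inverse)
qed

lemma psi_rec_left: "m \<le> n \<Longrightarrow> psi x m n w = (w - x m) * psi x (Suc m) n w"
  unfolding psi_def by (rule prod.atLeast_Suc_atMost)

lemma psi_rec_right: "m \<le> Suc n \<Longrightarrow> psi x m (Suc n) w = psi x m n w * (w - x (Suc n))"
  by (simp add: psi_def prod.nat_ivl_Suc' mult.commute)

lemma psi_nonzero: "(\<And>i. i \<in> {m..n} \<Longrightarrow> w \<noteq> x i) \<Longrightarrow> psi x m n w \<noteq> 0"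
  by (auto simp: psi_def)

lemma psi_split: "m \<le> Suc j \<Longrightarrow> j \<le> n \<Longrightarrow> psi x m n w = psi x m j w * psi x (Suc j) n w"
  unfolding psi_def using prod.ub_add_nat[of m j "\<lambda>r. w - x r" "n - j"] by simp

lemma continuous_on_psi [continuous_intros]:
  "continuous_on S f \<Longrightarrow> continuous_on S (\<lambda>w. psi x m n (f w))"
  unfolding psi_def by (intro continuous_intros)

lemma psi_all_equal:
  assumes "\<And>j. m \<le> j \<Longrightarrow> j \<le> n \<Longrightarrow> x j = x m" "m \<le> n"
  shows "psi x m n w = (w - x m) ^ Suc (n - m)"
proof -
  have "psi x m n w = (\<Prod>r=m..n. w - x m)"
    unfolding psi_def
  proof (rule prod.cong[OF refl])
    fix r assume "r \<in> {m..n}"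
    then show "w - x r = w - x m" using assms(1)[of r] by (simp only: atLeastAtMost_iff)
  qed
  also have "\<dots> = (w - x m) ^ Suc (n - m)"
    using assms(2) by (simp add: Suc_diff_le del: power_Suc)
  finally show ?thesis .
qed

text \<open>The recursion for divided differences is matched by \<open>1 / psi x (Suc m) n w - 1 /
  psi x m (n - 1) w = (x n - x m) / psi x m n w\<close>. Equal end points force all points between
  them to coincide, by the consecutive listing, so the base case is a pure power. The functional
  \<open>\<Lambda>\<close> is abstract and reads its argument only on \<open>\<Gamma>\<close>, so
  that integrals and evaluations at poles are both covered.\<close>

lemma divided_difference_functional:
  assumes "equal_points_consecutive N x" "1 \<le> m" "m \<le> n" "n \<le> N"
    and x: "\<And>i. i \<in> {m..n} \<Longrightarrow> x i \<in> X" and "X \<inter> \<Gamma> = {}"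
    and base: "\<And>\<xi> j. \<xi> \<in> X \<Longrightarrow> (deriv ^^ j) f \<xi> / fact j = \<Lambda> (\<lambda>w. 1 / (w - \<xi>) ^ Suc j)"
    and cong: "\<And>\<phi> \<eta>. (\<And>w. w \<in> \<Gamma> \<Longrightarrow> \<phi> w = \<eta> w) \<Longrightarrow> \<Lambda> \<phi> = \<Lambda> \<eta>"
    and add: "\<And>\<phi> \<eta>. continuous_on \<Gamma> \<phi> \<Longrightarrow> continuous_on \<Gamma> \<eta> \<Longrightarrow> \<Lambda> (\<lambda>w. \<phi> w + \<eta> w) = \<Lambda> \<phi> + \<Lambda> \<eta>"
    and cmult: "\<And>\<phi> d. continuous_on \<Gamma> \<phi> \<Longrightarrow> \<Lambda> (\<lambda>w. d * \<phi> w) = d * \<Lambda> \<phi>"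
  shows "divided_difference f x m n = \<Lambda> (\<lambda>w. 1 / psi x m n w)"
  using assms(2-4) x
proof (induction "n - m" arbitrary: m n rule: less_induct)
  case less
  have nz: "psi x m' n' w \<noteq> 0" if "w \<in> \<Gamma>" "{m'..n'} \<subseteq> {m..n}" for w m' n'
    using that less.prems(4) assms(6) by (intro psi_nonzero) blast
  have cont: "continuous_on \<Gamma> (\<lambda>w. 1 / psi x m' n' w)" if "{m'..n'} \<subseteq> {m..n}" for m' n'
    using nz[OF _ that] by (intro continuous_intros) auto
  show ?case
  proof (cases "x m = x n")
    case True
    have "x j = x m" if "m \<le> j" "j \<le> n" for j
      using assms(1) True that less.prems(1,3) unfolding equal_points_consecutive_def by blast
    then have "psi x m n w = (w - x m) ^ Suc (n - m)" for w
      using less.prems(2) by (intro psi_all_equal)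
    moreover have "divided_difference f x m n = (deriv ^^ (n - m)) f (x m) / fact (n - m)"
      by (subst divided_difference.simps) (simp add: True)
    ultimately show ?thesis
      using base[of "x m" "n - m"] less.prems(2,4) by simp
  next
    case False
    then have mn: "m < n" using less.prems(2) by (cases "m = n") auto
    then obtain n' where n': "n = Suc n'" by (cases n) auto
    have sub: "{Suc m..n} \<subseteq> {m..n}" "{m..n'} \<subseteq> {m..n}" using n' by auto
    have "divided_difference f x m n =
        (divided_difference f x (Suc m) n - divided_difference f x m n') / (x n - x m)"
      using mn False by (subst divided_difference.simps) (simp add: n')
    also have "divided_difference f x (Suc m) n = \<Lambda> (\<lambda>w. 1 / psi x (Suc m) n w)"
      using less.prems mn by (intro less.hyps) auto
    also have "divided_difference f x m n' = \<Lambda> (\<lambda>w. 1 / psi x m n' w)"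
      using less.prems mn n' by (intro less.hyps) auto
    also have "(\<Lambda> (\<lambda>w. 1 / psi x (Suc m) n w) - \<Lambda> (\<lambda>w. 1 / psi x m n' w)) / (x n - x m) =
        \<Lambda> (\<lambda>w. inverse (x n - x m) * (1 / psi x (Suc m) n w + (- 1) * (1 / psi x m n' w)))"
    proof -
      note c = cont[OF sub(1)] cont[OF sub(2)]
      have "\<Lambda> (\<lambda>w. inverse (x n - x m) * (1 / psi x (Suc m) n w + (- 1) * (1 / psi x m n' w))) =
          inverse (x n - x m) * \<Lambda> (\<lambda>w. 1 / psi x (Suc m) n w + (- 1) * (1 / psi x m n' w))"
        by (rule cmult) (intro continuous_on_add continuous_on_mult_const c continuous_on_mult continuous_on_const)
      also have "\<Lambda> (\<lambda>w. 1 / psi x (Suc m) n w + (- 1) * (1 / psi x m n' w)) =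
          \<Lambda> (\<lambda>w. 1 / psi x (Suc m) n w) + \<Lambda> (\<lambda>w. (- 1) * (1 / psi x m n' w))"
        by (rule add) (intro c continuous_on_mult continuous_on_const)+
      also have "\<Lambda> (\<lambda>w. (- 1) * (1 / psi x m n' w)) = (- 1) * \<Lambda> (\<lambda>w. 1 / psi x m n' w)"
        by (rule cmult) (rule c)
      finally show ?thesis by (simp add: divide_inverse mult.commute)
    qed
    also have "\<dots> = \<Lambda> (\<lambda>w. 1 / psi x m n w)"
    proof (rule cong)
      fix w assume w: "w \<in> \<Gamma>"
      note nz' = nz[OF w sub(1)] nz[OF w sub(2)] nz[OF w order.refl]
      have "psi x m n w = (w - x m) * psi x (Suc m) n w" "psi x m n w = psi x m n' w * (w - x n)"
        using mn n' psi_rec_left[of m n x w] psi_rec_right[of m n' x w] by simp_all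
      then have "1 / psi x (Suc m) n w = (w - x m) / psi x m n w"
        "1 / psi x m n' w = (w - x n) / psi x m n w"
        using nz' by (simp_all add: divide_simps mult.commute)
      then have "inverse (x n - x m) * (1 / psi x (Suc m) n w + (- 1) * (1 / psi x m n' w)) =
          inverse (x n - x m) * (((w - x m) - (w - x n)) / psi x m n w)"
        by (simp add: diff_divide_distrib)
      also have "\<dots> = 1 / psi x m n w"
        using False by simp
      finally show "inverse (x n - x m) * (1 / psi x (Suc m) n w + (- 1) * (1 / psi x m n' w)) = 1 / psi x m n w" .
    qed
    finally show ?thesis .
  qed
qed

text \<open>Holomorphy enters because coincident nodes bring in \<open>deriv\<close>, which is
  linear only where the derivatives exist.\<close>

lemma divided_difference_sum:
  assumes "finite C" "open X" "\<And>c. c \<in> C \<Longrightarrow> f c holomorphic_on X"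
    and "m \<le> n" "\<And>i. i \<in> {m..n} \<Longrightarrow> x i \<in> X"
  shows "divided_difference (\<lambda>w. \<Sum>c\<in>C. l c * f c w) x m n = (\<Sum>c\<in>C. l c * divided_difference (f c) x m n)"
  using assms(4,5)
proof (induction "n - m" arbitrary: m n rule: less_induct)
  case less
  show ?case
  proof (cases "n \<le> m \<or> x m = x n")
    case True
    have "(deriv ^^ j) (\<lambda>w. \<Sum>c\<in>C. l c * f c w) (x m) = (\<Sum>c\<in>C. l c * (deriv ^^ j) (f c) (x m))" for j
    proof -
      have xm: "x m \<in> X" using less.prems by simp
      have "(deriv ^^ j) (\<lambda>w. \<Sum>c\<in>C. l c * f c w) (x m) = (\<Sum>c\<in>C. (deriv ^^ j) (\<lambda>w. l c * f c w) (x m))"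
        by (rule higher_deriv_sum[OF assms(1,2) xm]) (intro holomorphic_intros assms(3))
      also have "\<dots> = (\<Sum>c\<in>C. l c * (deriv ^^ j) (f c) (x m))"
        by (intro sum.cong refl higher_deriv_cmult[OF assms(3) xm assms(2)])
      finally show ?thesis .
    qed
    moreover have "divided_difference h x m n = (deriv ^^ (n - m)) h (x m) / fact (n - m)" for h
      using True by (subst divided_difference.simps) (rule if_P)
    ultimately show ?thesis
      by (simp add: sum_divide_distrib)
  next
    case False
    have IH: "divided_difference (\<lambda>w. \<Sum>c\<in>C. l c * f c w) x (m + 1) n =
          (\<Sum>c\<in>C. l c * divided_difference (f c) x (m + 1) n)"
        "divided_difference (\<lambda>w. \<Sum>c\<in>C. l c * f c w) x m (n - 1) =
          (\<Sum>c\<in>C. l c * divided_difference (f c) x m (n - 1))"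
      by (intro less.hyps; use False less.prems in force)+
    have "divided_difference (\<lambda>w. \<Sum>c\<in>C. l c * f c w) x m n =
       ((\<Sum>c\<in>C. l c * divided_difference (f c) x (m + 1) n) -
        (\<Sum>c\<in>C. l c * divided_difference (f c) x m (n - 1))) / (x n - x m)"
      unfolding IH[symmetric] using False by (subst divided_difference.simps) (rule if_not_P)
    also have "\<dots> = (\<Sum>c\<in>C. l c * ((divided_difference (f c) x (m + 1) n -
        divided_difference (f c) x m (n - 1)) / (x n - x m)))"
      by (simp add: sum_subtractf[symmetric] sum_divide_distrib right_diff_distrib)
    also have "\<dots> = (\<Sum>c\<in>C. l c * divided_difference (f c) x m n)"
    proof (intro sum.cong refl arg_cong2[where f="(*)"])
      fix c
      show "(divided_difference (f c) x (m + 1) n - divided_difference (f c) x m (n - 1)) / (x n - x m) =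
          divided_difference (f c) x m n"
        using False by (subst (3) divided_difference.simps) (rule if_not_P[symmetric])
    qed
    finally show ?thesis .
  qed
qed

text \<open>Vector divided differences and analyticity are defined by components; this expansion
  carries them over to scalar functions such as \<open>ip q (F w)\<close>.\<close>

lemma inner_product_expansion:
  assumes "is_inner_product ip"
  shows "ip q y = (\<Sum>c\<in>UNIV. ip q (axis c 1) * vec_nth y c)"
proof -
  have add: "ip q (u + w) = ip q u + ip q w" and scale: "ip q (a *s u) = a * ip q u" for u w a
    using assms unfolding is_inner_product_def by blast+
  have zero: "ip q 0 = 0"
    using scale[of 0 0] by simp
  have sum: "ip q (\<Sum>c\<in>C. f c) = (\<Sum>c\<in>C. ip q (f c))" if "finite C" for C :: "'a set" and f
    using that by (induction C rule: finite_induct) (auto simp: add zero)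
  have "ip q y = ip q (\<Sum>c\<in>UNIV. vec_nth y c *s axis c 1)"
    by (simp only: basis_expansion)
  also have "\<dots> = (\<Sum>c\<in>UNIV. ip q (axis c 1) * vec_nth y c)"
    unfolding sum[OF finite_class.finite_UNIV] scale by (simp only: mult.commute)
  finally show ?thesis .
qed

lemma inner_product_vec_divided_difference:
  assumes "is_inner_product ip" "open X" "\<And>c. (\<lambda>w. vec_nth (F w) c) holomorphic_on X"
    and "m \<le> n" "\<And>i. i \<in> {m..n} \<Longrightarrow> x i \<in> X"
  shows "ip q (vec_divided_difference F x m n) = divided_difference (\<lambda>w. ip q (F w)) x m n"
proof -
  have "ip q (vec_divided_difference F x m n) =
      (\<Sum>c\<in>UNIV. ip q (axis c 1) * divided_difference (\<lambda>w. vec_nth (F w) c) x m n)"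
    by (subst inner_product_expansion[OF assms(1)]) (simp add: vec_divided_difference_def)
  also have "\<dots> = divided_difference (\<lambda>w. \<Sum>c\<in>UNIV. ip q (axis c 1) * vec_nth (F w) c) x m n"
    by (rule divided_difference_sum[OF finite_class.finite_UNIV assms(2,3,4,5), symmetric])
  also have "(\<lambda>w. \<Sum>c\<in>UNIV. ip q (axis c 1) * vec_nth (F w) c) = (\<lambda>w. ip q (F w))"
    by (rule ext) (rule inner_product_expansion[OF assms(1), symmetric])
  finally show ?thesis .
qed

text \<open>The divided difference of \<open>\<Sum>\<^sub>s a\<^sub>s / (w - z\<^sub>s) + \<theta>\<close> over the points with nodal polynomial \<open>\<psi>\<close> is the
  value of this functional at \<open>1 / \<psi>\<close>.\<close>

definition residue_functional ::
    "(complex \<times> complex \<times> complex) list \<Rightarrow> (complex \<Rightarrow> complex) \<Rightarrow> (nat \<Rightarrow> complex) \<Rightarrow> (nat \<Rightarrow> complex) \<Rightarrow>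
     nat \<Rightarrow> (complex \<Rightarrow> complex) \<Rightarrow> complex" where
  "residue_functional \<Gamma> \<theta> a z \<mu> \<phi> =
     chain_integral \<Gamma> (\<lambda>w. \<theta> w * \<phi> w) - (\<Sum>s=1..\<mu>. a s * \<phi> (z s))"

lemma residue_functional_cong:
  assumes "\<And>w. w \<in> chain_support \<Gamma> \<union> z ` {1..\<mu>} \<Longrightarrow> \<phi> w = \<eta> w"
  shows "residue_functional \<Gamma> \<theta> a z \<mu> \<phi> = residue_functional \<Gamma> \<theta> a z \<mu> \<eta>"
proof -
  have "chain_integral \<Gamma> (\<lambda>w. \<theta> w * \<phi> w) = chain_integral \<Gamma> (\<lambda>w. \<theta> w * \<eta> w)"
    using assms by (intro chain_integral_cong) simp
  moreover have "(\<Sum>s=1..\<mu>. a s * \<phi> (z s)) = (\<Sum>s=1..\<mu>. a s * \<eta> (z s))"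
    using assms by (intro sum.cong) simp_all
  ultimately show ?thesis by (simp add: residue_functional_def)
qed

lemma residue_functional_add:
  assumes "continuous_on (chain_support \<Gamma>) \<theta>"
    and "continuous_on (chain_support \<Gamma> \<union> z ` {1..\<mu>}) \<phi>" "continuous_on (chain_support \<Gamma> \<union> z ` {1..\<mu>}) \<eta>"
  shows "residue_functional \<Gamma> \<theta> a z \<mu> (\<lambda>w. \<phi> w + \<eta> w) =
    residue_functional \<Gamma> \<theta> a z \<mu> \<phi> + residue_functional \<Gamma> \<theta> a z \<mu> \<eta>"
proof -
  have "continuous_on (chain_support \<Gamma>) (\<lambda>w. \<theta> w * \<phi> w)" "continuous_on (chain_support \<Gamma>) (\<lambda>w. \<theta> w * \<eta> w)"
    using assms by (auto intro!: continuous_on_mult intro: continuous_on_subset)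
  from chain_integral_add[OF this] show ?thesis
    by (simp add: residue_functional_def distrib_left sum.distrib)
qed

lemma residue_functional_cmult:
  assumes "continuous_on (chain_support \<Gamma>) \<theta>" "continuous_on (chain_support \<Gamma> \<union> z ` {1..\<mu>}) \<phi>"
  shows "residue_functional \<Gamma> \<theta> a z \<mu> (\<lambda>w. d * \<phi> w) = d * residue_functional \<Gamma> \<theta> a z \<mu> \<phi>"
proof -
  have "continuous_on (chain_support \<Gamma>) (\<lambda>w. \<theta> w * \<phi> w)"
    using assms by (auto intro!: continuous_on_mult intro: continuous_on_subset)
  from chain_integral_cmult[OF this, of d] show ?thesis
    by (simp add: residue_functional_def right_diff_distrib sum_distrib_left mult.left_commute)
qed

lemma residue_functional_sum:
  assumes "continuous_on (chain_support \<Gamma>) \<theta>" "finite J"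
    and "\<And>j. j \<in> J \<Longrightarrow> continuous_on (chain_support \<Gamma> \<union> z ` {1..\<mu>}) (\<phi> j)"
  shows "residue_functional \<Gamma> \<theta> a z \<mu> (\<lambda>w. \<Sum>j\<in>J. c j * \<phi> j w) =
    (\<Sum>j\<in>J. c j * residue_functional \<Gamma> \<theta> a z \<mu> (\<phi> j))"
  using assms(2,3)
proof (induction J rule: finite_induct)
  case empty
  show ?case
    using residue_functional_cmult[OF assms(1), where d=0 and \<phi>="\<lambda>_. 0"] by simp
next
  case (insert j J)
  have "residue_functional \<Gamma> \<theta> a z \<mu> (\<lambda>w. c j * \<phi> j w + (\<Sum>j\<in>J. c j * \<phi> j w)) =
      residue_functional \<Gamma> \<theta> a z \<mu> (\<lambda>w. c j * \<phi> j w) +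
      residue_functional \<Gamma> \<theta> a z \<mu> (\<lambda>w. \<Sum>j\<in>J. c j * \<phi> j w)"
    using insert.prems
    by (intro residue_functional_add[OF assms(1)] continuous_on_mult continuous_on_const continuous_on_sum) auto
  then show ?case
    using insert by (simp add: residue_functional_cmult[OF assms(1)])
qed

text \<open>All entries are brought to the common denominator \<open>psi x 1 (p + k)\<close>, the
  missing factors being the first \<open>j\<close> and the last \<open>k - i\<close> nodes. The
  indices thus separate: column combinations build the denominator polynomial, row combinations the
  test polynomial. The condition \<open>k \<le> p\<close> guarantees
  \<open>j + 1 \<le> p + i\<close>.\<close>

lemma itea_u_residue_functional:
  assumes ip: "is_inner_product ip" and X: "open X" "X \<inter> (chain_support \<Gamma> \<union> z ` {1..\<mu>}) = {}"
    and FX: "\<And>c. (\<lambda>w. vec_nth (F w) c) holomorphic_on X"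
    and F: "\<And>w. w \<in> X \<Longrightarrow> F w = (\<Sum>s=1..\<mu>. (1 / (w - z s)) *s v s) + \<Theta> w"
    and \<Theta>X: "(\<lambda>w. ip q (\<Theta> w)) holomorphic_on X"
    and cont: "continuous_on (chain_support \<Gamma>) (\<lambda>w. ip q (\<Theta> w))"
    and Cauchy: "\<And>\<xi> j. \<xi> \<in> X \<Longrightarrow> (deriv ^^ j) (\<lambda>w. ip q (\<Theta> w)) \<xi> / fact j =
      chain_integral \<Gamma> (\<lambda>w. ip q (\<Theta> w) / (w - \<xi>) ^ Suc j)"
    and x: "equal_points_consecutive (p + k) x" "\<And>i. i \<in> {1..p+k} \<Longrightarrow> x i \<in> X"
    and ij: "1 \<le> i" "i \<le> k" "j \<le> k" "k \<le> p"
  shows "itea_u ip q F x p i j = residue_functional \<Gamma> (\<lambda>w. ip q (\<Theta> w)) (\<lambda>s. ip q (v s)) z \<mu>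
    (\<lambda>w. psi x 1 j w * psi x (p + i + 1) (p + k) w / psi x 1 (p + k) w)"
proof -
  let ?\<Lambda> = "residue_functional \<Gamma> (\<lambda>w. ip q (\<Theta> w)) (\<lambda>s. ip q (v s)) z \<mu>"
  let ?f = "\<lambda>w. ip q (F w)"
  have add: "ip q (u + w) = ip q u + ip q w" and scale: "ip q (a *s u) = a * ip q u" for u w a
    using ip unfolding is_inner_product_def by blast+
  have zero: "ip q 0 = 0"
    using scale[of 0 0] by simp
  have sum: "ip q (\<Sum>s=1..m. (1 / (w - z s)) *s v s) = (\<Sum>s=1..m. ip q (v s) * (1 / (w - z s)))" for w m
    by (induction m) (auto simp: add zero scale)
  have f: "?f w = (\<Sum>s=1..\<mu>. ip q (v s) * (1 / (w - z s))) + ip q (\<Theta> w)" if "w \<in> X" for w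
    using F[OF that] by (simp only: add sum)
  have base: "(deriv ^^ j) ?f \<xi> / fact j = ?\<Lambda> (\<lambda>w. 1 / (w - \<xi>) ^ Suc j)" if \<xi>: "\<xi> \<in> X" for \<xi> j
  proof -
    have nz: "\<xi> \<noteq> z s" if "s \<in> {1..\<mu>}" for s
      using X(2) \<xi> that by blast
    have hs: "(\<lambda>w. 1 / (w - z s)) holomorphic_on X" if "s \<in> {1..\<mu>}" for s
      using X(2) that by (intro holomorphic_intros) auto
    have hX: "?f holomorphic_on X"
    proof (rule holomorphic_transform)
      show "(\<lambda>w. (\<Sum>s=1..\<mu>. ip q (v s) * (1 / (w - z s))) + ip q (\<Theta> w)) holomorphic_on X"
        using hs by (intro holomorphic_on_add \<Theta>X holomorphic_on_sum holomorphic_on_mult holomorphic_on_const)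
    qed (simp only: f)
    have hsum: "(\<lambda>w. \<Sum>s=1..\<mu>. ip q (v s) * (1 / (w - z s))) holomorphic_on X"
      using hs by (intro holomorphic_on_sum holomorphic_on_mult holomorphic_on_const)
    have "(deriv ^^ j) ?f \<xi> =
        (deriv ^^ j) (\<lambda>w. (\<Sum>s=1..\<mu>. ip q (v s) * (1 / (w - z s))) + ip q (\<Theta> w)) \<xi>"
      by (rule higher_deriv_transform_within_open[OF hX holomorphic_on_add[OF hsum \<Theta>X] X(1) \<xi> f])
    also have "\<dots> = (deriv ^^ j) (\<lambda>w. \<Sum>s=1..\<mu>. ip q (v s) * (1 / (w - z s))) \<xi> +
        (deriv ^^ j) (\<lambda>w. ip q (\<Theta> w)) \<xi>"
      by (rule higher_deriv_add[OF hsum \<Theta>X X(1) \<xi>])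
    also have "(deriv ^^ j) (\<lambda>w. \<Sum>s=1..\<mu>. ip q (v s) * (1 / (w - z s))) \<xi> =
        (\<Sum>s=1..\<mu>. (deriv ^^ j) (\<lambda>w. ip q (v s) * (1 / (w - z s))) \<xi>)"
      by (rule higher_deriv_sum[OF finite_atLeastAtMost X(1) \<xi>])
        (intro holomorphic_on_mult holomorphic_on_const hs)
    also have "\<dots> = (\<Sum>s=1..\<mu>. ip q (v s) * (deriv ^^ j) (\<lambda>w. 1 / (w - z s)) \<xi>)"
      by (intro sum.cong refl higher_deriv_cmult[OF hs \<xi> X(1)])
    finally have "(deriv ^^ j) ?f \<xi> / fact j =
        (\<Sum>s=1..\<mu>. ip q (v s) * ((deriv ^^ j) (\<lambda>w. 1 / (w - z s)) \<xi> / fact j)) +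
        (deriv ^^ j) (\<lambda>w. ip q (\<Theta> w)) \<xi> / fact j"
      by (simp add: add_divide_distrib sum_divide_distrib)
    also have "(\<Sum>s=1..\<mu>. ip q (v s) * ((deriv ^^ j) (\<lambda>w. 1 / (w - z s)) \<xi> / fact j)) =
        (\<Sum>s=1..\<mu>. - (ip q (v s) * (1 / (z s - \<xi>) ^ Suc j)))"
      using higher_deriv_inverse_diff[OF nz] by (intro sum.cong refl) simp
    finally show ?thesis
      using Cauchy[OF \<xi>, of j] by (simp add: residue_functional_def sum_negf)
  qed
  have ij': "1 \<le> j + 1" "j + 1 \<le> p + i" "p + i \<le> p + k"
    using ij by auto
  have "itea_u ip q F x p i j = divided_difference ?f x (j + 1) (p + i)"
    unfolding itea_u_def
    using x(2) ij' by (intro inner_product_vec_divided_difference[OF ip X(1) FX]) auto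
  also have "\<dots> = ?\<Lambda> (\<lambda>w. 1 / psi x (j + 1) (p + i) w)"
  proof (rule divided_difference_functional[OF x(1) ij' _ X(2) base])
    show "x i' \<in> X" if "i' \<in> {j + 1..p + i}" for i'
      using that ij' by (intro x(2)) auto
  qed (auto intro: residue_functional_cong residue_functional_add[OF cont] residue_functional_cmult[OF cont])
  also have "\<dots> = ?\<Lambda> (\<lambda>w. psi x 1 j w * psi x (p + i + 1) (p + k) w / psi x 1 (p + k) w)"
  proof (rule residue_functional_cong)
    fix w assume w: "w \<in> chain_support \<Gamma> \<union> z ` {1..\<mu>}"
    have nz: "psi x m n w \<noteq> 0" if "1 \<le> m" "n \<le> p + k" for m n
    proof (rule psi_nonzero)
      fix i' assume "i' \<in> {m..n}"
      then have "x i' \<in> X" using that by (intro x(2)) simp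
      then show "w \<noteq> x i'" using w X(2) by blast
    qed
    have "psi x 1 (p + k) w = psi x 1 j w * psi x (Suc j) (p + k) w"
      using ij' by (intro psi_split) auto
    also have "psi x (Suc j) (p + k) w = psi x (Suc j) (p + i) w * psi x (Suc (p + i)) (p + k) w"
      using ij' by (intro psi_split) auto
    finally have "psi x 1 (p + k) w =
        psi x 1 j w * (psi x (Suc j) (p + i) w * psi x (Suc (p + i)) (p + k) w)" .
    then show "1 / psi x (j + 1) (p + i) w =
        psi x 1 j w * psi x (p + i + 1) (p + k) w / psi x 1 (p + k) w"
      using nz[of 1 j] nz[of "Suc j" "p + i"] nz[of "Suc (p + i)" "p + k"] ij'
      by (simp add: field_simps)
  qed
  finally show ?thesis .
qed

section \<open>Newton and Lagrange bases, and the orthogonality relations\<close>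

lemma monic_basis_span:
  fixes P :: "complex poly"
  assumes "\<And>j. degree (B j) = j" "\<And>j. lead_coeff (B j) = 1" "degree P \<le> d"
  shows "\<exists>b. P = (\<Sum>j\<le>d. Polynomial.smult (b j) (B j))"
  using assms(3)
proof (induction d arbitrary: P)
  case 0
  then obtain c where c: "P = [:c:]" using degree_eq_zeroE by blast
  obtain e where e: "B 0 = [:e:]" using degree_eq_zeroE assms(1)[of 0] by blast
  with assms(2)[of 0] c show ?case
    by (intro exI[of _ "\<lambda>_. c"]) simp
next
  case (Suc d)
  define Q where "Q = P - Polynomial.smult (coeff P (Suc d)) (B (Suc d))"
  have "coeff Q i = 0" if "i > d" for i
  proof (cases "i = Suc d")
    case True
    then show ?thesis using assms(1,2)[of "Suc d"] by (simp add: Q_def)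
  next
    case False
    with that have "i > Suc d" by simp
    then show ?thesis
      using assms(1)[of "Suc d"] Suc.prems by (simp add: Q_def coeff_eq_0)
  qed
  then have "degree Q \<le> d" by (intro degree_le) auto
  then obtain b where b: "Q = (\<Sum>j\<le>d. Polynomial.smult (b j) (B j))" using Suc.IH by blast
  have "P = Q + Polynomial.smult (coeff P (Suc d)) (B (Suc d))" by (simp add: Q_def)
  also have "\<dots> = (\<Sum>j\<le>Suc d. Polynomial.smult ((b(Suc d := coeff P (Suc d))) j) (B j))"
    by (simp add: b)
  finally show ?case by blast
qed

lemma monic_basis_independent:
  fixes B :: "nat \<Rightarrow> complex poly"
  assumes "\<And>j. degree (B j) = j" "\<And>j. lead_coeff (B j) = 1"
    and "(\<Sum>j<d. Polynomial.smult (b j) (B j)) = 0" "j < d"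
  shows "b j = 0"
  using assms(3,4)
proof (induction d)
  case (Suc d)
  have "coeff (\<Sum>j<d. Polynomial.smult (b j) (B j)) d = 0"
    using assms(1) by (simp add: coeff_sum coeff_eq_0)
  then have "coeff (\<Sum>j<Suc d. Polynomial.smult (b j) (B j)) d = b d"
    using assms(1,2)[of d] by simp
  then have "b d = 0" unfolding Suc.prems(1) by simp
  then show ?case using Suc by (cases "j = d") auto
qed simp

definition psi_poly :: "(nat \<Rightarrow> complex) \<Rightarrow> nat \<Rightarrow> nat \<Rightarrow> complex poly" where
  "psi_poly x m n = (\<Prod>r=m..n. [:- x r, 1:])"

lemma poly_psi_poly [simp]: "poly (psi_poly x m n) w = psi x m n w"
  by (simp add: psi_poly_def psi_def poly_prod)

lemma degree_psi_poly [simp]: "degree (psi_poly x m n) = Suc n - m"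
  unfolding psi_poly_def by (subst degree_prod_sum_eq) auto

lemma lead_coeff_psi_poly [simp]: "lead_coeff (psi_poly x m n) = 1"
  unfolding psi_poly_def by (subst lead_coeff_prod) auto

text \<open>The factors contributed by rows \<open>i = 1, ..., k\<close> have degrees
  \<open>k - i\<close>, hence one of each degree below \<open>k\<close>: a Newton basis built from
  the last nodes.\<close>

lemma backward_newton_expansion:
  assumes "degree P < k" "1 \<le> k"
  obtains b where "\<And>w. poly P w = (\<Sum>i=1..k. b i * psi x (p + i + 1) (p + k) w)"
proof -
  \<comment> \<open>\<open>monic_basis_span\<close> asks for a monic polynomial of every degree;
    beyond \<open>p + k\<close> the nodes run out and monomials fill in.\<close>
  define B where "B j = (if j \<le> p + k then psi_poly x (p + k + 1 - j) (p + k) else monom 1 j)" for j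
  have "degree (B j) = j" for j
    by (auto simp: B_def degree_monom_eq)
  moreover have "lead_coeff (B j) = 1" for j
    by (cases "j \<le> p + k") (simp_all del: degree_psi_poly add: B_def degree_monom_eq)
  ultimately obtain b where b: "P = (\<Sum>j\<le>k - 1. Polynomial.smult (b j) (B j))"
    using assms monic_basis_span[of B P "k - 1"] by force
  have "poly P w = (\<Sum>i=1..k. b (k - i) * psi x (p + i + 1) (p + k) w)" for w
  proof -
    have "poly P w = (\<Sum>j\<le>k - 1. b j * poly (B j) w)"
      by (subst b) (simp add: poly_sum)
    also have "\<dots> = (\<Sum>i=1..k. b (k - i) * poly (B (k - i)) w)"
      using assms(2) by (intro sum.reindex_bij_witness[of _ "\<lambda>i. k - i" "\<lambda>i. k - i"]) auto
    also have "\<dots> = (\<Sum>i=1..k. b (k - i) * psi x (p + i + 1) (p + k) w)"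
      by (intro sum.cong refl) (auto simp: B_def Suc_diff_le)
    finally show ?thesis .
  qed
  then show ?thesis by (rule that)
qed

text \<open>The \<open>i\<close>-th equation tests against the \<open>i\<close>-th backward Newton
  polynomial, and these span all test polynomials. The coefficients \<open>c\<close> are not
  normalised: \<open>c k = 1\<close> gives the denominator and \<open>c k = 0\<close> a kernel
  vector of the linear system.\<close>

lemma itea_orthogonality:
  assumes cont: "continuous_on (chain_support \<Gamma>) \<theta>"
    and nz: "\<And>w. w \<in> chain_support \<Gamma> \<union> z ` {1..\<mu>} \<Longrightarrow> psi x 1 (p + k) w \<noteq> 0"
    and u: "\<And>i j. \<lbrakk>1 \<le> i; i \<le> k; j \<le> k\<rbrakk> \<Longrightarrow> u i j = residue_functional \<Gamma> \<theta> a z \<mu>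
      (\<lambda>w. psi x 1 j w * psi x (p + i + 1) (p + k) w / psi x 1 (p + k) w)"
    and c: "\<And>i. i \<in> {1..k} \<Longrightarrow> (\<Sum>j\<le>k. c j * u i j) = 0"
    and P: "degree P < k" "1 \<le> k"
  shows "residue_functional \<Gamma> \<theta> a z \<mu>
    (\<lambda>w. (\<Sum>j\<le>k. c j * psi x 1 j w) * poly P w / psi x 1 (p + k) w) = 0"
proof -
  let ?S = "chain_support \<Gamma> \<union> z ` {1..\<mu>}"
  let ?\<Lambda> = "residue_functional \<Gamma> \<theta> a z \<mu>"
  define \<phi> where "\<phi> i j w = psi x 1 j w * psi x (p + i + 1) (p + k) w / psi x 1 (p + k) w" for i j w
  have cont\<phi>: "continuous_on ?S (\<phi> i j)" for i j
    unfolding \<phi>_def using nz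
    by (intro continuous_on_divide continuous_on_mult continuous_on_psi continuous_on_id ballI)
  obtain b where b: "\<And>w. poly P w = (\<Sum>i=1..k. b i * psi x (p + i + 1) (p + k) w)"
    by (rule backward_newton_expansion[OF P]) blast
  have eq: "(\<lambda>w. (\<Sum>j\<le>k. c j * psi x 1 j w) * poly P w / psi x 1 (p + k) w) =
      (\<lambda>w. \<Sum>i=1..k. b i * (\<Sum>j\<le>k. c j * \<phi> i j w))"
    by (rule ext, unfold b \<phi>_def)
      (simp add: sum_product sum_divide_distrib sum_distrib_left mult_ac sum.swap[of _ "{..k}"])
  have "?\<Lambda> (\<lambda>w. (\<Sum>j\<le>k. c j * psi x 1 j w) * poly P w / psi x 1 (p + k) w) =
      (\<Sum>i=1..k. b i * ?\<Lambda> (\<lambda>w. \<Sum>j\<le>k. c j * \<phi> i j w))"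
    unfolding eq using cont\<phi> by (intro residue_functional_sum[OF cont] continuous_on_sum continuous_on_mult continuous_on_const) auto
  also have "\<dots> = (\<Sum>i=1..k. b i * (\<Sum>j\<le>k. c j * ?\<Lambda> (\<phi> i j)))"
    using cont\<phi> by (subst residue_functional_sum[OF cont]) auto
  also have "\<dots> = (\<Sum>i=1..k. b i * (\<Sum>j\<le>k. c j * u i j))"
    by (intro sum.cong refl arg_cong2[where f="(*)"]) (simp add: u \<phi>_def[abs_def])
  also have "\<dots> = 0"
    using c by simp
  finally show ?thesis .
qed

definition lagrange_poly :: "(nat \<Rightarrow> complex) \<Rightarrow> nat \<Rightarrow> nat \<Rightarrow> complex poly" where
  "lagrange_poly z k m = (\<Prod>i\<in>{1..k} - {m}. Polynomial.smult (1 / (z m - z i)) [:- z i, 1:])"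

lemma poly_lagrange_poly:
  "poly (lagrange_poly z k m) w = (\<Prod>i\<in>{1..k} - {m}. (w - z i) / (z m - z i))"
  by (simp add: lagrange_poly_def poly_prod diff_divide_distrib)

lemma degree_lagrange_poly:
  assumes "m \<in> {1..k}"
  shows "degree (lagrange_poly z k m) < k"
proof -
  have "degree (lagrange_poly z k m) \<le>
      (\<Sum>i\<in>{1..k} - {m}. degree (Polynomial.smult (1 / (z m - z i)) [:- z i, 1:]))"
    unfolding lagrange_poly_def by (rule degree_prod_sum_le[of "{1..k} - {m}", unfolded comp_def]) simp
  also have "\<dots> \<le> (\<Sum>i\<in>{1..k} - {m}. 1)"
    by (intro sum_mono) simp
  also have "\<dots> = k - 1"
    using assms by simp
  finally show ?thesis using assms by auto
qed

lemma lagrange_poly_node: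
  assumes "inj_on z {1..k}" "m \<in> {1..k}" "s \<in> {1..k}"
  shows "poly (lagrange_poly z k m) (z s) = (if s = m then 1 else 0)"
proof (cases "s = m")
  case True
  have "z m \<noteq> z i" if "i \<in> {1..k} - {m}" for i
    using assms that by (auto dest: inj_onD)
  then show ?thesis using True by (simp add: poly_lagrange_poly)
next
  case False
  then show ?thesis using assms by (auto simp: poly_lagrange_poly)
qed

lemma lagrange_interpolation:
  assumes inj: "inj_on z {1..k}" and P: "degree P < k"
  shows "P = (\<Sum>m=1..k. Polynomial.smult (poly P (z m)) (lagrange_poly z k m))"
proof -
  define Q where "Q = P - (\<Sum>m=1..k. Polynomial.smult (poly P (z m)) (lagrange_poly z k m))"
  have "degree (\<Sum>m=1..k. Polynomial.smult (poly P (z m)) (lagrange_poly z k m)) < k"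
    using P by (intro degree_sum_less)
      (auto intro: le_less_trans[OF degree_smult_le] degree_lagrange_poly)
  then have degQ: "degree Q < k"
    unfolding Q_def using P by (intro degree_diff_less)
  have "poly Q (z s) = 0" if "s \<in> {1..k}" for s
  proof -
    have "poly (\<Sum>m=1..k. Polynomial.smult (poly P (z m)) (lagrange_poly z k m)) (z s) =
        (\<Sum>m=1..k. if m = s then poly P (z m) else 0)"
      unfolding poly_sum poly_smult using that
      by (intro sum.cong refl) (auto simp: lagrange_poly_node[OF inj])
    also have "\<dots> = poly P (z s)"
      using that by simp
    finally show ?thesis by (simp add: Q_def)
  qed
  then have sub: "z ` {1..k} \<subseteq> {w. poly Q w = 0}" by auto
  have "Q = 0"
  proof (rule ccontr)
    assume "Q \<noteq> 0"
    then have "card (z ` {1..k}) \<le> card {w. poly Q w = 0}"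
      by (intro card_mono poly_roots_finite sub)
    also have "\<dots> \<le> degree Q"
      using \<open>Q \<noteq> 0\<close> by (rule card_poly_roots_bound)
    finally show False using degQ inj by (simp add: card_image)
  qed
  then show ?thesis by (simp add: Q_def)
qed

text \<open>A test polynomial of degree below \<open>k\<close> can be made to vanish at
  \<open>k - 1\<close> poles, which is why the poles beyond the first \<open>k\<close> remain in the
  sum.\<close>

lemma itea_residue_identity:
  assumes "continuous_on (chain_support \<Gamma>) \<theta>"
    and "\<And>w. w \<in> chain_support \<Gamma> \<union> z ` {1..\<mu>} \<Longrightarrow> psi x 1 (p + k) w \<noteq> 0"
    and "\<And>i j. \<lbrakk>1 \<le> i; i \<le> k; j \<le> k\<rbrakk> \<Longrightarrow> u i j = residue_functional \<Gamma> \<theta> a z \<mu>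
      (\<lambda>w. psi x 1 j w * psi x (p + i + 1) (p + k) w / psi x 1 (p + k) w)"
    and "\<And>i. i \<in> {1..k} \<Longrightarrow> (\<Sum>j\<le>k. c j * u i j) = 0"
    and m: "m \<in> {1..k}" and k: "k \<le> \<mu>" and inj: "inj_on z {1..\<mu>}"
  defines "W \<equiv> \<lambda>w. \<Sum>j\<le>k. c j * psi x 1 j w"
  shows "a m * W (z m) / psi x 1 (p + k) (z m) +
      (\<Sum>s=k+1..\<mu>. a s * W (z s) * poly (lagrange_poly z k m) (z s) / psi x 1 (p + k) (z s)) =
    chain_integral \<Gamma> (\<lambda>w. \<theta> w * (W w * poly (lagrange_poly z k m) w / psi x 1 (p + k) w))"
proof -
  let ?L = "poly (lagrange_poly z k m)"
  let ?t = "\<lambda>s. a s * (W (z s) * ?L (z s) / psi x 1 (p + k) (z s))"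
  have "1 \<le> k" using m by simp
  have inj': "inj_on z {1..k}" using inj k by (auto intro: inj_on_subset)
  have "chain_integral \<Gamma> (\<lambda>w. \<theta> w * (W w * ?L w / psi x 1 (p + k) w)) = (\<Sum>s=1..\<mu>. ?t s)"
    using itea_orthogonality[of \<Gamma> \<theta> z \<mu> x p k u a c, OF assms(1-4) degree_lagrange_poly[OF m] \<open>1 \<le> k\<close>]
    unfolding residue_functional_def W_def by (simp only: right_minus_eq)
  also have "\<dots> = (\<Sum>s=1..k. ?t s) + (\<Sum>s=k+1..\<mu>. ?t s)"
    using k sum.ub_add_nat[of 1 k ?t "\<mu> - k"] by simp
  also have "(\<Sum>s=1..k. ?t s) = (\<Sum>s=1..k. if s = m then a m * W (z m) / psi x 1 (p + k) (z m) else 0)"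
    using lagrange_poly_node[OF inj' m] by (intro sum.cong refl) auto
  also have "\<dots> = a m * W (z m) / psi x 1 (p + k) (z m)"
    using m by simp
  finally show ?thesis by (simp add: mult.assoc)
qed

subsection \<open>Asymptotics of the zeros\<close>

lemma eventually_power_le_of_root_tendsto:
  assumes "(\<lambda>p. root p (x p)) \<longlonglongrightarrow> L" "0 \<le> c" "c < L" "\<And>p. 0 \<le> x p"
  shows "\<forall>\<^sub>F p in sequentially. c ^ p \<le> x p"
  using order_tendstoD(1)[OF assms(1,3)] eventually_gt_at_top[of 0]
proof eventually_elim
  case (elim p)
  then have "c ^ p \<le> root p (x p) ^ p"
    using assms(2) by (intro power_mono) auto
  then show ?case using elim assms(4) by (simp add: real_root_pow_pos2)
qed

lemma eventually_le_power_of_root_tendsto: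
  assumes "(\<lambda>p. root p (x p)) \<longlonglongrightarrow> L" "L < c" "\<And>p. 0 \<le> x p"
  shows "\<forall>\<^sub>F p in sequentially. x p \<le> c ^ p"
  using order_tendstoD(2)[OF assms(1,2)] eventually_gt_at_top[of 0]
proof eventually_elim
  case (elim p)
  then have "root p (x p) ^ p \<le> c ^ p"
    using assms(3) by (intro power_mono) (auto intro: real_root_ge_zero)
  then show ?case using elim assms(3) by (simp add: real_root_pow_pos2)
qed

lemma limsup_root_le:
  fixes d x :: "nat \<Rightarrow> real"
  assumes d: "\<forall>\<^sub>F p in sequentially. d p \<le> C * x p / s ^ p"
    and x: "(\<lambda>p. root p (x p)) \<longlonglongrightarrow> L" "\<And>p. 0 \<le> x p" and "0 < s"
  shows "limsup (\<lambda>p. ereal (root p (d p))) \<le> ereal (L / s)"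
proof -
  \<comment> \<open>A positive constant is needed for its \<open>p\<close>-th roots to tend to 1,
    hence the maximum with 1.\<close>
  define C' where "C' = max C 1"
  have "(\<lambda>p. root p C' * root p (x p) / s) \<longlonglongrightarrow> 1 * L / s"
    using assms by (intro tendsto_intros LIMSEQ_root_const) (auto simp: C'_def)
  then have lim: "limsup (\<lambda>p. ereal (root p C' * root p (x p) / s)) = ereal (L / s)"
    by (intro lim_imp_Limsup) auto
  have "\<forall>\<^sub>F p in sequentially. ereal (root p (d p)) \<le> ereal (root p C' * root p (x p) / s)"
    using d eventually_gt_at_top[of 0]
  proof eventually_elim
    case (elim p)
    have "C * x p / s ^ p \<le> C' * x p / s ^ p"
      using x(2) \<open>0 < s\<close> by (intro divide_right_mono mult_right_mono) (auto simp: C'_def)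
    with elim have "root p (d p) \<le> root p (C' * x p / s ^ p)"
      by simp
    also have "\<dots> = root p C' * root p (x p) / s"
      using elim \<open>0 < s\<close> by (simp add: real_root_divide real_root_mult real_root_power_cancel)
    finally show ?case by simp
  qed
  from Limsup_mono[OF this] show ?thesis unfolding lim .
qed

text \<open>Convergent zeros stay bounded, so one \<open>B\<close> works for all large
  \<open>p\<close>; this is the a priori bound for the denominator on compact sets.\<close>

lemma bounded_root_product:
  fixes zp :: "nat \<Rightarrow> nat \<Rightarrow> complex"
  assumes "\<And>i. i \<in> I \<Longrightarrow> (\<lambda>p. zp p i) \<longlonglongrightarrow> z i" "finite I" "compact \<Gamma>"
  obtains B where "0 \<le> B" "\<forall>\<^sub>F p in sequentially. \<forall>w\<in>\<Gamma>. cmod (\<Prod>i\<in>I. w - zp p i) \<le> B"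
proof -
  obtain R where R: "\<And>w. w \<in> \<Gamma> \<Longrightarrow> cmod w \<le> R"
    using compact_imp_bounded[OF assms(3)] unfolding bounded_iff by blast
  have "\<forall>\<^sub>F p in sequentially. cmod (zp p i) < cmod (z i) + 1" if "i \<in> I" for i
    using tendsto_norm[OF assms(1)[OF that]] by (rule order_tendstoD) simp
  then have "\<forall>\<^sub>F p in sequentially. \<forall>i\<in>I. cmod (zp p i) < cmod (z i) + 1"
    using assms(2) by (simp add: eventually_ball_finite)
  then have "\<forall>\<^sub>F p in sequentially. \<forall>w\<in>\<Gamma>. cmod (\<Prod>i\<in>I. w - zp p i) \<le> (\<Prod>i\<in>I. \<bar>R\<bar> + cmod (z i) + 1)"
  proof eventually_elim
    case (elim p)
    show ?case
    proof
      fix w assume "w \<in> \<Gamma>"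
      have "cmod (w - zp p i) \<le> \<bar>R\<bar> + cmod (z i) + 1" if "i \<in> I" for i
      proof -
        have "cmod (w - zp p i) \<le> cmod w + cmod (zp p i)" by (rule norm_triangle_ineq4)
        then show ?thesis using R[OF \<open>w \<in> \<Gamma>\<close>] bspec[OF elim that] by linarith
      qed
      then show "cmod (\<Prod>i\<in>I. w - zp p i) \<le> (\<Prod>i\<in>I. \<bar>R\<bar> + cmod (z i) + 1)"
        unfolding prod_norm[symmetric] by (intro prod_mono) simp
    qed
  qed
  moreover have "0 \<le> (\<Prod>i\<in>I. \<bar>R\<bar> + cmod (z i) + 1)"
    by (intro prod_nonneg) simp
  ultimately show ?thesis using that by blast
qed

text \<open>All that the asymptotics use of \<open>E\<close>, \<open>F\<close> and the contour is
  condensed in \<open>growth\<close> and \<open>remainder\<close>, with \<open>u\<close> an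
  unspecified family of linear systems. In \<open>remainder\<close> the coefficients
  \<open>c\<close> and the bound \<open>B\<close> are quantified after \<open>p\<close>: the
  threshold is the same for all coefficient vectors, and the estimate is linear in \<open>B\<close>.
  Kernel vectors, about which nothing is known in advance, require exactly this.\<close>

locale itea_asymptotics =
  fixes k \<mu> :: nat and \<kappa> \<rho> :: real and \<Phi> :: "complex \<Rightarrow> real"
    and xi :: "nat \<Rightarrow> nat \<Rightarrow> complex" and a z :: "nat \<Rightarrow> complex"
    and u :: "nat \<Rightarrow> nat \<Rightarrow> nat \<Rightarrow> complex"
  assumes k: "1 \<le> k" "k \<le> \<mu>" and \<kappa>: "0 < \<kappa>"
    and inj: "inj_on z {1..\<mu>}"
    and \<Phi>_gt_1: "\<And>s. s \<in> {1..\<mu>} \<Longrightarrow> 1 < \<Phi> (z s)"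
    and \<Phi>_mono: "\<And>s t. \<lbrakk>1 \<le> s; s \<le> t; t \<le> \<mu>\<rbrakk> \<Longrightarrow> \<Phi> (z s) \<le> \<Phi> (z t)"
    and \<Phi>_less: "\<And>s. s \<in> {1..\<mu>} \<Longrightarrow> \<Phi> (z s) < \<rho>"
    and gap: "k < \<mu> \<Longrightarrow> \<Phi> (z k) < \<Phi> (z (k + 1))"
    and a_nz: "\<And>m. m \<in> {1..k} \<Longrightarrow> a m \<noteq> 0"
    and growth: "\<And>s. s \<in> {1..\<mu>} \<Longrightarrow> (\<lambda>p. root p (cmod (Psi k xi p (z s)))) \<longlonglongrightarrow> \<kappa> * \<Phi> (z s)"
    and remainder: "\<And>\<sigma>. \<lbrakk>1 < \<sigma>; \<sigma> < \<rho>\<rbrakk> \<Longrightarrow> \<exists>C\<ge>0. \<exists>\<Gamma>. compact \<Gamma> \<and> (\<forall>\<^sub>F p in sequentially. \<forall>c m B.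
      m \<in> {1..k} \<longrightarrow> (\<forall>i\<in>{1..k}. (\<Sum>j\<le>k. c j * u p i j) = 0) \<longrightarrow> 0 \<le> B \<longrightarrow>
      (\<forall>w\<in>\<Gamma>. cmod (\<Sum>j\<le>k. c j * psi (xi p) 1 j w) \<le> B) \<longrightarrow>
      cmod (a m * (\<Sum>j\<le>k. c j * psi (xi p) 1 j (z m)) / Psi k xi p (z m) +
        (\<Sum>s=k+1..\<mu>. a s * (\<Sum>j\<le>k. c j * psi (xi p) 1 j (z s)) *
          poly (lagrange_poly z k m) (z s) / Psi k xi p (z s))) \<le> C * B / (\<kappa> * \<sigma>) ^ p)"
begin

definition "W p c w = (\<Sum>j\<le>k. c j * psi (xi p) 1 j w)"

definition "homogeneous p c \<longleftrightarrow> (\<forall>i\<in>{1..k}. (\<Sum>j\<le>k. c j * u p i j) = 0)"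

abbreviation "L m \<equiv> poly (lagrange_poly z k m)"

text \<open>The radius that governs the rate: the level of the next pole if there is one, otherwise
  \<rho>. It lets \<open>k < \<mu>\<close> and \<open>k = \<mu>\<close> share one proof.\<close>

definition "\<tau> = (if k < \<mu> then \<Phi> (z (k + 1)) else \<rho>)"

lemma inj_k: "inj_on z {1..k}"
  using inj k by (auto intro: inj_on_subset)

lemma \<tau>: "\<Phi> (z k) < \<tau>" "\<tau> \<le> \<rho>" "s \<in> {k+1..\<mu>} \<Longrightarrow> \<tau> \<le> \<Phi> (z s)"
  using gap \<Phi>_less[of k] \<Phi>_less[of "k + 1"] k \<Phi>_mono[of "k + 1" s] by (auto simp: \<tau>_def)

lemma \<Phi>_le_k: "m \<in> {1..k} \<Longrightarrow> \<Phi> (z m) \<le> \<Phi> (z k)"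
  using \<Phi>_mono k by auto

lemma residue_estimate:
  assumes "1 < \<sigma>" "\<sigma> < \<rho>"
  obtains C \<Gamma> where "0 \<le> C" "compact \<Gamma>"
    "\<forall>\<^sub>F p in sequentially. \<forall>c m B. m \<in> {1..k} \<longrightarrow> homogeneous p c \<longrightarrow> 0 \<le> B \<longrightarrow>
       (\<forall>w\<in>\<Gamma>. cmod (W p c w) \<le> B) \<longrightarrow>
       cmod (a m * W p c (z m) / Psi k xi p (z m) +
         (\<Sum>s=k+1..\<mu>. a s * W p c (z s) * L m (z s) / Psi k xi p (z s))) \<le> C * B / (\<kappa> * \<sigma>) ^ p"
  using remainder[OF assms] unfolding W_def[symmetric] homogeneous_def[symmetric] by blast

lemma Psi_lower:
  assumes "s \<in> {1..\<mu>}" "0 < \<sigma>" "\<sigma> < \<Phi> (z s)"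
  shows "\<forall>\<^sub>F p in sequentially. (\<kappa> * \<sigma>) ^ p \<le> cmod (Psi k xi p (z s))"
  using assms \<kappa> by (intro eventually_power_le_of_root_tendsto[OF growth[OF assms(1)]]) auto

lemma Psi_upper:
  assumes "s \<in> {1..\<mu>}" "\<Phi> (z s) < \<sigma>"
  shows "\<forall>\<^sub>F p in sequentially. cmod (Psi k xi p (z s)) \<le> (\<kappa> * \<sigma>) ^ p"
  using assms \<kappa> by (intro eventually_le_power_of_root_tendsto[OF growth[OF assms(1)]]) auto

lemma Psi_nonzero:
  "\<forall>\<^sub>F p in sequentially. \<forall>s\<in>{1..\<mu>}. Psi k xi p (z s) \<noteq> 0"
proof (intro eventually_ball_finite ballI)
  fix s assume s: "s \<in> {1..\<mu>}"
  show "\<forall>\<^sub>F p in sequentially. Psi k xi p (z s) \<noteq> 0"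
    using Psi_lower[of s 1, OF s _ \<Phi>_gt_1[OF s], simplified]
  proof eventually_elim
    case (elim p)
    moreover have "0 < \<kappa> ^ p" using \<kappa> by simp
    ultimately show ?case by auto
  qed
qed simp

text \<open>A pole with \<open>s > k\<close> has
  \<open>\<Phi> (z s) \<ge> \<tau> > \<sigma>\<close>, so up to a constant its term is no larger
  than the bound for the integral and can be moved to the right-hand side.\<close>

lemma value_at_pole_bound:
  assumes \<sigma>: "1 < \<sigma>" "\<sigma> < \<tau>"
  obtains C \<Gamma> where "0 \<le> C" "compact \<Gamma>"
    "\<forall>\<^sub>F p in sequentially. \<forall>c m B. m \<in> {1..k} \<longrightarrow> homogeneous p c \<longrightarrow> 0 \<le> B \<longrightarrow>
       (\<forall>w\<in>\<Gamma>. cmod (W p c w) \<le> B) \<longrightarrow>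
       cmod (W p c (z m)) \<le> C * B * cmod (Psi k xi p (z m)) / (\<kappa> * \<sigma>) ^ p"
proof -
  have "\<sigma> < \<rho>" using \<sigma> \<tau>(2) by linarith
  obtain C0 \<Gamma> where C0: "0 \<le> C0" "compact \<Gamma>" and
    est: "\<forall>\<^sub>F p in sequentially. \<forall>c m B. m \<in> {1..k} \<longrightarrow> homogeneous p c \<longrightarrow> 0 \<le> B \<longrightarrow>
       (\<forall>w\<in>\<Gamma>. cmod (W p c w) \<le> B) \<longrightarrow>
       cmod (a m * W p c (z m) / Psi k xi p (z m) +
         (\<Sum>s=k+1..\<mu>. a s * W p c (z s) * L m (z s) / Psi k xi p (z s))) \<le> C0 * B / (\<kappa> * \<sigma>) ^ p"
    by (rule residue_estimate[OF \<sigma>(1) \<open>\<sigma> < \<rho>\<close>])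
  \<comment> \<open>Sums over \<open>m\<close> in place of maxima give constants valid for every
    \<open>m\<close> at once.\<close>
  define C1 where "C1 = (\<Sum>m=1..k. \<Sum>s=k+1..\<mu>. cmod (a s) * cmod (L m (z s)))"
  define A where "A = (\<Sum>m=1..k. 1 / cmod (a m))"
  have nonneg: "0 \<le> C1" "0 \<le> A" unfolding C1_def A_def by (auto intro!: sum_nonneg)
  have low: "\<forall>\<^sub>F p in sequentially. \<forall>s\<in>{k+1..\<mu>}. (\<kappa> * \<sigma>) ^ p \<le> cmod (Psi k xi p (z s))"
  proof (intro eventually_ball_finite ballI Psi_lower)
    fix s assume "s \<in> {k+1..\<mu>}"
    then show "\<sigma> < \<Phi> (z s)" using \<sigma>(2) \<tau>(3) by fastforce
  qed (use \<sigma> in auto)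
  show ?thesis
  proof (rule that)
    show "0 \<le> A * (C0 + C1)" using nonneg C0 by simp
    \<comment> \<open>The poles beyond the first \<open>k\<close> are adjoined so that
      \<open>B\<close> also bounds the values of \<open>W\<close> there.\<close>
    show "compact (\<Gamma> \<union> z ` {k+1..\<mu>})"
      using C0(2) by (auto intro: compact_Un finite_imp_compact)
    show "\<forall>\<^sub>F p in sequentially. \<forall>c m B. m \<in> {1..k} \<longrightarrow> homogeneous p c \<longrightarrow> 0 \<le> B \<longrightarrow>
       (\<forall>w\<in>\<Gamma> \<union> z ` {k+1..\<mu>}. cmod (W p c w) \<le> B) \<longrightarrow>
       cmod (W p c (z m)) \<le> A * (C0 + C1) * B * cmod (Psi k xi p (z m)) / (\<kappa> * \<sigma>) ^ p"
      using est low Psi_nonzero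
    proof eventually_elim
      case (elim p)
      show ?case
      proof (intro allI impI)
        fix c m B
        assume m: "m \<in> {1..k}" and c: "homogeneous p c" and B: "0 \<le> B"
          and WB: "\<forall>w\<in>\<Gamma> \<union> z ` {k+1..\<mu>}. cmod (W p c w) \<le> B"
        let ?S = "\<Sum>s=k+1..\<mu>. a s * W p c (z s) * L m (z s) / Psi k xi p (z s)"
        let ?X = "a m * W p c (z m) / Psi k xi p (z m)"
        let ?q = "(\<kappa> * \<sigma>) ^ p"
        have q: "0 < ?q" using \<kappa> \<sigma> by simp
        have "cmod (?X + ?S) \<le> C0 * B / ?q"
          using elim(1) m c B WB by blast
        moreover have "cmod ?S \<le> C1 * B / ?q"
        proof -
          have "cmod ?S \<le> (\<Sum>s=k+1..\<mu>. cmod (a s) * cmod (L m (z s)) * B / ?q)"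
          proof (rule sum_norm_le)
            fix s assume s: "s \<in> {k+1..\<mu>}"
            have "cmod (W p c (z s)) \<le> B" using WB s by blast
            then have "cmod (a s) * cmod (L m (z s)) * cmod (W p c (z s)) \<le>
                cmod (a s) * cmod (L m (z s)) * B"
              by (intro mult_left_mono) auto
            then have "cmod (a s) * cmod (L m (z s)) * cmod (W p c (z s)) / cmod (Psi k xi p (z s)) \<le>
                cmod (a s) * cmod (L m (z s)) * B / ?q"
              using elim(2) s q B by (intro frac_le) auto
            then show "cmod (a s * W p c (z s) * L m (z s) / Psi k xi p (z s)) \<le>
                cmod (a s) * cmod (L m (z s)) * B / ?q"
              by (simp add: norm_mult norm_divide mult_ac)
          qed
          also have "\<dots> = (\<Sum>s=k+1..\<mu>. cmod (a s) * cmod (L m (z s))) * B / ?q"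
            by (simp add: sum_distrib_right sum_divide_distrib)
          also have "\<dots> \<le> C1 * B / ?q"
            unfolding C1_def using m q B
            by (intro divide_right_mono mult_right_mono member_le_sum) (auto intro!: sum_nonneg)
          finally show ?thesis .
        qed
        moreover have "cmod ?X \<le> cmod (?X + ?S) + cmod ?S"
          using norm_triangle_ineq4[of "?X + ?S" ?S] by (simp only: add_diff_cancel_right')
        ultimately have "cmod ?X \<le> (C0 + C1) * B / ?q"
          by (simp add: add_divide_distrib distrib_right)
        then have X: "cmod (a m) * cmod (W p c (z m)) / cmod (Psi k xi p (z m)) \<le> (C0 + C1) * B / ?q"
          by (simp add: norm_mult norm_divide)
        have \<Psi>: "0 < cmod (Psi k xi p (z m))" using elim(3) m k by simp
        have am: "0 < cmod (a m)" using a_nz[OF m] by simp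
        have "cmod (W p c (z m)) =
            1 / cmod (a m) * (cmod (a m) * cmod (W p c (z m)) / cmod (Psi k xi p (z m))) * cmod (Psi k xi p (z m))"
          using \<Psi> am by simp
        also have "\<dots> \<le> 1 / cmod (a m) * ((C0 + C1) * B / ?q) * cmod (Psi k xi p (z m))"
          using X am by (intro mult_right_mono mult_left_mono) auto
        also have "\<dots> \<le> A * ((C0 + C1) * B / ?q) * cmod (Psi k xi p (z m))"
          unfolding A_def using m q B C0(1) nonneg(1)
          by (intro mult_right_mono member_le_sum[where f="\<lambda>m. 1 / cmod (a m)"]) auto
        finally show "cmod (W p c (z m)) \<le> A * (C0 + C1) * B * cmod (Psi k xi p (z m)) / ?q"
          by (simp add: mult_ac)
      qed
    qed
  qed
qed

text \<open>A kernel vector gives a polynomial of degree below \<open>k\<close>, which is controlled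
  by the sum \<open>M\<close> of its moduli at the first \<open>k\<close> poles: by interpolation it
  is at most \<open>D * M\<close> on the compact set. Feeding this into
  \<open>value_at_pole_bound\<close> returns
  \<open>M \<le> k * C * D * (\<sigma>1 / \<sigma>) ^ p * M\<close>, and the factor of
  \<open>M\<close> is below 1 for large \<open>p\<close>.\<close>

lemma trivial_kernel:
  "\<forall>\<^sub>F p in sequentially. \<forall>c. c k = 0 \<longrightarrow> homogeneous p c \<longrightarrow> (\<forall>j<k. c j = 0)"
proof -
  obtain \<sigma> where \<sigma>: "\<Phi> (z k) < \<sigma>" "\<sigma> < \<tau>" using dense[OF \<tau>(1)] by blast
  \<comment> \<open>Two radii above \<open>\<Phi> (z k)\<close>: the numerator
    \<open>Psi k xi p (z m)\<close> is at most \<open>(\<kappa> * \<sigma>1) ^ p\<close>, and its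
    quotient by \<open>(\<kappa> * \<sigma>) ^ p\<close> decays geometrically.\<close>
  obtain \<sigma>1 where \<sigma>1: "\<Phi> (z k) < \<sigma>1" "\<sigma>1 < \<sigma>" using dense[OF \<sigma>(1)] by blast
  have pos: "1 < \<sigma>1" "1 < \<sigma>" using \<sigma>1 \<Phi>_gt_1[of k] k by auto
  obtain C \<Gamma> where C: "0 \<le> C" "compact \<Gamma>" and
    bound: "\<forall>\<^sub>F p in sequentially. \<forall>c m B. m \<in> {1..k} \<longrightarrow> homogeneous p c \<longrightarrow> 0 \<le> B \<longrightarrow>
       (\<forall>w\<in>\<Gamma>. cmod (W p c w) \<le> B) \<longrightarrow>
       cmod (W p c (z m)) \<le> C * B * cmod (Psi k xi p (z m)) / (\<kappa> * \<sigma>) ^ p"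
    by (rule value_at_pole_bound[OF pos(2) \<sigma>(2)])
  have "continuous_on \<Gamma> (\<lambda>w. \<Sum>m=1..k. cmod (L m w))"
    by (intro continuous_intros)
  then have "bounded ((\<lambda>w. \<Sum>m=1..k. cmod (L m w)) ` \<Gamma>)"
    using C(2) by (intro compact_imp_bounded compact_continuous_image)
  then obtain D0 where D0: "\<And>w. w \<in> \<Gamma> \<Longrightarrow> norm (\<Sum>m=1..k. cmod (L m w)) \<le> D0"
    unfolding bounded_iff by auto
  define D where "D = \<bar>D0\<bar>"
  have D: "0 \<le> D" "cmod (L m w) \<le> D" if "m \<in> {1..k}" "w \<in> \<Gamma>" for m w
  proof -
    have "cmod (L m w) \<le> (\<Sum>m=1..k. cmod (L m w))"
      using that by (intro member_le_sum) auto
    then show "cmod (L m w) \<le> D" using D0[OF that(2)] by (simp add: D_def)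
  qed (simp add: D_def)
  have "D \<ge> 0" by (simp add: D_def)
  have up: "\<forall>\<^sub>F p in sequentially. \<forall>m\<in>{1..k}. cmod (Psi k xi p (z m)) \<le> (\<kappa> * \<sigma>1) ^ p"
    using \<sigma>1 \<Phi>_le_k k by (intro eventually_ball_finite ballI Psi_upper) fastforce+
  have "(\<lambda>p. real k * (C * D) * (\<sigma>1 / \<sigma>) ^ p) \<longlonglongrightarrow> real k * (C * D) * 0"
    using \<sigma>1 pos by (intro tendsto_intros LIMSEQ_power_zero) auto
  then have small: "\<forall>\<^sub>F p in sequentially. real k * (C * D) * (\<sigma>1 / \<sigma>) ^ p < 1"
    by (intro order_tendstoD(2)) auto
  show ?thesis using bound up small
  proof eventually_elim
    case (elim p)
    show ?case
    proof (intro allI impI)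
      fix c j assume ck: "c k = 0" and hom: "homogeneous p c" and j: "j < k"
      define P where "P = (\<Sum>j<k. Polynomial.smult (c j) (psi_poly (xi p) 1 j))"
      have W: "W p c w = poly P w" for w
        using ck k by (simp add: W_def P_def poly_sum lessThan_Suc_atMost[symmetric])
      have degP: "degree P < k"
        unfolding P_def using k
        by (intro degree_sum_less) (auto intro: le_less_trans[OF degree_smult_le])
      define M where "M = (\<Sum>m=1..k. cmod (W p c (z m)))"
      have M: "0 \<le> M" by (simp add: M_def sum_nonneg)
      have WM: "cmod (W p c w) \<le> D * M" if "w \<in> \<Gamma>" for w
      proof -
        have "W p c w = (\<Sum>m=1..k. W p c (z m) * L m w)"
          unfolding W by (subst lagrange_interpolation[OF inj_k degP]) (simp add: poly_sum)
        also have "cmod \<dots> \<le> (\<Sum>m=1..k. cmod (W p c (z m)) * D)"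
          by (rule sum_norm_le) (auto simp: norm_mult intro!: mult_left_mono D(2) that)
        finally show ?thesis by (simp add: M_def sum_distrib_left mult.commute)
      qed
      have "cmod (W p c (z m)) \<le> C * D * (\<sigma>1 / \<sigma>) ^ p * M" if m: "m \<in> {1..k}" for m
      proof -
        have "cmod (W p c (z m)) \<le> C * (D * M) * cmod (Psi k xi p (z m)) / (\<kappa> * \<sigma>) ^ p"
          using elim(1) m hom WM M \<open>D \<ge> 0\<close> by simp
        also have "\<dots> \<le> C * (D * M) * (\<kappa> * \<sigma>1) ^ p / (\<kappa> * \<sigma>) ^ p"
          using elim(2) m C M \<open>D \<ge> 0\<close> \<kappa> pos
          by (intro divide_right_mono mult_left_mono) auto
        also have "\<dots> = C * D * (\<sigma>1 / \<sigma>) ^ p * M"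
          using \<kappa> by (simp add: power_mult_distrib power_divide)
        finally show ?thesis .
      qed
      then have "M \<le> (\<Sum>m=1..k. C * D * (\<sigma>1 / \<sigma>) ^ p * M)"
        unfolding M_def by (rule sum_mono)
      also have "\<dots> = (real k * (C * D) * (\<sigma>1 / \<sigma>) ^ p) * M"
        by simp
      finally have "M \<le> (real k * (C * D) * (\<sigma>1 / \<sigma>) ^ p) * M" .
      moreover have "(real k * (C * D) * (\<sigma>1 / \<sigma>) ^ p) * M < 1 * M" if "0 < M"
        using elim(3) that by (rule mult_strict_right_mono)
      ultimately have "M = 0"
        using M by (cases "M = 0") (auto simp: less_le)
      then have "W p c (z m) = 0" if "m \<in> {1..k}" for m
        using that unfolding M_def by (subst (asm) sum_nonneg_eq_0_iff) auto
      then have "P = 0"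
        using lagrange_interpolation[OF inj_k degP] by (simp add: W)
      then show "c j = 0"
        unfolding P_def using j by (intro monic_basis_independent[where B="psi_poly (xi p) 1" and d=k])
          (simp_all del: degree_psi_poly add: lead_coeff_psi_poly, simp)
    qed
  qed
qed

end

section \<open>Errors of the zeros: the general rate\<close>

locale itea_zeros = itea_asymptotics +
  fixes c :: "nat \<Rightarrow> nat \<Rightarrow> complex" and zp :: "nat \<Rightarrow> nat \<Rightarrow> complex"
  assumes hom: "\<forall>\<^sub>F p in sequentially. homogeneous p (c p)"
    and factor: "\<forall>\<^sub>F p in sequentially. \<forall>w. W p (c p) w = (\<Prod>m=1..k. w - zp p m)"
    and zeros: "\<And>m. m \<in> {1..k} \<Longrightarrow> (\<lambda>p. zp p m) \<longlonglongrightarrow> z m"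
begin

definition "zero_product p m = (\<Prod>i\<in>{1..k} - {m}. z m - zp p i)"

definition "pole_product m = (\<Prod>i\<in>{1..k} - {m}. z m - z i)"

lemma pole_product_nonzero: "m \<in> {1..k} \<Longrightarrow> pole_product m \<noteq> 0"
  using inj_k by (auto simp: pole_product_def dest: inj_onD)

lemma zero_product_tendsto: "(\<lambda>p. zero_product p m) \<longlonglongrightarrow> pole_product m"
  unfolding zero_product_def pole_product_def by (intro tendsto_intros zeros) auto

lemma W_at_pole:
  assumes "m \<in> {1..k}"
  shows "\<forall>\<^sub>F p in sequentially. W p (c p) (z m) = - ((zp p m - z m) * zero_product p m)"
  using factor
proof eventually_elim
  case (elim p)
  have "(\<Prod>i=1..k. z m - zp p i) = (z m - zp p m) * zero_product p m"
    unfolding zero_product_def using assms by (subst prod.remove[of _ m]) auto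
  then show ?case using elim by (simp add: algebra_simps)
qed

lemma W_bounded:
  assumes "compact \<Gamma>"
  obtains B where "0 \<le> B" "\<forall>\<^sub>F p in sequentially. \<forall>w\<in>\<Gamma>. cmod (W p (c p) w) \<le> B"
proof -
  obtain B where B: "0 \<le> B" "\<forall>\<^sub>F p in sequentially. \<forall>w\<in>\<Gamma>. cmod (\<Prod>i\<in>{1..k}. w - zp p i) \<le> B"
    by (rule bounded_root_product[OF zeros finite_atLeastAtMost assms])
  have "\<forall>\<^sub>F p in sequentially. \<forall>w\<in>\<Gamma>. cmod (W p (c p) w) \<le> B"
    using B(2) factor by eventually_elim simp
  with B(1) show ?thesis by (rule that)
qed

lemma eventually_zero_product_lower:
  assumes "m \<in> {1..k}"
  shows "\<forall>\<^sub>F p in sequentially. cmod (pole_product m) / 2 < cmod (zero_product p m)"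
  using pole_product_nonzero[OF assms]
  by (intro order_tendstoD(1)[OF tendsto_norm[OF zero_product_tendsto]]) simp

text \<open>The value at the pole is the error times \<open>zero_product\<close>, up to sign; the
  factor 2 arises because the modulus of \<open>zero_product\<close> eventually exceeds half of its
  limit.\<close>

lemma error_le_of_W_le:
  assumes m: "m \<in> {1..k}" and "\<forall>\<^sub>F p in sequentially. cmod (W p (c p) (z m)) \<le> b p"
  shows "\<forall>\<^sub>F p in sequentially. cmod (zp p m - z m) \<le> 2 / cmod (pole_product m) * b p"
  using assms(2) W_at_pole[OF m] eventually_zero_product_lower[OF m]
proof eventually_elim
  case (elim p)
  have pos: "0 < cmod (pole_product m)" using pole_product_nonzero[OF m] by simp
  have "cmod (zp p m - z m) * (cmod (pole_product m) / 2) \<le> cmod (zp p m - z m) * cmod (zero_product p m)"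
    using elim(3) by (intro mult_left_mono) auto
  also have "\<dots> \<le> b p"
    using elim(1,2) by (simp add: norm_mult)
  finally show ?case using pos by (simp add: field_simps)
qed

lemma error_estimate:
  assumes m: "m \<in> {1..k}" and \<sigma>: "1 < \<sigma>" "\<sigma> < \<tau>"
  obtains C where
    "\<forall>\<^sub>F p in sequentially. cmod (zp p m - z m) \<le> C * cmod (Psi k xi p (z m)) / (\<kappa> * \<sigma>) ^ p"
proof -
  obtain C \<Gamma> where C: "0 \<le> C" "compact \<Gamma>" and
    bound: "\<forall>\<^sub>F p in sequentially. \<forall>c m B. m \<in> {1..k} \<longrightarrow> homogeneous p c \<longrightarrow> 0 \<le> B \<longrightarrow>
       (\<forall>w\<in>\<Gamma>. cmod (W p c w) \<le> B) \<longrightarrow>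
       cmod (W p c (z m)) \<le> C * B * cmod (Psi k xi p (z m)) / (\<kappa> * \<sigma>) ^ p"
    by (rule value_at_pole_bound[OF \<sigma>])
  obtain B where B: "0 \<le> B" "\<forall>\<^sub>F p in sequentially. \<forall>w\<in>\<Gamma>. cmod (W p (c p) w) \<le> B"
    by (rule W_bounded[OF C(2)])
  have "\<forall>\<^sub>F p in sequentially. cmod (W p (c p) (z m)) \<le> C * B * cmod (Psi k xi p (z m)) / (\<kappa> * \<sigma>) ^ p"
    using bound B(2) hom by eventually_elim (use m B(1) in blast)
  from error_le_of_W_le[OF m this] show ?thesis
    by (intro that[of "2 / cmod (pole_product m) * (C * B)"]) (simp add: mult_ac)
qed

text \<open>Obtained from \<open>error_estimate\<close> for every \<sigma> between
  \<open>\<Phi> (z k)\<close> and \<tau> and then by letting \<sigma> tend to \<tau> from below, so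
  no estimate at the critical level itself is involved.\<close>

theorem limsup_error:
  assumes m: "m \<in> {1..k}"
  shows "limsup (\<lambda>p. ereal (root p (cmod (zp p m - z m)))) \<le> ereal (\<Phi> (z m) / \<tau>)"
proof (rule tendsto_lowerbound)
  have m': "m \<in> {1..\<mu>}" "k \<in> {1..\<mu>}" using m k by auto
  have k1: "1 < \<Phi> (z k)" using \<Phi>_gt_1[OF m'(2)] .
  then have "\<tau> \<noteq> 0" using \<tau>(1) by linarith
  then show "((\<lambda>\<sigma>. ereal (\<Phi> (z m) / \<sigma>)) \<longlongrightarrow> ereal (\<Phi> (z m) / \<tau>)) (at_left \<tau>)"
    by (intro tendsto_intros)
  have "limsup (\<lambda>p. ereal (root p (cmod (zp p m - z m)))) \<le> ereal (\<Phi> (z m) / \<sigma>)"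
    if \<sigma>: "\<Phi> (z k) < \<sigma>" "\<sigma> < \<tau>" for \<sigma>
  proof -
    have \<sigma>1: "1 < \<sigma>" using \<sigma>(1) k1 by linarith
    obtain C where C: "\<forall>\<^sub>F p in sequentially. cmod (zp p m - z m) \<le> C * cmod (Psi k xi p (z m)) / (\<kappa> * \<sigma>) ^ p"
      by (rule error_estimate[OF m \<sigma>1 \<sigma>(2)])
    have "limsup (\<lambda>p. ereal (root p (cmod (zp p m - z m)))) \<le> ereal (\<kappa> * \<Phi> (z m) / (\<kappa> * \<sigma>))"
      using \<kappa> \<sigma>1 by (intro limsup_root_le[OF C growth[OF m'(1)]]) auto
    then show ?thesis using \<kappa> by simp
  qed
  then show "\<forall>\<^sub>F \<sigma> in at_left \<tau>. limsup (\<lambda>p. ereal (root p (cmod (zp p m - z m)))) \<le> ereal (\<Phi> (z m) / \<sigma>)"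
    using \<tau>(1) unfolding eventually_at_left_field by blast
qed simp

end

section \<open>Refined estimates relative to the next level of poles\<close>

locale itea_zeros_gap = itea_zeros +
  fixes r :: nat
  assumes r: "1 \<le> r" "k + r \<le> \<mu>"
    and \<Phi>_eq: "\<And>j. j \<in> {1..r} \<Longrightarrow> \<Phi> (z (k + j)) = \<Phi> (z (k + 1))"
    and outer_gap: "\<Phi> (z (k + r)) < (if k + r < \<mu> then \<Phi> (z (k + r + 1)) else \<rho>)"
begin

text \<open>\<open>\<sigma>\<close> separates the level of the poles
  \<open>k + 1, ..., k + r\<close> from the later poles and from \<rho>. The second radius
  \<open>\<sigma>1\<close> leaves room for the decay factor
  \<open>(\<sigma>1 / \<sigma>) ^ p\<close>.\<close>

lemma outer_radius:
  obtains \<sigma>1 \<sigma> where "\<Phi> (z (k + 1)) < \<sigma>1" "\<sigma>1 < \<sigma>" "1 < \<sigma>1" "\<sigma> < \<rho>"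
    "\<forall>s\<in>{k+r+1..\<mu>}. \<sigma> < \<Phi> (z s)"
proof -
  define b where "b = (if k + r < \<mu> then \<Phi> (z (k + r + 1)) else \<rho>)"
  have "\<Phi> (z (k + 1)) < b"
    using outer_gap \<Phi>_eq[of r] r(1) by (simp add: b_def)
  then obtain \<sigma> where \<sigma>: "\<Phi> (z (k + 1)) < \<sigma>" "\<sigma> < b" using dense by blast
  obtain \<sigma>1 where \<sigma>1: "\<Phi> (z (k + 1)) < \<sigma>1" "\<sigma>1 < \<sigma>" using dense[OF \<sigma>(1)] by blast
  have "1 < \<sigma>1" using \<sigma>1(1) \<Phi>_gt_1[of "k + 1"] r by force
  moreover have "b \<le> \<rho>" using \<Phi>_less[of "k + r + 1"] by (auto simp: b_def)
  then have "\<sigma> < \<rho>" using \<sigma>(2) by linarith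
  moreover have "\<forall>s\<in>{k+r+1..\<mu>}. \<sigma> < \<Phi> (z s)"
  proof
    fix s assume "s \<in> {k+r+1..\<mu>}"
    then show "\<sigma> < \<Phi> (z s)"
      using \<sigma>(2) \<Phi>_mono[of "k + r + 1" s] by (auto simp: b_def split: if_splits)
  qed
  ultimately show ?thesis using \<sigma>1 by (intro that)
qed

lemma residue_estimate_zeros:
  assumes m: "m \<in> {1..k}" and \<sigma>: "1 < \<sigma>" "\<sigma> < \<rho>"
  obtains C where "0 \<le> C"
    "\<forall>\<^sub>F p in sequentially. cmod (a m * W p (c p) (z m) / Psi k xi p (z m) +
         (\<Sum>s=k+1..\<mu>. a s * W p (c p) (z s) * L m (z s) / Psi k xi p (z s))) \<le> C / (\<kappa> * \<sigma>) ^ p"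
proof -
  obtain C \<Gamma> where C: "0 \<le> C" "compact \<Gamma>" and
    bound: "\<forall>\<^sub>F p in sequentially. \<forall>c m B. m \<in> {1..k} \<longrightarrow> homogeneous p c \<longrightarrow> 0 \<le> B \<longrightarrow>
       (\<forall>w\<in>\<Gamma>. cmod (W p c w) \<le> B) \<longrightarrow>
       cmod (a m * W p c (z m) / Psi k xi p (z m) +
         (\<Sum>s=k+1..\<mu>. a s * W p c (z s) * L m (z s) / Psi k xi p (z s))) \<le> C * B / (\<kappa> * \<sigma>) ^ p"
    by (rule residue_estimate[OF \<sigma>])
  obtain B where B: "0 \<le> B" "\<forall>\<^sub>F p in sequentially. \<forall>w\<in>\<Gamma>. cmod (W p (c p) w) \<le> B"
    by (rule W_bounded[OF C(2)])
  have "\<forall>\<^sub>F p in sequentially. cmod (a m * W p (c p) (z m) / Psi k xi p (z m) +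
         (\<Sum>s=k+1..\<mu>. a s * W p (c p) (z s) * L m (z s) / Psi k xi p (z s))) \<le> C * B / (\<kappa> * \<sigma>) ^ p"
    using bound B(2) hom by eventually_elim (use m B(1) in blast)
  with C(1) B(1) show ?thesis by (intro that[of "C * B"]) simp_all
qed

text \<open>On the critical level all \<open>Psi k xi p (z (k + j))\<close> have the same limit of
  \<open>p\<close>-th roots, but their ratios are not controlled, so the minimum, whose index may
  change with \<open>p\<close>, is the natural scale. It bounds the critical terms by definition;
  the outer terms and the remainder are of order \<open>1 / (\<kappa> * \<sigma>) ^ p\<close>, and
  the minimum is at most \<open>(\<kappa> * \<sigma>) ^ p\<close>.\<close>

lemma error_le_min:
  assumes m: "m \<in> {1..k}"
  obtains C where "\<forall>\<^sub>F p in sequentially. cmod (zp p m - z m) \<le>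
    C * (cmod (Psi k xi p (z m)) / Min ((\<lambda>j. cmod (Psi k xi p (z (k + j)))) ` {1..r}))"
proof -
  define \<nu> where "\<nu> p = Min ((\<lambda>j. cmod (Psi k xi p (z (k + j)))) ` {1..r})" for p
  obtain \<sigma>1 \<sigma> where \<sigma>1: "\<Phi> (z (k + 1)) < \<sigma>1" "\<sigma>1 < \<sigma>" "1 < \<sigma>1" and \<sigma>: "\<sigma> < \<rho>"
    and outer: "\<forall>s\<in>{k+r+1..\<mu>}. \<sigma> < \<Phi> (z s)"
    by (rule outer_radius)
  have \<sigma>_gt: "1 < \<sigma>" using \<sigma>1 by linarith
  obtain C where C: "0 \<le> C" and est: "\<forall>\<^sub>F p in sequentially. cmod (a m * W p (c p) (z m) / Psi k xi p (z m) +
         (\<Sum>s=k+1..\<mu>. a s * W p (c p) (z s) * L m (z s) / Psi k xi p (z s))) \<le> C / (\<kappa> * \<sigma>) ^ p"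
    by (rule residue_estimate_zeros[OF m \<sigma>_gt \<sigma>])
  have "compact (z ` {k+1..\<mu>})" by (intro finite_imp_compact) auto
  then obtain B where B: "0 \<le> B" "\<forall>\<^sub>F p in sequentially. \<forall>w\<in>z ` {k+1..\<mu>}. cmod (W p (c p) w) \<le> B"
    by (rule W_bounded)
  have low: "\<forall>\<^sub>F p in sequentially. \<forall>s\<in>{k+r+1..\<mu>}. (\<kappa> * \<sigma>) ^ p \<le> cmod (Psi k xi p (z s))"
    using outer \<sigma>_gt by (intro eventually_ball_finite ballI Psi_lower) auto
  have up: "\<forall>\<^sub>F p in sequentially. cmod (Psi k xi p (z (k + 1))) \<le> (\<kappa> * \<sigma>) ^ p"
    using \<sigma>1 r by (intro Psi_upper) auto
  define C1 where "C1 = (\<Sum>s=k+1..\<mu>. cmod (a s) * cmod (L m (z s)) * B)"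
  have "\<forall>\<^sub>F p in sequentially. cmod (W p (c p) (z m)) \<le>
      (C + C1) / cmod (a m) * (cmod (Psi k xi p (z m)) / \<nu> p)"
    using est B(2) low up Psi_nonzero
  proof eventually_elim
    case (elim p)
    let ?S = "\<Sum>s=k+1..\<mu>. a s * W p (c p) (z s) * L m (z s) / Psi k xi p (z s)"
    let ?X = "a m * W p (c p) (z m) / Psi k xi p (z m)"
    have "\<nu> p \<in> (\<lambda>j. cmod (Psi k xi p (z (k + j)))) ` {1..r}"
      unfolding \<nu>_def using r(1) by (intro Min_in) auto
    then have \<nu>: "0 < \<nu> p" using elim(5) r(2) by auto
    have \<nu>_le: "\<nu> p \<le> cmod (Psi k xi p (z (k + j)))" if "j \<in> {1..r}" for j
      unfolding \<nu>_def using that by (intro Min_le) auto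
    have \<nu>_q: "\<nu> p \<le> (\<kappa> * \<sigma>) ^ p"
      using \<nu>_le[of 1] r(1) elim(4) by simp
    have \<nu>_s: "\<nu> p \<le> cmod (Psi k xi p (z s))" if "s \<in> {k+1..\<mu>}" for s
    proof (cases "s \<le> k + r")
      case True
      then have "s - k \<in> {1..r}" "k + (s - k) = s" using that by auto
      then show ?thesis using \<nu>_le[of "s - k"] by simp
    next
      case False
      then have "(\<kappa> * \<sigma>) ^ p \<le> cmod (Psi k xi p (z s))" using elim(3) that by auto
      then show ?thesis using \<nu>_q by linarith
    qed
    have "cmod ?S \<le> (\<Sum>s=k+1..\<mu>. cmod (a s) * cmod (L m (z s)) * B / \<nu> p)"
    proof (rule sum_norm_le)
      fix s assume s: "s \<in> {k+1..\<mu>}"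
      have "cmod (a s) * cmod (L m (z s)) * cmod (W p (c p) (z s)) \<le> cmod (a s) * cmod (L m (z s)) * B"
        using elim(2) s by (intro mult_left_mono) auto
      then have "cmod (a s) * cmod (L m (z s)) * cmod (W p (c p) (z s)) / cmod (Psi k xi p (z s)) \<le>
          cmod (a s) * cmod (L m (z s)) * B / \<nu> p"
        using \<nu>_s[OF s] \<nu> B(1) by (intro frac_le) auto
      then show "cmod (a s * W p (c p) (z s) * L m (z s) / Psi k xi p (z s)) \<le>
          cmod (a s) * cmod (L m (z s)) * B / \<nu> p"
        by (simp add: norm_mult norm_divide mult_ac)
    qed
    also have "\<dots> = C1 / \<nu> p" by (simp add: C1_def sum_divide_distrib)
    finally have S: "cmod ?S \<le> C1 / \<nu> p" .
    have "C / (\<kappa> * \<sigma>) ^ p \<le> C / \<nu> p"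
      using C \<nu> \<nu>_q by (intro divide_left_mono) auto
    moreover have "cmod ?X \<le> cmod (?X + ?S) + cmod ?S"
      using norm_triangle_ineq4[of "?X + ?S" ?S] by (simp only: add_diff_cancel_right')
    ultimately have "cmod ?X \<le> (C + C1) / \<nu> p"
      using elim(1) S by (simp add: add_divide_distrib)
    then have X: "cmod (a m) * cmod (W p (c p) (z m)) / cmod (Psi k xi p (z m)) \<le> (C + C1) / \<nu> p"
      by (simp add: norm_mult norm_divide)
    have \<Psi>: "0 < cmod (Psi k xi p (z m))" using elim(5) m k by simp
    have am: "0 < cmod (a m)" using a_nz[OF m] by simp
    have "cmod (W p (c p) (z m)) = 1 / cmod (a m) *
        (cmod (a m) * cmod (W p (c p) (z m)) / cmod (Psi k xi p (z m))) * cmod (Psi k xi p (z m))"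
      using \<Psi> am by simp
    also have "\<dots> \<le> 1 / cmod (a m) * ((C + C1) / \<nu> p) * cmod (Psi k xi p (z m))"
      using X am by (intro mult_right_mono mult_left_mono) auto
    finally show ?case by (simp add: mult_ac)
  qed
  from error_le_of_W_le[OF m this] show ?thesis
    unfolding \<nu>_def
    by (intro that[of "2 / cmod (pole_product m) * ((C + C1) / cmod (a m))"]) (simp only: mult.assoc)
qed

text \<open>After multiplication of the residue identity by \<open>Psi k xi p (z (k + 1))\<close>
  the remainder and the terms with \<open>s \<ge> k + 2\<close> are bounded by multiples of
  \<open>(\<sigma>1 / \<sigma>) ^ p\<close>, and only the term of \<open>z (k + 1)\<close> survives.
  The result is a limit and not an asymptotic equivalence because \<open>a (k + 1)\<close> may
  vanish here.\<close>

lemma error_ratio_tendsto: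
  assumes m: "m \<in> {1..k}" and r1: "r = 1"
  shows "(\<lambda>p. (zp p m - z m) * Psi k xi p (z (k + 1)) / Psi k xi p (z m)) \<longlonglongrightarrow>
    a (k + 1) * (\<Prod>i=1..k. z (k + 1) - z i) * L m (z (k + 1)) / (a m * pole_product m)"
proof -
  let ?\<Psi> = "\<lambda>p s. Psi k xi p (z s)"
  let ?V = "\<lambda>p s. W p (c p) (z s)"
  obtain \<sigma>1 \<sigma> where \<sigma>1: "\<Phi> (z (k + 1)) < \<sigma>1" "\<sigma>1 < \<sigma>" "1 < \<sigma>1" and \<sigma>: "\<sigma> < \<rho>"
    and outer: "\<forall>s\<in>{k+r+1..\<mu>}. \<sigma> < \<Phi> (z s)"
    by (rule outer_radius)
  have \<sigma>_gt: "1 < \<sigma>" using \<sigma>1 by linarith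
  have k1: "k + 1 \<in> {1..\<mu>}" using r by auto
  have up: "\<forall>\<^sub>F p in sequentially. cmod (?\<Psi> p (k + 1)) \<le> (\<kappa> * \<sigma>1) ^ p"
    using \<sigma>1 by (intro Psi_upper k1) auto
  have geometric: "(\<lambda>p. C * (\<sigma>1 / \<sigma>) ^ p) \<longlonglongrightarrow> 0" for C
    using \<sigma>1 \<sigma>_gt by (auto intro!: tendsto_mult_right_zero LIMSEQ_power_zero)
  have small: "(\<lambda>p. \<phi> p * ?\<Psi> p (k + 1)) \<longlonglongrightarrow> 0"
    if C: "0 \<le> C" and \<phi>: "\<forall>\<^sub>F p in sequentially. cmod (\<phi> p) \<le> C / (\<kappa> * \<sigma>) ^ p" for \<phi> C
  proof (rule Lim_null_comparison[OF _ geometric[of C]])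
    show "\<forall>\<^sub>F p in sequentially. norm (\<phi> p * ?\<Psi> p (k + 1)) \<le> C * (\<sigma>1 / \<sigma>) ^ p"
      using \<phi> up
    proof eventually_elim
      case (elim p)
      have "norm (\<phi> p * ?\<Psi> p (k + 1)) \<le> C / (\<kappa> * \<sigma>) ^ p * (\<kappa> * \<sigma>1) ^ p"
        unfolding norm_mult using elim C \<kappa> \<sigma>_gt by (intro mult_mono) auto
      also have "\<dots> = C * (\<sigma>1 / \<sigma>) ^ p"
        using \<kappa> by (simp add: power_mult_distrib power_divide)
      finally show ?case .
    qed
  qed
  obtain C where C: "0 \<le> C" and est: "\<forall>\<^sub>F p in sequentially. cmod (a m * ?V p m / ?\<Psi> p m +
         (\<Sum>s=k+1..\<mu>. a s * ?V p s * L m (z s) / ?\<Psi> p s)) \<le> C / (\<kappa> * \<sigma>) ^ p"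
    by (rule residue_estimate_zeros[OF m \<sigma>_gt \<sigma>])
  have "compact (z ` {k+1..\<mu>})" by (intro finite_imp_compact) auto
  then obtain B where B: "0 \<le> B" "\<forall>\<^sub>F p in sequentially. \<forall>w\<in>z ` {k+1..\<mu>}. cmod (W p (c p) w) \<le> B"
    by (rule W_bounded)
  have tail: "(\<lambda>p. a s * ?V p s * L m (z s) / ?\<Psi> p s * ?\<Psi> p (k + 1)) \<longlonglongrightarrow> 0"
    if s: "s \<in> {k+2..\<mu>}" for s
  proof (rule small)
    show "0 \<le> cmod (a s) * cmod (L m (z s)) * B" using B(1) by simp
    have "\<forall>\<^sub>F p in sequentially. (\<kappa> * \<sigma>) ^ p \<le> cmod (?\<Psi> p s)"
      using outer \<sigma>_gt s r1 by (intro Psi_lower) auto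
    then show "\<forall>\<^sub>F p in sequentially. cmod (a s * ?V p s * L m (z s) / ?\<Psi> p s) \<le>
        cmod (a s) * cmod (L m (z s)) * B / (\<kappa> * \<sigma>) ^ p"
      using B(2)
    proof eventually_elim
      case (elim p)
      have "cmod (a s) * cmod (L m (z s)) * cmod (?V p s) \<le> cmod (a s) * cmod (L m (z s)) * B"
        using elim(2) s by (intro mult_left_mono) auto
      then have "cmod (a s) * cmod (L m (z s)) * cmod (?V p s) / cmod (?\<Psi> p s) \<le>
          cmod (a s) * cmod (L m (z s)) * B / (\<kappa> * \<sigma>) ^ p"
        using elim(1) B(1) \<kappa> \<sigma>_gt by (intro frac_le) auto
      then show ?case by (simp add: norm_mult norm_divide mult_ac)
    qed
  qed
  have V: "(\<lambda>p. ?V p (k + 1)) \<longlonglongrightarrow> (\<Prod>i=1..k. z (k + 1) - z i)"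
  proof (rule Lim_transform_eventually)
    show "(\<lambda>p. \<Prod>i=1..k. z (k + 1) - zp p i) \<longlonglongrightarrow> (\<Prod>i=1..k. z (k + 1) - z i)"
      by (intro tendsto_intros zeros)
    show "\<forall>\<^sub>F p in sequentially. (\<Prod>i=1..k. z (k + 1) - zp p i) = ?V p (k + 1)"
      using factor by eventually_elim simp
  qed
  let ?rem = "\<lambda>p. a m * ?V p m / ?\<Psi> p m + (\<Sum>s=k+1..\<mu>. a s * ?V p s * L m (z s) / ?\<Psi> p s)"
  \<comment> \<open>The remainder solved for the error: by \<open>W_at_pole\<close> the value at
    \<open>z m\<close> is minus the error times \<open>zero_product p m\<close>, whence the leading
    sign and the denominator.\<close>
  have "(\<lambda>p. - ((?rem p * ?\<Psi> p (k + 1) - a (k + 1) * ?V p (k + 1) * L m (z (k + 1)) -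
      (\<Sum>s=k+2..\<mu>. a s * ?V p s * L m (z s) / ?\<Psi> p s * ?\<Psi> p (k + 1))) / (a m * zero_product p m)))
    \<longlonglongrightarrow> - ((0 - a (k + 1) * (\<Prod>i=1..k. z (k + 1) - z i) * L m (z (k + 1)) - (\<Sum>s=k+2..\<mu>. 0)) /
      (a m * pole_product m))"
    using a_nz[OF m] pole_product_nonzero[OF m]
    by (intro tendsto_intros small[OF C est] tail V zero_product_tendsto) auto
  moreover have "\<forall>\<^sub>F p in sequentially. - ((?rem p * ?\<Psi> p (k + 1) - a (k + 1) * ?V p (k + 1) * L m (z (k + 1)) -
      (\<Sum>s=k+2..\<mu>. a s * ?V p s * L m (z s) / ?\<Psi> p s * ?\<Psi> p (k + 1))) / (a m * zero_product p m)) =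
      (zp p m - z m) * ?\<Psi> p (k + 1) / ?\<Psi> p m"
    using W_at_pole[OF m] eventually_zero_product_lower[OF m] Psi_nonzero
  proof eventually_elim
    case (elim p)
    have cf: "zero_product p m \<noteq> 0" using elim(2) by auto
    have nz: "?\<Psi> p (k + 1) \<noteq> 0" "?\<Psi> p m \<noteq> 0" using elim(3) k1 m k by auto
    have "(\<Sum>s=k+1..\<mu>. a s * ?V p s * L m (z s) / ?\<Psi> p s) =
        a (k + 1) * ?V p (k + 1) * L m (z (k + 1)) / ?\<Psi> p (k + 1) +
        (\<Sum>s=k+2..\<mu>. a s * ?V p s * L m (z s) / ?\<Psi> p s)"
      using k1 by (subst sum.atLeast_Suc_atMost) auto
    then have "?rem p * ?\<Psi> p (k + 1) - a (k + 1) * ?V p (k + 1) * L m (z (k + 1)) -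
        (\<Sum>s=k+2..\<mu>. a s * ?V p s * L m (z s) / ?\<Psi> p s * ?\<Psi> p (k + 1)) =
        a m * ?V p m / ?\<Psi> p m * ?\<Psi> p (k + 1)"
      using nz(1) by (simp add: distrib_right sum_distrib_right)
    also have "\<dots> = - (a m * zero_product p m) * ((zp p m - z m) * ?\<Psi> p (k + 1) / ?\<Psi> p m)"
      by (simp add: elim(1))
    finally show ?case using cf a_nz[OF m] by simp
  qed
  ultimately show ?thesis
    by (simp add: tendsto_cong)
qed

end

subsection \<open>Determinants and solvability\<close>

text \<open>Row \<open>i\<close> is repeated on top of the \<open>k\<close> rows with all
  \<open>k + 1\<close> labels, so the determinant vanishes; deleting the top row and one column
  leaves the \<open>T_det\<close> that omits this label.\<close>

lemma T_det_Laplace_identity: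
  assumes "i \<in> {1..k}"
  shows "(\<Sum>j\<le>k. (-1) ^ j * alpha ip q v z x p k i (Suc j) * T_det ip q v z x p k (omit (Suc j))) = 0"
proof -
  define A where "A = Matrix.mat (Suc k) (Suc k)
    (\<lambda>(i', j). alpha ip q v z x p k (if i' = 0 then i else i') (Suc j))"
  have A: "A \<in> carrier_mat (Suc k) (Suc k)" by (simp add: A_def)
  have "row A 0 = row A i"
    using assms by (intro eq_vecI) (auto simp: A_def)
  then have "Determinant.det A = 0"
    using assms by (intro det_identical_rows[OF A, of 0 i]) auto
  moreover have "Determinant.det A = (\<Sum>j<Suc k. A $$ (0, j) * cofactor A 0 j)"
    by (rule laplace_expansion_row[OF A]) simp
  moreover have "A $$ (0, j) * cofactor A 0 j =
      (-1) ^ j * alpha ip q v z x p k i (Suc j) * T_det ip q v z x p k (omit (Suc j))" if "j < Suc k" for j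
  proof -
    have "mat_delete A 0 j =
        Matrix.mat k k (\<lambda>(i, j'). alpha ip q v z x p k (Suc i) (omit (Suc j) (Suc j')))"
      using that by (intro eq_matI) (auto simp: mat_delete_def A_def omit_def)
    then show ?thesis
      using that by (simp add: Determinant.cofactor_def T_det_def A_def)
  qed
  ultimately show ?thesis
    by (simp add: lessThan_Suc_atMost)
qed

lemma T_det_omit_last: "T_det ip q v z x p k (omit (Suc k)) = T_det ip q v z x p k (\<lambda>j. j)"
proof -
  have "Matrix.mat k k (\<lambda>(i, j). alpha ip q v z x p k (Suc i) (omit (Suc k) (Suc j))) =
      Matrix.mat k k (\<lambda>(i, j). alpha ip q v z x p k (Suc i) (Suc j))"
    by (intro eq_matI) (auto simp: omit_def)
  then show ?thesis by (simp add: T_det_def)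
qed

text \<open>Expanding along a repeated row gives a linear relation between the values at the nodes of every
  polynomial of degree less than \<open>k\<close>; the Lagrange polynomial isolates two of its terms.\<close>

lemma T_det_omit:
  assumes m: "m \<in> {1..k}" and inj: "inj_on z {1..k}"
  shows "ip q (v m) * T_det ip q v z x p k (omit m) =
    (-1) ^ (k - m) * ip q (v (k + 1)) * poly (lagrange_poly z k m) (z (k + 1)) * T_det ip q v z x p k (\<lambda>j. j)"
proof -
  let ?L = "poly (lagrange_poly z k m)"
  let ?T = "\<lambda>j. T_det ip q v z x p k (omit (Suc j))"
  obtain m' where m': "m = Suc m'" "m' < k" using m by (cases m) auto
  have "1 \<le> k" using m by simp
  obtain b where b: "\<And>w. ?L w = (\<Sum>i=1..k. b i * psi x (p + i + 1) (p + k) w)"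
    by (rule backward_newton_expansion[OF degree_lagrange_poly[OF m] \<open>1 \<le> k\<close>]) blast
  have "0 = (\<Sum>i=1..k. b i * (\<Sum>j\<le>k. (-1) ^ j * alpha ip q v z x p k i (Suc j) * ?T j))"
    using T_det_Laplace_identity[of _ k ip q v z x p] by simp
  also have "\<dots> = (\<Sum>i=1..k. \<Sum>j\<le>k. (-1) ^ j * ip q (v (Suc j)) *
      (b i * psi x (p + i + 1) (p + k) (z (Suc j))) * ?T j)"
    by (simp add: alpha_def sum_distrib_left mult_ac)
  also have "\<dots> = (\<Sum>j\<le>k. \<Sum>i=1..k. (-1) ^ j * ip q (v (Suc j)) *
      (b i * psi x (p + i + 1) (p + k) (z (Suc j))) * ?T j)"
    by (rule sum.swap)
  also have "\<dots> = (\<Sum>j\<le>k. (-1) ^ j * ip q (v (Suc j)) * ?L (z (Suc j)) * ?T j)"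
    by (simp add: b sum_distrib_left sum_distrib_right)
  also have "\<dots> = (\<Sum>j<k. (-1) ^ j * ip q (v (Suc j)) * ?L (z (Suc j)) * ?T j) +
      (-1) ^ k * ip q (v (Suc k)) * ?L (z (Suc k)) * ?T k"
    by (simp add: lessThan_Suc_atMost[symmetric])
  also have "(\<Sum>j<k. (-1) ^ j * ip q (v (Suc j)) * ?L (z (Suc j)) * ?T j) =
      (\<Sum>j<k. if j = m' then (-1) ^ m' * ip q (v m) * T_det ip q v z x p k (omit m) else 0)"
    using m' m by (intro sum.cong refl) (simp add: lagrange_poly_node[OF inj])
  also have "\<dots> = (-1) ^ m' * ip q (v m) * T_det ip q v z x p k (omit m)"
    using m' by simp
  finally have eq: "(-1) ^ m' * (ip q (v m) * T_det ip q v z x p k (omit m)) =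
      - ((-1) ^ k * (ip q (v (k + 1)) * ?L (z (k + 1)) * T_det ip q v z x p k (\<lambda>j. j)))"
    by (simp add: T_det_omit_last eq_neg_iff_add_eq_0 mult.assoc)
  have "ip q (v m) * T_det ip q v z x p k (omit m) =
      (-1) ^ m' * ((-1) ^ m' * (ip q (v m) * T_det ip q v z x p k (omit m)))"
    by (simp add: mult.assoc[symmetric] power_mult_distrib[symmetric])
  also have "\<dots> = - ((-1) ^ m' * (-1) ^ k) * (ip q (v (k + 1)) * ?L (z (k + 1)) * T_det ip q v z x p k (\<lambda>j. j))"
    unfolding eq by simp
  \<comment> \<open>With \<open>m = Suc m'\<close> the exponents add up to \<open>k + m - 1\<close>;
    the outer minus sign restores the parity of \<open>k - m\<close>.\<close>
  also have "- ((-1) ^ m' * (-1) ^ k) = ((-1) ^ (k - m) :: complex)"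
  proof -
    have "k = m' + Suc (k - m)" using m' by simp
    then have "(-1 :: complex) ^ k = (-1) ^ m' * (-1) ^ Suc (k - m)"
      by (metis power_add)
    then show ?thesis
      by (simp add: mult.assoc[symmetric] power_mult_distrib[symmetric])
  qed
  finally show ?thesis by (simp add: mult.assoc)
qed

text \<open>By \<open>T_det_omit\<close> the quotient of determinants is a quotient of residues
  times a Lagrange value, with a sign that cancels the one in \<open>C_const\<close>. The right-hand
  side is the limit found in \<open>error_ratio_tendsto\<close> and involves neither
  \<open>x\<close> nor \<open>p\<close>. The same relation shows that a nonzero \<open>T_det\<close>
  with label \<open>m\<close> omitted forces both \<open>ip q (v (k + 1))\<close> and the
  determinant of the labels \<open>1, ..., k\<close> to be nonzero.\<close>

lemma C_const_eq:
  assumes m: "m \<in> {1..k}" and inj: "inj_on z {1..k}" and "ip q (v m) \<noteq> 0"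
    and T: "T_det ip q v z x p k (omit m) \<noteq> 0"
  shows "C_const ip q v z x p k m = ip q (v (k + 1)) * (\<Prod>i=1..k. z (k + 1) - z i) *
      poly (lagrange_poly z k m) (z (k + 1)) / (ip q (v m) * (\<Prod>i\<in>{1..k} - {m}. z m - z i))"
    and "ip q (v (k + 1)) \<noteq> 0"
proof -
  let ?L = "poly (lagrange_poly z k m) (z (k + 1))"
  let ?T = "T_det ip q v z x p k"
  note om = T_det_omit[OF m inj, of ip q v x p]
  have nz: "?T (\<lambda>j. j) \<noteq> 0" "ip q (v (k + 1)) \<noteq> 0"
    using om assms(3) T by auto
  then show "ip q (v (k + 1)) \<noteq> 0" by simp
  have ratio: "?T (omit m) / ?T (\<lambda>j. j) = (-1) ^ (k - m) * ip q (v (k + 1)) * ?L / ip q (v m)"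
    using om assms(3) nz(1) by (simp add: field_simps)
  have sign: "(-1) ^ (k - m) * ((-1) ^ (k - m) * y) = y" for y :: complex
    by (simp add: mult.assoc[symmetric] power_mult_distrib[symmetric])
  have "C_const ip q v z x p k m =
      (-1) ^ (k - m) * ((-1) ^ (k - m) * (ip q (v (k + 1)) * ?L / ip q (v m) *
        ((z (k + 1) - z m) * (\<Prod>i\<in>{1..k} - {m}. (z (k + 1) - z i) / (z m - z i)))))"
    unfolding C_const_def ratio by (simp add: mult_ac)
  also have "\<dots> = ip q (v (k + 1)) * ?L / ip q (v m) *
        ((z (k + 1) - z m) * (\<Prod>i\<in>{1..k} - {m}. (z (k + 1) - z i) / (z m - z i)))"
    by (rule sign)
  also have "(z (k + 1) - z m) * (\<Prod>i\<in>{1..k} - {m}. (z (k + 1) - z i) / (z m - z i)) =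
      (\<Prod>i=1..k. z (k + 1) - z i) / (\<Prod>i\<in>{1..k} - {m}. z m - z i)"
    unfolding prod.remove[OF finite_atLeastAtMost m] by (simp add: prod_dividef)
  finally show "C_const ip q v z x p k m = ip q (v (k + 1)) * (\<Prod>i=1..k. z (k + 1) - z i) *
      ?L / (ip q (v m) * (\<Prod>i\<in>{1..k} - {m}. z m - z i))"
    by simp
qed

text \<open>For a square matrix a trivial kernel means a nonzero determinant, and the adjugate
  divided by it is an inverse.\<close>

lemma linear_system_solvable:
  fixes u :: "nat \<Rightarrow> nat \<Rightarrow> complex"
  assumes kernel: "\<And>x. (\<And>i. i \<in> {1..k} \<Longrightarrow> (\<Sum>j<k. u i j * x j) = 0) \<Longrightarrow> (\<forall>j<k. x j = 0)"
  shows "\<exists>x. \<forall>i\<in>{1..k}. (\<Sum>j<k. u i j * x j) = b i"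
proof -
  define A where "A = Matrix.mat k k (\<lambda>(i, j). u (Suc i) j)"
  have A: "A \<in> carrier_mat k k" by (simp add: A_def)
  have mult: "vec_index (A *\<^sub>v y) i = (\<Sum>j<k. u (Suc i) j * vec_index y j)" if "y \<in> carrier_vec k" "i < k" for y i
    using that by (simp add: A_def scalar_prod_def atLeast0LessThan)
  have "Determinant.det A \<noteq> 0"
  proof
    assume "Determinant.det A = 0"
    then obtain y where y: "y \<in> carrier_vec k" "y \<noteq> 0\<^sub>v k" "A *\<^sub>v y = 0\<^sub>v k"
      using det_0_iff_vec_prod_zero[OF A] by blast
    have "(\<Sum>j<k. u i j * vec_index y j) = 0" if "i \<in> {1..k}" for i
      using mult[OF y(1), of "i - 1"] y(3) that by auto
    then have "\<forall>j<k. vec_index y j = 0" by (rule kernel)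
    then have "y = 0\<^sub>v k" using y(1) by (intro eq_vecI) auto
    with y(2) show False by simp
  qed
  define d where "d = Determinant.det A"
  have d: "d \<noteq> 0" using \<open>Determinant.det A \<noteq> 0\<close> by (simp add: d_def)
  define y where "y = adj_mat A *\<^sub>v (vec k (\<lambda>i. b (Suc i) / d))"
  have y: "y \<in> carrier_vec k" unfolding y_def using adj_mat(1)[OF A] by simp
  have "A *\<^sub>v y = (A * adj_mat A) *\<^sub>v vec k (\<lambda>i. b (Suc i) / d)"
    unfolding y_def by (rule assoc_mult_mat_vec[symmetric, OF A adj_mat(1)[OF A]]) simp
  also have "\<dots> = vec k (\<lambda>i. b (Suc i))"
    unfolding adj_mat(2)[OF A] d_def[symmetric] using d
    by (intro eq_vecI) (auto simp: scalar_prod_def if_distrib[of "\<lambda>t. t * _"] if_distrib[of "\<lambda>t. _ * t"] if_distrib[of "\<lambda>t. t / _"] cong: if_cong)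
  finally have Ay: "A *\<^sub>v y = vec k (\<lambda>i. b (Suc i))" .
  have "(\<Sum>j<k. u i j * vec_index y j) = b i" if "i \<in> {1..k}" for i
    using mult[OF y, of "i - 1"] that by (auto simp: Ay)
  then show ?thesis by (intro exI[of _ "\<lambda>j. vec_index y j"]) blast
qed

text \<open>\<open>itea_coeffs\<close> is a choice, so its equations hold once a solution is known
  to exist; a trivial kernel supplies one. Kernel vectors are encoded by
  \<open>c k = 0\<close>.\<close>

lemma itea_coeffs_solution:
  assumes "\<And>c. c k = 0 \<Longrightarrow> (\<forall>i\<in>{1..k}. (\<Sum>j\<le>k. c j * itea_u ip q F x p i j) = 0) \<Longrightarrow> (\<forall>j<k. c j = 0)"
  shows "\<forall>i\<in>{1..k}. (\<Sum>j\<le>k. itea_coeffs ip q F x p k j * itea_u ip q F x p i j) = 0"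
proof -
  let ?u = "itea_u ip q F x p"
  have "\<exists>y. \<forall>i\<in>{1..k}. (\<Sum>j<k. ?u i j * y j) = - ?u i k"
  proof (rule linear_system_solvable)
    fix y assume y: "\<And>i. i \<in> {1..k} \<Longrightarrow> (\<Sum>j<k. ?u i j * y j) = 0"
    have "(\<Sum>j\<le>k. (y(k := 0)) j * ?u i j) = 0" if "i \<in> {1..k}" for i
      using y[OF that] by (simp add: lessThan_Suc_atMost[symmetric] mult.commute)
    then have "\<forall>j<k. (y(k := 0)) j = 0" by (intro assms) auto
    then show "\<forall>j<k. y j = 0" by auto
  qed
  then obtain y where y: "\<forall>i\<in>{1..k}. (\<Sum>j<k. ?u i j * y j) = - ?u i k" by blast
  have "\<exists>c. c k = 1 \<and> (\<forall>i\<in>{1..k}. (\<Sum>j<k. ?u i j * c j) = - ?u i k)"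
    using y by (intro exI[of _ "y(k := 1)"]) simp
  from someI_ex[OF this] show ?thesis
    unfolding itea_coeffs_def[symmetric]
    by (simp add: lessThan_Suc_atMost[symmetric] mult.commute)
qed

subsection \<open>Level sets of the Green's function\<close>

text \<open>The values of \<open>g\<close> in the interior of \<open>E\<close> are arbitrary.
  Replaced by 0 they give a function continuous on the whole plane, as \<open>g\<close> vanishes on
  the frontier, and its sublevel sets at positive levels are neighbourhoods of
  \<open>E\<close>.\<close>

definition green_extension :: "complex set \<Rightarrow> (complex \<Rightarrow> real) \<Rightarrow> complex \<Rightarrow> real" where
  "green_extension E g w = (if w \<in> E then 0 else g w)"

locale green_sets =
  fixes E :: "complex set" and g :: "complex \<Rightarrow> real"
  assumes closed: "closed E" and bounded: "bounded E" and green: "green_function_at_infinity E g"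
begin

abbreviation "G \<equiv> green_extension E g"

lemma g_pos: "w \<notin> E \<Longrightarrow> 0 < g w"
  using green by (simp add: green_function_at_infinity_def)

lemma continuous_on_G: "continuous_on S G"
proof -
  have "continuous_on (E \<union> closure (- E)) (\<lambda>w. if w \<in> E then 0 else g w)"
    using green closed
    by (intro continuous_on_cases) (auto simp: green_function_at_infinity_def frontier_closures)
  moreover have "E \<union> closure (- E) = UNIV" using closure_subset[of "- E"] by blast
  ultimately show ?thesis
    using continuous_on_subset[of UNIV _ S] by (simp add: green_extension_def[abs_def])
qed

lemma open_sublevel: "open {w. G w < c}"
  by (intro open_Collect_less continuous_on_G continuous_on_const)

text \<open>Near infinity \<open>g\<close> differs from \<open>ln (cmod w)\<close> by a bounded
  amount, so sublevel sets are bounded.\<close>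

lemma compact_sublevel: "compact {w. G w \<le> c}"
proof -
  obtain \<gamma> where "((\<lambda>w. g w - ln (cmod w)) \<longlongrightarrow> \<gamma>) at_infinity"
    using green by (auto simp: green_function_at_infinity_def)
  moreover have "LIM w at_infinity. ln (cmod w) :> at_top"
    by (rule filterlim_compose[OF ln_at_top filterlim_norm_at_top])
  ultimately have "LIM w at_infinity. (g w - ln (cmod w)) + ln (cmod w) :> at_top"
    by (rule filterlim_tendsto_add_at_top)
  then have "\<forall>\<^sub>F w in at_infinity. c < g w"
    by (simp add: filterlim_at_top_dense)
  then obtain b where b: "\<And>w. b \<le> cmod w \<Longrightarrow> c < g w"
    unfolding eventually_at_infinity by blast
  have "{w. G w \<le> c} \<subseteq> E \<union> cball 0 b"
  proof
    fix w assume "w \<in> {w. G w \<le> c}"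
    then show "w \<in> E \<union> cball 0 b"
      using b[of w] by (cases "b \<le> cmod w"; cases "w \<in> E") (auto simp: green_extension_def)
  qed
  then have "bounded {w. G w \<le> c}"
    using bounded bounded_subset bounded_cball bounded_Un by metis
  moreover have "closed {w. G w \<le> c}"
    by (intro closed_Collect_le continuous_on_G continuous_on_const)
  ultimately show ?thesis by (simp add: compact_eq_bounded_closed)
qed

text \<open>A connected set that avoids the locus cannot cross the value \<open>ln \<rho>\<close>,
  so the component of a point below this value stays in a compact sublevel set and is bounded. This
  makes the decomposition of \<open>F\<close> available on an open sublevel set.\<close>

lemma sublevel_subset_level_interior:
  assumes "1 < \<rho>"
  shows "{w. G w < ln \<rho>} \<subseteq> level_interior E g \<rho>"
proof
  fix w assume w: "w \<in> {w. G w < ln \<rho>}"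
  let ?S = "level_locus E g \<rho>"
  have locus: "y \<in> ?S" if "G y = ln \<rho>" for y
    using that assms by (auto simp: level_locus_def green_extension_def Phi_def split: if_splits)
  have notin: "G y \<noteq> ln \<rho>" if "y \<notin> ?S" for y
    using locus that by blast
  have "w \<notin> ?S"
    using w assms by (auto simp: level_locus_def green_extension_def Phi_def)
  moreover have "bounded (connected_component_set (- ?S) w)"
  proof (rule bounded_subset[OF compact_imp_bounded[OF compact_sublevel]])
    show "connected_component_set (- ?S) w \<subseteq> {y. G y \<le> ln \<rho>}"
    proof
      fix y assume y: "y \<in> connected_component_set (- ?S) w"
      have conn: "connected (G ` connected_component_set (- ?S) w)"
        by (intro connected_continuous_image continuous_on_G connected_connected_component)
      have "w \<in> connected_component_set (- ?S) w"
        using \<open>w \<notin> ?S\<close> by simp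
      moreover have "ln \<rho> \<notin> G ` connected_component_set (- ?S) w"
      proof
        assume "ln \<rho> \<in> G ` connected_component_set (- ?S) w"
        then obtain x where x: "G x = ln \<rho>" "x \<in> connected_component_set (- ?S) w" by force
        then have "x \<in> - ?S" using connected_component_subset by blast
        then show False using notin x(1) by blast
      qed
      ultimately show "y \<in> {y. G y \<le> ln \<rho>}"
        using connectedD_interval[OF conn, of "G w" "G y" "ln \<rho>"] w y by force
    qed
  qed
  ultimately show "w \<in> level_interior E g \<rho>"
    by (simp add: level_interior_def inside_def)
qed

lemma Phi_less_of_level_interior:
  assumes "w \<in> level_interior E g \<rho>" "w \<notin> E" "Phi g w \<le> \<rho>"
  shows "Phi g w < \<rho>"
proof -
  have "w \<notin> level_locus E g \<rho>"
    using assms(1) inside_no_overlap unfolding level_interior_def by blast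
  then show ?thesis using assms(2,3) by (auto simp: level_locus_def)
qed

lemma points_eventually_bounded:
  assumes "\<not> infinity_limit_point_of_sets k xi"
  obtains R where "\<forall>\<^sub>F p in sequentially. \<forall>i\<in>{1..p+k}. cmod (xi p i) \<le> R"
  using assms unfolding infinity_limit_point_of_sets_def not_all not_frequently
  by (auto simp: not_less)

text \<open>The nodes eventually lie in a disc, and the part of the disc outside \<open>X\<close> is
  compact. Each of its points has a neighbourhood that eventually contains no node, and finitely
  many of these suffice.\<close>

lemma points_eventually_in_open:
  assumes lim: "\<forall>w\<in>- E. \<not> limit_point_of_sets k xi w" and inf: "\<not> infinity_limit_point_of_sets k xi"
    and X: "open X" "E \<subseteq> X"
  shows "\<forall>\<^sub>F p in sequentially. \<forall>i\<in>{1..p+k}. xi p i \<in> X"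
proof -
  obtain R where R: "\<forall>\<^sub>F p in sequentially. \<forall>i\<in>{1..p+k}. cmod (xi p i) \<le> R"
    by (rule points_eventually_bounded[OF inf])
  define N where "N = cball 0 R - X"
  have N: "compact N" unfolding N_def using X(1) by (intro compact_diff compact_cball)
  have "\<exists>e>0. \<forall>\<^sub>F p in sequentially. \<forall>i\<in>{1..p+k}. \<not> dist (xi p i) w < e" if "w \<in> N" for w
  proof -
    have "\<not> limit_point_of_sets k xi w" using lim that X(2) unfolding N_def by blast
    then obtain e' where "0 < e'" "\<not> (\<exists>\<^sub>F p in sequentially. \<exists>i\<in>{1..p+k}. dist (xi p i) w < e')"
      unfolding limit_point_of_sets_def by blast
    then show ?thesis unfolding not_frequently by (intro exI[of _ e']) simp
  qed
  then have "\<forall>w\<in>N. \<exists>e. 0 < e \<and> (\<forall>\<^sub>F p in sequentially. \<forall>i\<in>{1..p+k}. \<not> dist (xi p i) w < e)"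
    by blast
  from bchoice[OF this] obtain e where e: "\<forall>w\<in>N. 0 < e w \<and>
      (\<forall>\<^sub>F p in sequentially. \<forall>i\<in>{1..p+k}. \<not> dist (xi p i) w < e w)"
    by blast
  obtain D where D: "D \<subseteq> N" "finite D" "N \<subseteq> (\<Union>w\<in>D. ball w (e w))"
  proof (rule compactE_image[OF N])
    show "N \<subseteq> (\<Union>w\<in>N. ball w (e w))"
    proof
      fix w assume "w \<in> N"
      then show "w \<in> (\<Union>w\<in>N. ball w (e w))" using e centre_in_ball by blast
    qed
  qed auto
  have "\<forall>\<^sub>F p in sequentially. \<forall>w\<in>D. \<forall>i\<in>{1..p+k}. \<not> dist (xi p i) w < e w"
    using D(1,2) e by (intro eventually_ball_finite) blast+
  with R show ?thesis
  proof eventually_elim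
    case (elim p)
    show ?case
    proof (intro ballI, rule ccontr)
      fix i assume i: "i \<in> {1..p+k}" "xi p i \<notin> X"
      then have "xi p i \<in> N" using elim(1) by (simp add: N_def)
      then obtain w where "w \<in> D" "dist (xi p i) w < e w"
        using D(3) by (auto simp: dist_commute)
      then show False using elim(2) i(1) by blast
    qed
  qed
qed

lemma Psi_root_tendsto:
  assumes uni: "\<forall>S. compact S \<and> S \<subseteq> - E \<longrightarrow>
           uniform_limit S (\<lambda>p w. root p (cmod (\<Prod>i=1..p+k. w - xi p i))) (\<lambda>w. \<kappa> * Phi g w) sequentially"
    and w: "w \<notin> E"
  shows "(\<lambda>p. root p (cmod (Psi k xi p w))) \<longlonglongrightarrow> \<kappa> * Phi g w"
proof -
  have "uniform_limit {w} (\<lambda>p w. root p (cmod (\<Prod>i=1..p+k. w - xi p i))) (\<lambda>w. \<kappa> * Phi g w) sequentially"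
    using w by (intro uni[rule_format]) auto
  from tendsto_uniform_limitI[OF this, of w] show ?thesis
    by (simp add: Psi_def psi_def)
qed

text \<open>Far from the interpolation points the product is at least 1 in modulus, so the limit is positive
  there.\<close>

lemma growth_constant_positive:
  assumes uni: "\<forall>S. compact S \<and> S \<subseteq> - E \<longrightarrow>
           uniform_limit S (\<lambda>p w. root p (cmod (\<Prod>i=1..p+k. w - xi p i))) (\<lambda>w. \<kappa> * Phi g w) sequentially"
    and inf: "\<not> infinity_limit_point_of_sets k xi"
  shows "0 < \<kappa>"
proof -
  obtain R where R: "\<forall>\<^sub>F p in sequentially. \<forall>i\<in>{1..p+k}. cmod (xi p i) \<le> R"
    by (rule points_eventually_bounded[OF inf])
  obtain R' where R': "\<And>w. w \<in> E \<Longrightarrow> cmod w \<le> R'"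
    using bounded unfolding bounded_iff by blast
  define w where "w = complex_of_real (\<bar>R\<bar> + \<bar>R'\<bar> + 1)"
  have cw: "cmod w = \<bar>R\<bar> + \<bar>R'\<bar> + 1" unfolding w_def norm_of_real by simp
  then have "w \<notin> E" using R'[of w] by auto
  have "\<forall>\<^sub>F p in sequentially. 1 \<le> root p (cmod (Psi k xi p w))"
    using R eventually_gt_at_top[of 0]
  proof eventually_elim
    case (elim p)
    have "1 \<le> cmod (w - xi p i)" if "i \<in> {1..p+k}" for i
      using bspec[OF elim(1) that] cw norm_triangle_ineq2[of w "xi p i"] by linarith
    then have "1 \<le> cmod (Psi k xi p w)"
      unfolding Psi_def psi_def prod_norm[symmetric] by (intro prod_ge_1) auto
    then show ?case using elim(2) by simp
  qed
  then have "1 \<le> \<kappa> * Phi g w"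
    by (intro tendsto_lowerbound[OF Psi_root_tendsto[OF uni \<open>w \<notin> E\<close>]]) auto
  moreover have "0 < Phi g w" by (simp add: Phi_def)
  ultimately show ?thesis
    using zero_less_mult_pos2[of \<kappa> "Phi g w"] by linarith
qed

end

text \<open>Provides the assumption \<open>remainder\<close> of \<open>itea_asymptotics\<close>. The
  chain lies where \<open>Phi g w > \<sigma>'\<close>, strictly above \<sigma>, and the uniform
  limit then makes \<open>(\<kappa> * \<sigma>) ^ p\<close> a lower bound for the node polynomial on
  the whole chain.\<close>

lemma (in green_sets) itea_remainder:
  fixes ip :: "complex^'n \<Rightarrow> complex^'n \<Rightarrow> complex" and F \<Theta> :: "complex \<Rightarrow> complex^'n"
  assumes ip: "is_inner_product ip" and "1 \<le> k" "k \<le> \<mu>" and \<kappa>: "0 < \<kappa>" and \<sigma>: "1 < \<sigma>" "\<sigma> < \<rho>"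
    and inj: "inj_on z {1..\<mu>}" and zE: "\<And>s. s \<in> {1..\<mu>} \<Longrightarrow> z s \<notin> E"
    and \<Theta>: "vec_analytic_on \<Theta> (level_interior E g \<rho>)"
    and F: "\<forall>w \<in> level_interior E g \<rho> - z ` {1..\<mu>}.
           F w = (\<Sum>s=1..\<mu>. (1 / (w - z s)) *s v s) + \<Theta> w"
    and consec: "\<forall>p\<ge>1. equal_points_consecutive (p + k) (xi p)"
    and lim: "\<forall>w\<in>- E. \<not> limit_point_of_sets k xi w" and inf: "\<not> infinity_limit_point_of_sets k xi"
    and uni: "\<forall>S. compact S \<and> S \<subseteq> - E \<longrightarrow>
           uniform_limit S (\<lambda>p w. root p (cmod (\<Prod>i=1..p+k. w - xi p i))) (\<lambda>w. \<kappa> * Phi g w) sequentially"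
  shows "\<exists>C\<ge>0. \<exists>\<Gamma>. compact \<Gamma> \<and> (\<forall>\<^sub>F p in sequentially. \<forall>c m B.
      m \<in> {1..k} \<longrightarrow> (\<forall>i\<in>{1..k}. (\<Sum>j\<le>k. c j * itea_u ip q F (xi p) p i j) = 0) \<longrightarrow> 0 \<le> B \<longrightarrow>
      (\<forall>w\<in>\<Gamma>. cmod (\<Sum>j\<le>k. c j * psi (xi p) 1 j w) \<le> B) \<longrightarrow>
      cmod (ip q (v m) * (\<Sum>j\<le>k. c j * psi (xi p) 1 j (z m)) / Psi k xi p (z m) +
        (\<Sum>s=k+1..\<mu>. ip q (v s) * (\<Sum>j\<le>k. c j * psi (xi p) 1 j (z s)) *
          poly (lagrange_poly z k m) (z s) / Psi k xi p (z s))) \<le> C * B / (\<kappa> * \<sigma>) ^ p)"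
proof -
  obtain \<sigma>' where \<sigma>': "\<sigma> < \<sigma>'" "\<sigma>' < \<rho>" using dense[OF \<sigma>(2)] by blast
  have "1 < \<sigma>'" "1 < \<rho>" using \<sigma> \<sigma>' by linarith+
  define K D where "K = {w. G w \<le> ln \<sigma>'}" and "D = {w. G w < ln \<rho>}"
  have "ln \<sigma>' < ln \<rho>" using \<open>1 < \<sigma>'\<close> \<sigma>' by simp
  then have KD: "K \<subseteq> D" by (auto simp: K_def D_def)
  have DL: "D \<subseteq> level_interior E g \<rho>"
    unfolding D_def by (rule sublevel_subset_level_interior[OF \<open>1 < \<rho>\<close>])
  have "compact K" "open D"
    unfolding K_def D_def by (rule compact_sublevel open_sublevel)+
  then obtain \<Gamma> where supp: "chain_support \<Gamma> \<subseteq> D - K" and Cauchy: "\<forall>h z j. h holomorphic_on D \<longrightarrow>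
      z \<in> interior K \<longrightarrow> (deriv ^^ j) h z / fact j = chain_integral \<Gamma> (\<lambda>w. h w / (w - z) ^ Suc j)"
    using KD by (rule Cauchy_chain)
  \<comment> \<open>A positive level not above any pole nor above \<open>ln \<sigma>'\<close>: the
    sublevel set \<open>X\<close> contains \<open>E\<close>, and so eventually all nodes, but no
    pole and no point of the chain.\<close>
  define \<eta> where "\<eta> = Min (insert (ln \<sigma>') ((\<lambda>s. g (z s)) ` {1..\<mu>}))"
  have \<eta>_pos: "0 < \<eta>"
    unfolding \<eta>_def using \<open>1 < \<sigma>'\<close> g_pos[OF zE] by (subst Min_gr_iff) auto
  have \<eta>_le: "\<eta> \<le> ln \<sigma>'"
    unfolding \<eta>_def by (intro Min_le) auto
  have \<eta>_le_g: "\<eta> \<le> g (z s)" if "s \<in> {1..\<mu>}" for s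
    unfolding \<eta>_def using that by (intro Min_le) auto
  define X where "X = {w. G w < \<eta>}"
  have X: "open X" unfolding X_def by (rule open_sublevel)
  have EX: "E \<subseteq> X" using \<eta>_pos by (auto simp: X_def green_extension_def)
  have XK: "X \<subseteq> interior K"
    using \<eta>_le by (intro interior_maximal X) (auto simp: X_def K_def)
  have zX: "z s \<notin> X" if "s \<in> {1..\<mu>}" for s
    using \<eta>_le_g[OF that] zE[OF that] by (simp add: X_def green_extension_def)
  have XS: "X \<inter> (chain_support \<Gamma> \<union> z ` {1..\<mu>}) = {}"
    using XK interior_subset supp zX by blast
  have XD: "X \<subseteq> D" using XK interior_subset KD by blast
  have EK: "E \<subseteq> K" using EX XK interior_subset by blast

  let ?\<theta> = "\<lambda>w. ip q (\<Theta> w)"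
  have \<Theta>D: "(\<lambda>w. vec_nth (\<Theta> w) c) holomorphic_on D" for c
    using \<Theta> DL unfolding vec_analytic_on_def
    by (blast intro: analytic_imp_holomorphic analytic_on_subset)
  have \<theta>D: "?\<theta> holomorphic_on D"
  proof -
    have "(\<lambda>w. \<Sum>c\<in>UNIV. ip q (axis c 1) * vec_nth (\<Theta> w) c) holomorphic_on D"
      by (intro holomorphic_on_sum holomorphic_on_mult holomorphic_on_const \<Theta>D)
    then show ?thesis by (simp only: inner_product_expansion[OF ip, symmetric])
  qed
  have cont\<theta>: "continuous_on (chain_support \<Gamma>) ?\<theta>"
    using holomorphic_on_imp_continuous_on[OF \<theta>D] supp continuous_on_subset by blast
  have FX: "(\<lambda>w. vec_nth (F w) c) holomorphic_on X" for c
  proof (rule holomorphic_transform)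
    show "(\<lambda>w. (\<Sum>s=1..\<mu>. 1 / (w - z s) * vec_nth (v s) c) + vec_nth (\<Theta> w) c) holomorphic_on X"
      using zX by (intro holomorphic_intros holomorphic_on_subset[OF \<Theta>D XD]) auto
    fix w assume "w \<in> X"
    then have "F w = (\<Sum>s=1..\<mu>. (1 / (w - z s)) *s v s) + \<Theta> w"
      using XS XD DL by (intro F[rule_format]) blast
    then show "(\<Sum>s=1..\<mu>. 1 / (w - z s) * vec_nth (v s) c) + vec_nth (\<Theta> w) c = vec_nth (F w) c"
      by simp
  qed
  have F': "F w = (\<Sum>s=1..\<mu>. (1 / (w - z s)) *s v s) + \<Theta> w" if "w \<in> X" for w
    using XS XD DL that by (intro F[rule_format]) blast

  have pts: "\<forall>\<^sub>F p in sequentially. \<forall>i\<in>{1..p+k}. xi p i \<in> X"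
    by (rule points_eventually_in_open[OF lim inf X EX])
  have low: "\<forall>\<^sub>F p in sequentially. \<forall>w\<in>chain_support \<Gamma>. (\<kappa> * \<sigma>) ^ p \<le> cmod (Psi k xi p w)"
  proof -
    have "uniform_limit (chain_support \<Gamma>) (\<lambda>p w. root p (cmod (\<Prod>i=1..p+k. w - xi p i)))
        (\<lambda>w. \<kappa> * Phi g w) sequentially"
      using supp EK by (intro uni[rule_format]) (auto simp: compact_chain_support)
    \<comment> \<open>The tolerance is the gap between \<open>\<kappa> * \<sigma>'\<close> and
      \<open>\<kappa> * \<sigma>\<close>.\<close>
    then have "\<forall>\<^sub>F p in sequentially. \<forall>w\<in>chain_support \<Gamma>.
        dist (root p (cmod (\<Prod>i=1..p+k. w - xi p i))) (\<kappa> * Phi g w) < \<kappa> * (\<sigma>' - \<sigma>)"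
      using \<kappa> \<sigma>' by (intro uniform_limitD) auto
    then show ?thesis using eventually_gt_at_top[of 0]
    proof eventually_elim
      case (elim p)
      show ?case
      proof
        fix w assume w: "w \<in> chain_support \<Gamma>"
        then have "w \<notin> E" "ln \<sigma>' < G w" using supp EK by (auto simp: K_def)
        then have "exp (ln \<sigma>') < Phi g w" by (simp add: green_extension_def Phi_def)
        then have "\<kappa> * \<sigma>' < \<kappa> * Phi g w" using \<open>1 < \<sigma>'\<close> \<kappa> by simp
        then have "\<kappa> * \<sigma> \<le> root p (cmod (Psi k xi p w))"
          using bspec[OF elim(1) w] by (simp add: Psi_def psi_def dist_real_def right_diff_distrib abs_less_iff)
        then have "(\<kappa> * \<sigma>) ^ p \<le> root p (cmod (Psi k xi p w)) ^ p"
          using \<kappa> \<sigma> by (intro power_mono) auto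
        then show "(\<kappa> * \<sigma>) ^ p \<le> cmod (Psi k xi p w)"
          using elim(2) by (simp add: real_root_pow_pos2)
      qed
    qed
  qed

  have "continuous_on (chain_support \<Gamma>) (\<lambda>w. cmod (?\<theta> w) * (\<Sum>m=1..k. cmod (poly (lagrange_poly z k m) w)))"
    by (intro continuous_intros cont\<theta>)
  then have "bounded ((\<lambda>w. cmod (?\<theta> w) * (\<Sum>m=1..k. cmod (poly (lagrange_poly z k m) w))) ` chain_support \<Gamma>)"
    by (intro compact_imp_bounded compact_continuous_image compact_chain_support)
  then obtain T0 where T0: "\<And>w. w \<in> chain_support \<Gamma> \<Longrightarrow>
      norm (cmod (?\<theta> w) * (\<Sum>m=1..k. cmod (poly (lagrange_poly z k m) w))) \<le> T0"
    unfolding bounded_iff by auto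
  define T where "T = \<bar>T0\<bar>"
  have T: "cmod (?\<theta> w) * cmod (poly (lagrange_poly z k m) w) \<le> T"
    if "w \<in> chain_support \<Gamma>" "m \<in> {1..k}" for w m
  proof -
    have "cmod (?\<theta> w) * cmod (poly (lagrange_poly z k m) w) \<le>
        cmod (?\<theta> w) * (\<Sum>m=1..k. cmod (poly (lagrange_poly z k m) w))"
      using that(2) by (intro mult_left_mono member_le_sum) auto
    then show ?thesis using T0[OF that(1)] by (simp add: T_def)
  qed
  have "0 \<le> T" by (simp add: T_def)
  obtain C where C: "C \<ge> 0" "\<And>\<phi> B. \<lbrakk>continuous_on (chain_support \<Gamma>) \<phi>; 0 \<le> B;
      \<And>w. w \<in> chain_support \<Gamma> \<Longrightarrow> cmod (\<phi> w) \<le> B\<rbrakk> \<Longrightarrow> cmod (chain_integral \<Gamma> \<phi>) \<le> C * B"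
    using chain_integral_bound[of \<Gamma>] by blast
  show ?thesis
  proof (intro exI conjI)
    show "0 \<le> C * T" using C(1) \<open>0 \<le> T\<close> by simp
    show "compact (chain_support \<Gamma>)" by (rule compact_chain_support)
    show "\<forall>\<^sub>F p in sequentially. \<forall>c m B.
      m \<in> {1..k} \<longrightarrow> (\<forall>i\<in>{1..k}. (\<Sum>j\<le>k. c j * itea_u ip q F (xi p) p i j) = 0) \<longrightarrow> 0 \<le> B \<longrightarrow>
      (\<forall>w\<in>chain_support \<Gamma>. cmod (\<Sum>j\<le>k. c j * psi (xi p) 1 j w) \<le> B) \<longrightarrow>
      cmod (ip q (v m) * (\<Sum>j\<le>k. c j * psi (xi p) 1 j (z m)) / Psi k xi p (z m) +
        (\<Sum>s=k+1..\<mu>. ip q (v s) * (\<Sum>j\<le>k. c j * psi (xi p) 1 j (z s)) *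
          poly (lagrange_poly z k m) (z s) / Psi k xi p (z s))) \<le> C * T * B / (\<kappa> * \<sigma>) ^ p"
      \<comment> \<open>\<open>p \<ge> k\<close> keeps the indices of the divided differences in
        order and, with \<open>1 \<le> k\<close>, gives the \<open>p \<ge> 1\<close> asked for by
        \<open>consec\<close>.\<close>
      using pts low eventually_ge_at_top[of k]
    proof eventually_elim
      case (elim p)
      show ?case
      proof (intro allI impI)
        fix c m B
        assume m: "m \<in> {1..k}"
          and hom: "\<forall>i\<in>{1..k}. (\<Sum>j\<le>k. c j * itea_u ip q F (xi p) p i j) = 0" and B: "0 \<le> B"
          and WB: "\<forall>w\<in>chain_support \<Gamma>. cmod (\<Sum>j\<le>k. c j * psi (xi p) 1 j w) \<le> B"
        let ?W = "\<lambda>w. \<Sum>j\<le>k. c j * psi (xi p) 1 j w"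
        let ?L = "poly (lagrange_poly z k m)"
        have x: "equal_points_consecutive (p + k) (xi p)" "\<And>i. i \<in> {1..p+k} \<Longrightarrow> xi p i \<in> X"
          using consec elim(1,3) \<open>1 \<le> k\<close> by auto
        have nz: "psi (xi p) 1 (p + k) w \<noteq> 0" if "w \<in> chain_support \<Gamma> \<union> z ` {1..\<mu>}" for w
        proof (rule psi_nonzero)
          fix i assume "i \<in> {1..p + k}"
          then show "w \<noteq> xi p i" using x(2)[of i] XS that by blast
        qed
        have "itea_u ip q F (xi p) p i j = residue_functional \<Gamma> ?\<theta> (\<lambda>s. ip q (v s)) z \<mu>
            (\<lambda>w. psi (xi p) 1 j w * psi (xi p) (p + i + 1) (p + k) w / psi (xi p) 1 (p + k) w)"
          if "1 \<le> i" "i \<le> k" "j \<le> k" for i j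
        proof (rule itea_u_residue_functional[OF ip X XS FX F' _ cont\<theta> _ x that elim(3)])
          show "?\<theta> holomorphic_on X" using \<theta>D XD by (rule holomorphic_on_subset)
          show "(deriv ^^ j) ?\<theta> \<xi> / fact j = chain_integral \<Gamma> (\<lambda>w. ?\<theta> w / (w - \<xi>) ^ Suc j)"
            if "\<xi> \<in> X" for \<xi> j
            using Cauchy \<theta>D XK that by blast
        qed
        from itea_residue_identity[OF cont\<theta> nz this _ m \<open>k \<le> \<mu>\<close> inj, of c] hom
        have "ip q (v m) * ?W (z m) / Psi k xi p (z m) +
            (\<Sum>s=k+1..\<mu>. ip q (v s) * ?W (z s) * ?L (z s) / Psi k xi p (z s)) =
          chain_integral \<Gamma> (\<lambda>w. ?\<theta> w * (?W w * ?L w / Psi k xi p w))"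
          unfolding Psi_def by blast
        also have "cmod \<dots> \<le> C * (T * B / (\<kappa> * \<sigma>) ^ p)"
        proof (rule C(2))
          show "continuous_on (chain_support \<Gamma>) (\<lambda>w. ?\<theta> w * (?W w * ?L w / Psi k xi p w))"
            using nz unfolding Psi_def
            by (intro continuous_on_mult continuous_on_divide cont\<theta> continuous_on_sum continuous_on_const
                continuous_on_psi continuous_on_id continuous_on_poly) auto
          show "0 \<le> T * B / (\<kappa> * \<sigma>) ^ p" using \<open>0 \<le> T\<close> B \<kappa> \<sigma> by simp
          fix w assume w: "w \<in> chain_support \<Gamma>"
          have "cmod (?\<theta> w * (?W w * ?L w / Psi k xi p w)) =
              cmod (?\<theta> w) * cmod (?L w) * cmod (?W w) / cmod (Psi k xi p w)"
            by (simp add: norm_mult norm_divide mult_ac)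
          also have "\<dots> \<le> T * B / (\<kappa> * \<sigma>) ^ p"
          proof (rule frac_le)
            show "cmod (?\<theta> w) * cmod (?L w) * cmod (?W w) \<le> T * B"
              using T[OF w m] WB w \<open>0 \<le> T\<close> by (intro mult_mono) auto
            show "(\<kappa> * \<sigma>) ^ p \<le> cmod (Psi k xi p w)" using elim(2) w by blast
          qed (use \<open>0 \<le> T\<close> B \<kappa> \<sigma> in auto)
          finally show "cmod (?\<theta> w * (?W w * ?L w / Psi k xi p w)) \<le> T * B / (\<kappa> * \<sigma>) ^ p" .
        qed
        finally show "cmod (ip q (v m) * ?W (z m) / Psi k xi p (z m) +
            (\<Sum>s=k+1..\<mu>. ip q (v s) * ?W (z s) * ?L (z s) / Psi k xi p (z s))) \<le> C * T * B / (\<kappa> * \<sigma>) ^ p"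
          by simp
      qed
    qed
  qed
qed

lemma is_pole_not_vec_analytic:
  assumes "is_pole F w" "vec_analytic_on F E" "w \<in> E"
  shows False
proof -
  have "isCont (\<lambda>w. vec_nth (F w) c) w" for c
    using assms(2,3) unfolding vec_analytic_on_def
    by (meson analytic_on_imp_differentiable_at field_differentiable_imp_continuous_at)
  then have "(F \<longlongrightarrow> F w) (at w)"
    by (intro vec_tendstoI) (simp add: isCont_def)
  then show False
    using assms(1) not_tendsto_and_filterlim_at_infinity[OF at_neq_bot] unfolding is_pole_def by blast
qed

theorem theorem6p3:
  fixes E :: "complex set" and g :: "complex \<Rightarrow> real" and \<rho> :: real
    and k \<mu> r :: nat
    and xi :: "nat \<Rightarrow> nat \<Rightarrow> complex"
    and ip :: "complex^'n \<Rightarrow> complex^'n \<Rightarrow> complex" and q :: "complex^'n"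
    and F \<Theta> :: "complex \<Rightarrow> complex^'n"
    and z :: "nat \<Rightarrow> complex" and v :: "nat \<Rightarrow> complex^'n"
    and zp :: "nat \<Rightarrow> nat \<Rightarrow> complex"
  assumes "closed E" and "bounded E"
    and "green_function_at_infinity E g"
    and "1 \<le> k"
    and "\<forall>p\<ge>1. equal_points_consecutive (p + k) (xi p)"
    and "\<forall>w\<in>- E. \<not> limit_point_of_sets k xi w"
    and "\<not> infinity_limit_point_of_sets k xi"
    and "\<forall>S. compact S \<and> S \<subseteq> - E \<longrightarrow>
           uniform_limit S (\<lambda>p w. root p (cmod (\<Prod>i=1..p+k. w - xi p i)))
             (\<lambda>w. log_capacity E * Phi g w) sequentially"
    and "is_inner_product ip" and "q \<noteq> 0"
    and "1 < \<rho>"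
    and "vec_analytic_on F E"
    and "vec_meromorphic_on F (level_interior E g \<rho>)"
    and "inj_on z {1..\<mu>}"
    and "{w \<in> level_interior E g \<rho>. is_pole F w} = z ` {1..\<mu>}"
    and "\<forall>s\<in>{1..\<mu>}. v s \<noteq> 0"
    and "vec_analytic_on \<Theta> (level_interior E g \<rho>)"
    and "\<forall>w \<in> level_interior E g \<rho> - z ` {1..\<mu>}.
           F w = (\<Sum>s=1..\<mu>. (1 / (w - z s)) *s v s) + \<Theta> w"
    and "\<forall>s t. 1 \<le> s \<and> s \<le> t \<and> t \<le> \<mu> \<longrightarrow> Phi g (z s) \<le> Phi g (z t)"
    and "\<forall>s\<in>{1..\<mu>}. Phi g (z s) \<le> \<rho>"
    and "(\<Prod>i=1..k. ip q (v i)) \<noteq> 0"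
    and "k < \<mu> \<Longrightarrow>
           1 \<le> r \<and> k + r \<le> \<mu> \<and>
           Phi g (z k) < Phi g (z (k + 1)) \<and>
           (\<forall>j\<in>{1..r}. Phi g (z (k + j)) = Phi g (z (k + 1))) \<and>
           Phi g (z (k + r)) < (if k + r < \<mu> then Phi g (z (k + r + 1)) else \<rho>)"
    and "\<forall>\<^sub>F p in sequentially. \<forall>w. itea_V ip q F (xi p) p k w = (\<Prod>m=1..k. w - zp p m)"
    and "\<forall>m\<in>{1..k}. (\<lambda>p. zp p m) \<longlonglongrightarrow> z m"
  shows
    "(k < \<mu> \<longrightarrow>
        (\<forall>m\<in>{1..k}.
           (\<forall>Psi_t :: nat \<Rightarrow> complex.
              (\<forall>p\<ge>1. cmod (Psi_t p) = Min ((\<lambda>j. cmod (Psi k xi p (z (k + j)))) ` {1..r})) \<longrightarrow>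
              (\<lambda>p. zp p m - z m) \<in> O[sequentially](\<lambda>p. Psi k xi p (z m) / Psi_t p)) \<and>
           limsup (\<lambda>p. ereal (root p (cmod (zp p m - z m))))
             \<le> ereal (Phi g (z m) / Phi g (z (k + 1))) \<and>
           (\<forall>p0\<ge>1. r = 1 \<and> T_det ip q v z (xi p0) p0 k (omit m) \<noteq> 0 \<longrightarrow>
              (\<lambda>p. zp p m - z m) \<sim>[sequentially]
              (\<lambda>p. C_const ip q v z (xi p0) p0 k m *
                     (Psi k xi p (z m) / Psi k xi p (z (k + 1))))))) \<and>
     (k = \<mu> \<longrightarrow>
        (\<forall>m\<in>{1..k}.
           limsup (\<lambda>p. ereal (root p (cmod (zp p m - z m)))) \<le> ereal (Phi g (z m) / \<rho>)))"
proof -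
  interpret S: green_sets E g
    by unfold_locales (fact assms(1,2,3))+
  define \<kappa> where "\<kappa> = log_capacity E"
  define u where "u p = itea_u ip q F (xi p) p" for p
  note uni = assms(8)[folded \<kappa>_def]
  note inj = assms(14) and F = assms(18)
  have \<kappa>: "0 < \<kappa>"
    by (rule S.growth_constant_positive[OF uni assms(7)])
  have zL: "z s \<in> level_interior E g \<rho>" "is_pole F (z s)" if "s \<in> {1..\<mu>}" for s
    using assms(15) that by blast+
  \<comment> \<open>Analyticity of \<open>F\<close> on \<open>E\<close> keeps the poles out of
    \<open>E\<close>, so \<open>g\<close> is positive at them.\<close>
  have zE: "z s \<notin> E" if "s \<in> {1..\<mu>}" for s
    using is_pole_not_vec_analytic[OF zL(2)[OF that] assms(12)] by blast
  have Phi_less: "Phi g (z s) < \<rho>" if "s \<in> {1..\<mu>}" for s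
    using S.Phi_less_of_level_interior[OF zL(1)[OF that] zE[OF that]] assms(20) that by blast
  have a_nz: "ip q (v m) \<noteq> 0" if "m \<in> {1..k}" for m
    using assms(21) that by (auto simp: prod_zero_iff)
  have asymptotics: "itea_asymptotics k \<mu> \<kappa> \<rho> (Phi g) xi (\<lambda>s. ip q (v s)) z u" if "k \<le> \<mu>"
  proof
    show "1 < Phi g (z s)" if "s \<in> {1..\<mu>}" for s
      using S.g_pos[OF zE[OF that]] by (simp add: Phi_def)
    show "k < \<mu> \<Longrightarrow> Phi g (z k) < Phi g (z (k + 1))"
      using assms(22) by blast
    show "(\<lambda>p. root p (cmod (Psi k xi p (z s)))) \<longlonglongrightarrow> \<kappa> * Phi g (z s)" if "s \<in> {1..\<mu>}" for s
      by (rule S.Psi_root_tendsto[OF uni zE[OF that]])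
    show "\<exists>C\<ge>0. \<exists>\<Gamma>. compact \<Gamma> \<and> (\<forall>\<^sub>F p in sequentially. \<forall>c m B.
      m \<in> {1..k} \<longrightarrow> (\<forall>i\<in>{1..k}. (\<Sum>j\<le>k. c j * u p i j) = 0) \<longrightarrow> 0 \<le> B \<longrightarrow>
      (\<forall>w\<in>\<Gamma>. cmod (\<Sum>j\<le>k. c j * psi (xi p) 1 j w) \<le> B) \<longrightarrow>
      cmod (ip q (v m) * (\<Sum>j\<le>k. c j * psi (xi p) 1 j (z m)) / Psi k xi p (z m) +
        (\<Sum>s=k+1..\<mu>. ip q (v s) * (\<Sum>j\<le>k. c j * psi (xi p) 1 j (z s)) *
          poly (lagrange_poly z k m) (z s) / Psi k xi p (z s))) \<le> C * B / (\<kappa> * \<sigma>) ^ p)"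
      if "1 < \<sigma>" "\<sigma> < \<rho>" for \<sigma>
      unfolding u_def
      by (rule S.itea_remainder[OF assms(9,4) \<open>k \<le> \<mu>\<close> \<kappa> that inj zE assms(17) F assms(5,6,7) uni])
  qed (use assms(4,19) that \<kappa> inj Phi_less a_nz in auto)
  define c where "c p = itea_coeffs ip q F (xi p) p k" for p
  have zeros: "itea_zeros k \<mu> \<kappa> \<rho> (Phi g) xi (\<lambda>s. ip q (v s)) z u c zp" if "k \<le> \<mu>"
  proof -
    interpret A: itea_asymptotics k \<mu> \<kappa> \<rho> "Phi g" xi "\<lambda>s. ip q (v s)" z u
      by (rule asymptotics[OF that])
    show ?thesis
    proof
      show "\<forall>\<^sub>F p in sequentially. A.homogeneous p (c p)"
        using A.trivial_kernel
      proof eventually_elim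
        case (elim p)
        then show ?case
          unfolding A.homogeneous_def c_def u_def by (intro itea_coeffs_solution) blast
      qed
      show "\<forall>\<^sub>F p in sequentially. \<forall>w. A.W p (c p) w = (\<Prod>m=1..k. w - zp p m)"
        using assms(23) unfolding itea_V_def A.W_def c_def .
      show "(\<lambda>p. zp p m) \<longlonglongrightarrow> z m" if "m \<in> {1..k}" for m
        using assms(24) that by blast
    qed
  qed
  show ?thesis
  proof (intro conjI impI ballI allI)
    fix m assume km: "k = \<mu>" and m: "m \<in> {1..k}"
    interpret Z: itea_zeros k \<mu> \<kappa> \<rho> "Phi g" xi "\<lambda>s. ip q (v s)" z u c zp
      using km by (intro zeros) simp
    show "limsup (\<lambda>p. ereal (root p (cmod (zp p m - z m)))) \<le> ereal (Phi g (z m) / \<rho>)"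
      using Z.limsup_error[OF m] unfolding Z.\<tau>_def using km by (simp only: less_irrefl if_False)
  next
    fix m assume km: "k < \<mu>" and m: "m \<in> {1..k}"
    interpret Z: itea_zeros k \<mu> \<kappa> \<rho> "Phi g" xi "\<lambda>s. ip q (v s)" z u c zp
      using km by (intro zeros) simp
    show "limsup (\<lambda>p. ereal (root p (cmod (zp p m - z m)))) \<le> ereal (Phi g (z m) / Phi g (z (k + 1)))"
      using Z.limsup_error[OF m] unfolding Z.\<tau>_def if_P[OF km] .
    note gap = assms(22)[OF km]
    interpret Z: itea_zeros_gap k \<mu> \<kappa> \<rho> "Phi g" xi "\<lambda>s. ip q (v s)" z u c zp r
      by unfold_locales (use gap in auto)
    show "(\<lambda>p. zp p m - z m) \<in> O(\<lambda>p. Psi k xi p (z m) / Psi_t p)"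
      if Psi_t: "\<forall>p\<ge>1. cmod (Psi_t p) = Min ((\<lambda>j. cmod (Psi k xi p (z (k + j)))) ` {1..r})"
      for Psi_t :: "nat \<Rightarrow> complex"
    proof -
      obtain C where C: "\<forall>\<^sub>F p in sequentially. cmod (zp p m - z m) \<le>
          C * (cmod (Psi k xi p (z m)) / Min ((\<lambda>j. cmod (Psi k xi p (z (k + j)))) ` {1..r}))"
        by (rule Z.error_le_min[OF m])
      show ?thesis
      proof (rule bigoI)
        show "\<forall>\<^sub>F p in sequentially. norm (zp p m - z m) \<le> C * norm (Psi k xi p (z m) / Psi_t p)"
          using C eventually_ge_at_top[of 1]
        proof eventually_elim
          case (elim p)
          then show ?case using Psi_t by (simp only: norm_divide)
        qed
      qed
    qed
    \<comment> \<open>The determinants are written with the nodes of an arbitrary \<open>p0\<close>;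
      the formula \<open>C\<close> below shows that the constant is the same for all of
      them.\<close>
    fix p0 assume "1 \<le> p0" and T: "r = 1 \<and> T_det ip q v z (xi p0) p0 k (omit m) \<noteq> 0"
    let ?C = "C_const ip q v z (xi p0) p0 k m"
    have "k + 1 \<in> {1..\<mu>}" using km by auto
    have C: "?C = ip q (v (k + 1)) * (\<Prod>i=1..k. z (k + 1) - z i) *
        poly (lagrange_poly z k m) (z (k + 1)) / (ip q (v m) * Z.pole_product m)"
      and ak: "ip q (v (k + 1)) \<noteq> 0"
      unfolding Z.pole_product_def using C_const_eq[of m k z ip q v "xi p0" p0, OF m Z.inj_k a_nz[OF m]] T by blast+
    have neq: "z (k + 1) \<noteq> z i" if "i \<in> {1..k}" for i
      using inj_onD[OF inj, of "k + 1" i] that km by auto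
    have neq': "z m \<noteq> z i" if "i \<in> {1..k} - {m}" for i
      using inj_onD[OF Z.inj_k, of m i] that m by auto
    \<comment> \<open>A nonzero constant is what turns the limit of the ratio into an asymptotic
      equivalence; \<open>ak\<close> and the distinctness of the poles provide it.\<close>
    have nz: "?C \<noteq> 0"
      unfolding C poly_lagrange_poly using ak a_nz[OF m] Z.pole_product_nonzero[OF m] neq neq'
      by (auto simp: prod_zero_iff)
    have "(\<lambda>p. (zp p m - z m) / (Psi k xi p (z m) / Psi k xi p (z (k + 1)))) \<longlonglongrightarrow> ?C"
      using Z.error_ratio_tendsto[OF m] T unfolding C by simp
    from asymp_equivI'_const[OF this nz]
    show "(\<lambda>p. zp p m - z m) \<sim>[sequentially]
        (\<lambda>p. ?C * (Psi k xi p (z m) / Psi k xi p (z (k + 1))))" .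
  qed
qed

end
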